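(* Consider one of the two models (the massive Thirring model or the massive Gross--Neveu model), let $\mathcal{O}\subset(-1,1)$ be the existence interval of its line solitary waves, namely $\mathcal{O}=(-1,1)$ for the massive Thirring model and $\mathcal{O}=(0,1)$ for the massive Gross--Neveu model. For every $\omega\in\mathcal{O}$ there exists $p_0>0$ such that for every $p$ with $0<|p|<p_0$ the spectral stability problem $$i\lambda\sigma\mathbf{U}=(D_\omega+E_p+W_\omega)\mathbf{U}$$ of that model admits at least one eigenvalue $\lambda$ with $\mathrm{Re}(\lambda)>0$. Moreover, up to a suitable normalization, as $p\to0$ the corresponding eigenvector $\mathbf{U}$ converges in $L^2(\mathbb{R})$ to $\mathbf{U}_t=\partial_x\mathbf{U}_\omega$ for the massive Thirring model and to $\mathbf{U}_g=i\sigma\mathbf{U}_\omega$ for the massive Gross--Neveu model. Simultaneously, for such $p$, there exists at least one pair of purely imaginary eigenvalues $\lambda$ of the same spectral stability problem, and the corresponding eigenvector $\mathbf{U}$ converges (up to normalization) as $p\to0$ to the other of these two vectors, i.e. to $\mathbf{U}_g$ for the massive Thirring model and to $\mathbf{U}_t$ for the massive Gross--Neveu model.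
   Context: Notation. $\mu=\sqrt{1-\omega^2}$; $\mathbf{U}=(u_1,u_2,v_1,v_2)^t$; $\sigma=\mathrm{diag}(1,-1,1,-1)$; $\mathbf{U}_\omega=(U_\omega,\bar U_\omega,\bar U_\omega,U_\omega)^t$, where $U_\omega:\mathbb{R}\to\mathbb{C}$ is the soliton profile given below. The operator $D_\omega+E_p+W_\omega$ acts in $L^2(\mathbb{R},\mathbb{C}^4)$ with domain $H^1(\mathbb{R},\mathbb{C}^4)$; an eigenvalue is $\lambda\in\mathbb{C}$ for which the problem has a nonzero solution (eigenvector) $\mathbf{U}\in H^1(\mathbb{R},\mathbb{C}^4)$. The parameter $p\in\mathbb{R}$ is the transverse wave number. Here $$D_\omega=\begin{pmatrix} -i\partial_x+\omega & 0 & -1 & 0 \\ 0 & i\partial_x+\omega & 0 & -1 \\ -1 & 0 & i\partial_x+\omega & 0 \\ 0 & -1 & 0 & -i\partial_x+\omega \end{pmatrix}.$$ Massive Thirring model: for $\omega\in(-1,1)$, $$U_\omega(x)=\sqrt2\,\mu\,\frac{\sqrt{1+\omega}\cosh(\mu x)-i\sqrt{1-\omega}\sinh(\mu x)}{\omega+\cosh(2\mu x)},$$ $E_p=p^2I$ with $I$ the $4\times4$ identity, and $$W_\omega=\begin{pmatrix} |U_\omega|^2 & 0 & U_\omega^2 & |U_\omega|^2 \\ 0 & |U_\omega|^2 & |U_\omega|^2 & \bar U_\omega^2 \\ \bar U_\omega^2 & |U_\omega|^2 & |U_\omega|^2 & 0 \\ |U_\omega|^2 & U_\omega^2 & 0 &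 |U_\omega|^2 \end{pmatrix}.$$ Massive Gross--Neveu model: for $\omega\in(0,1)$, $$U_\omega(x)=\mu\,\frac{\sqrt{1+\omega}\cosh(\mu x)-i\sqrt{1-\omega}\sinh(\mu x)}{1+\omega\cosh(2\mu x)},$$ $E_p=-ipJ$ with $$J=\begin{pmatrix} 0 & 0 & 1 & 0 \\ 0 & 0 & 0 & 1 \\ -1 & 0 & 0 & 0 \\ 0 & -1 & 0 & 0 \end{pmatrix},\quad W_\omega=\begin{pmatrix} |U_\omega|^2 & \bar U_\omega^2 & U_\omega^2+2\bar U_\omega^2 & |U_\omega|^2 \\ U_\omega^2 & |U_\omega|^2 & |U_\omega|^2 & 2U_\omega^2+\bar U_\omega^2 \\ 2U_\omega^2+\bar U_\omega^2 & |U_\omega|^2 & |U_\omega|^2 & U_\omega^2 \\ |U_\omega|^2 & U_\omega^2+2\bar U_\omega^2 & \bar U_\omega^2 & |U_\omega|^2 \end{pmatrix}.$$ (These problems arise by linearizing, about the line soliton $u=U_\omega(x)e^{i\omega t}$, $v=\bar U_\omega(x)e^{i\omega t}$, with perturbations proportional to $e^{\lambda t+ipy}$, the systems $i(u_t+u_x)+v+u_{yy}=|v|^2u$, $i(v_t-v_x)+u+v_{yy}=|u|^2v$ (Thirring) and $i(u_t+u_x)+v+v_y=\bar uv^2+u|v|^2$, $i(v_t-v_x)+u-u_y=\bar vu^2+v|u|^2$ (Gross--Neveu).) *)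

theory Defs
  imports "HOL-Analysis.Analysis"
begin

lemma vector_4_nth [simp]:
  "(vector [a, b, c, d] :: 'a::zero^4) $ 1 = a"
  "(vector [a, b, c, d] :: 'a^4) $ 2 = b"
  "(vector [a, b, c, d] :: 'a^4) $ 3 = c"
  "(vector [a, b, c, d] :: 'a^4) $ 4 = d"
  by (simp_all add: vector_def)

text \<open>
  Elements of $L^2$ and $H^1$ are represented by functions on the line; equality in the spaces is
  equality almost everywhere.  The norm on \<^typ>\<open>complex^4\<close> is the Hermitian one.
\<close>

definition in_L2 :: "(real \<Rightarrow> complex^4) \<Rightarrow> bool" where
  "in_L2 f \<longleftrightarrow> f \<in> borel_measurable lborel \<and> integrable lborel (\<lambda>x. (norm (f x))\<^sup>2)"

definition L2_norm :: "(real \<Rightarrow> complex^4) \<Rightarrow> real" where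
  "L2_norm f = sqrt (LINT x|lborel. (norm (f x))\<^sup>2)"

text \<open>
  Membership in $L^2$ is part of convergence, because the Bochner integral in \<^const>\<open>L2_norm\<close>
  is 0 for functions that are not square integrable.
\<close>

definition L2_tendsto :: "('i \<Rightarrow> real \<Rightarrow> complex^4) \<Rightarrow> (real \<Rightarrow> complex^4) \<Rightarrow> 'i filter \<Rightarrow> bool" where
  "L2_tendsto F f \<F> \<longleftrightarrow>
     in_L2 f \<and> eventually (\<lambda>i. in_L2 (F i)) \<F> \<and>
     ((\<lambda>i. L2_norm (\<lambda>x. F i x - f x)) \<longlongrightarrow> 0) \<F>"

definition test_function :: "(real \<Rightarrow> real) \<Rightarrow> bool" where
  "test_function \<phi> \<longleftrightarrow>
     (\<forall>n. (deriv ^^ n) \<phi> differentiable_on UNIV) \<and> bounded {x. \<phi> x \<noteq> 0}"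

text \<open>Membership of \<open>u\<close> in $H^1$, with weak derivative \<open>u'\<close>; real test functions suffice.\<close>

definition H1_with_deriv :: "(real \<Rightarrow> complex^4) \<Rightarrow> (real \<Rightarrow> complex^4) \<Rightarrow> bool" where
  "H1_with_deriv u u' \<longleftrightarrow>
     in_L2 u \<and> in_L2 u' \<and>
     (\<forall>\<phi>. test_function \<phi> \<longrightarrow>
        (LINT x|lborel. deriv \<phi> x *\<^sub>R u x) = - (LINT x|lborel. \<phi> x *\<^sub>R u' x))"

datatype dirac_model = Thirring | Gross_Neveu

fun existence_interval :: "dirac_model \<Rightarrow> real set" where
  "existence_interval Thirring = {-1<..<1}"
| "existence_interval Gross_Neveu = {0<..<1}"

definition soliton_mu :: "real \<Rightarrow> real" where
  "soliton_mu \<omega> = sqrt (1 - \<omega>\<^sup>2)"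

definition soliton_numerator :: "real \<Rightarrow> real \<Rightarrow> complex" where
  "soliton_numerator \<omega> x =
     of_real (sqrt (1 + \<omega>) * cosh (soliton_mu \<omega> * x))
     - \<i> * of_real (sqrt (1 - \<omega>) * sinh (soliton_mu \<omega> * x))"

fun soliton :: "dirac_model \<Rightarrow> real \<Rightarrow> real \<Rightarrow> complex" where
  "soliton Thirring \<omega> x =
     of_real (sqrt 2 * soliton_mu \<omega>) *
     (soliton_numerator \<omega> x / of_real (\<omega> + cosh (2 * soliton_mu \<omega> * x)))"
| "soliton Gross_Neveu \<omega> x =
     of_real (soliton_mu \<omega>) *
     (soliton_numerator \<omega> x / of_real (1 + \<omega> * cosh (2 * soliton_mu \<omega> * x)))"

definition sigma :: "complex^4^4" where
  "sigma = vector [vector [1,  0, 0,  0],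
                   vector [0, -1, 0,  0],
                   vector [0,  0, 1,  0],
                   vector [0,  0, 0, -1]]"

definition J :: "complex^4^4" where
  "J = vector [vector [ 0,  0, 1, 0],
               vector [ 0,  0, 0, 1],
               vector [-1,  0, 0, 0],
               vector [ 0, -1, 0, 0]]"

fun E_matrix :: "dirac_model \<Rightarrow> real \<Rightarrow> complex^4^4" where
  "E_matrix Thirring p = mat (of_real (p\<^sup>2))"
| "E_matrix Gross_Neveu p = map_matrix (\<lambda>z. - \<i> * of_real p * z) J"

fun W_matrix :: "dirac_model \<Rightarrow> real \<Rightarrow> real \<Rightarrow> complex^4^4" where
  "W_matrix Thirring \<omega> x =
     (let U = soliton Thirring \<omega> x; A = of_real ((cmod U)\<^sup>2); S = U\<^sup>2; C = (cnj U)\<^sup>2 in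
      vector [vector [A, 0, S, A],
              vector [0, A, A, C],
              vector [C, A, A, 0],
              vector [A, S, 0, A]])"
| "W_matrix Gross_Neveu \<omega> x =
     (let U = soliton Gross_Neveu \<omega> x; A = of_real ((cmod U)\<^sup>2); S = U\<^sup>2; C = (cnj U)\<^sup>2 in
      vector [vector [A,         C,         S + 2 * C, A        ],
              vector [S,         A,         A,         2 * S + C],
              vector [2 * S + C, A,         A,         S        ],
              vector [A,         S + 2 * C, C,         A        ]])"

text \<open>
  The value at a point of $D_\omega \mathbf{U}$, in terms of the values \<open>u\<close> of $\mathbf{U}$
  and \<open>u'\<close> of $\partial_x \mathbf{U}$ at that point.
\<close>

definition D_omega :: "real \<Rightarrow> complex^4 \<Rightarrow> complex^4 \<Rightarrow> complex^4" where
  "D_omega \<omega> u u' =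
     vector [- \<i> * u' $ 1 + of_real \<omega> * u $ 1 - u $ 3,
               \<i> * u' $ 2 + of_real \<omega> * u $ 2 - u $ 4,
             - u $ 1 + \<i> * u' $ 3 + of_real \<omega> * u $ 3,
             - u $ 2 - \<i> * u' $ 4 + of_real \<omega> * u $ 4]"

text \<open>
  The spectral problem $i\lambda\sigma\mathbf{U}=(D_\omega+E_p+W_\omega)\mathbf{U}$ in $L^2$, with
  $\lambda$ written \<open>l\<close>.  The weak derivative is unique up to null sets, so the choice of \<open>u'\<close>
  does not matter.
\<close>

definition eigenvector :: "dirac_model \<Rightarrow> real \<Rightarrow> real \<Rightarrow> complex \<Rightarrow> (real \<Rightarrow> complex^4) \<Rightarrow> bool" where
  "eigenvector m \<omega> p l u \<longleftrightarrow>
     (\<exists>u'. H1_with_deriv u u' \<and> \<not> (AE x in lborel. u x = 0) \<and>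
        (AE x in lborel.
           (\<i> * l) *s (sigma *v u x) =
           D_omega \<omega> (u x) (u' x) + E_matrix m p *v u x + W_matrix m \<omega> x *v u x))"

definition soliton_vector :: "dirac_model \<Rightarrow> real \<Rightarrow> real \<Rightarrow> complex^4" where
  "soliton_vector m \<omega> x =
     (let U = soliton m \<omega> x in vector [U, cnj U, cnj U, U])"

definition U_t :: "dirac_model \<Rightarrow> real \<Rightarrow> real \<Rightarrow> complex^4" where
  "U_t m \<omega> x = vector_derivative (soliton_vector m \<omega>) (at x)"

definition U_g :: "dirac_model \<Rightarrow> real \<Rightarrow> real \<Rightarrow> complex^4" where
  "U_g m \<omega> x = \<i> *s (sigma *v soliton_vector m \<omega> x)"

fun unstable_limit :: "dirac_model \<Rightarrow> real \<Rightarrow> real \<Rightarrow> complex^4" where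
  "unstable_limit Thirring = U_t Thirring"
| "unstable_limit Gross_Neveu = U_g Gross_Neveu"

fun neutral_limit :: "dirac_model \<Rightarrow> real \<Rightarrow> real \<Rightarrow> complex^4" where
  "neutral_limit Thirring = U_g Thirring"
| "neutral_limit Gross_Neveu = U_t Gross_Neveu"

end

theory Submission
  imports Defs
begin

text \<open>
  In the sums and differences of the components of $\mathbf{U}$ the operator $D_\omega+W_\omega$ is
  block diagonal, and on pairs \<open>(a, cnj a)\<close>, \<open>(b, cnj b)\<close> it acts as two real-linear scalar Dirac
  operators. Their decaying kernels are spanned by \<open>U'\<close> and \<open>\<i> U\<close>; knowing a kernel function, each
  equation is inverted explicitly by two integrations. The eigenvalue and the transverse terms
  couple the two blocks, so with \<open>\<epsilon> = |p|\<close> and \<open>\<lambda> = \<epsilon> t\<close> (up to a factor \<open>\<plusminus> \<i>\<close>) a Lyapunov--Schmidt reduction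
  leaves one equation \<open>c\<^sub>1 t\<^sup>2 + c\<^sub>0 = O(\<epsilon>)\<close> per kernel vector. Its coefficients are integrals of the
  soliton, and their signs decide whether \<open>\<lambda>\<close> is real or imaginary. The phase between the blocks
  is chosen so that the system remains real-linear in \<open>a\<close> and \<open>b\<close>; for the unstable Gross--Neveu
  mode this requires the nonlocal combinations of \<open>f(x)\<close> and \<open>cnj (f (- x))\<close>.
\<close>

section \<open>Lyapunov--Schmidt reduction\<close>

text \<open>What decides the theorem is a pair of signs. For \<open>U'\<close> the coefficient of
  \<open>t\<^sup>2\<close> is \<open>s1 * s2\<close> times half the integral of
  \<open>Re (U^2)\<close>, which is positive; for \<open>\<i> U\<close> it is \<open>s1 * s2\<close>
  times \<open>real_pairing dw U\<close>, which is negative. The two constant coefficients share one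
  sign \<open>sg\<close>: -1 for Thirring, where they are minus the masses of the kernel functions,
  and +1 for Gross--Neveu, where they are second-order effects of the coupling. So for a fixed sign
  of \<open>s1 * s2\<close> exactly one kernel vector has a root \<open>t > 0\<close>, and the other
  condition stays away from zero; its amplitude can be eliminated, and the intermediate value
  theorem finishes. All scalars are real because of the conjugations. If the difference block
  carries the phase \<open>z\<close> relative to the sum block, \<open>\<lambda> * z\<close> and
  \<open>\<lambda> / z\<close> must be real: \<open>z = 1\<close> gives real \<lambda>,
  \<open>z = \<i>\<close> imaginary \<lambda>. The Gross--Neveu term \<open>- \<i> p J\<close> is
  compatible only with \<open>z = \<i>\<close> up to sign, whereas the instability needs real
  \<lambda>; mixing \<open>f x\<close> with \<open>cnj (f (- x))\<close> resolves this
  conflict.\<close>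

lemma neumann_fixpoint:
  fixes T :: "'a::banach \<Rightarrow> 'a"
  assumes "linear T" "\<And>x. norm (T x) \<le> norm x / 2"
  shows "\<exists>z. z = g + T z"
proof -
  have "\<exists>!z. g + T z = z"
  proof (rule banach_fix_type[of "1/2"])
    show "\<forall>x y. dist (g + T x) (g + T y) \<le> 1/2 * dist x y"
      using assms(2) by (simp add: dist_norm flip: linear_diff[OF assms(1)])
  qed auto
  then show ?thesis by metis
qed

text \<open>The equation is affine in \<open>z t\<close>, and its linear part
  \<open>\<epsilon> K (t S + Q + \<epsilon> Z)\<close> contracts by 1/2 for small \<epsilon>,
  uniformly for \<open>t\<close> in a bounded interval. The bound \<open>D\<close> does not depend
  on \<epsilon>, and continuity in \<open>t\<close> prepares the intermediate value
  argument.\<close>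

lemma corrector_exists:
  fixes S Q Z K :: "'a::banach \<Rightarrow> 'a" and g :: "real \<Rightarrow> real \<Rightarrow> 'a"
  assumes bl: "bounded_linear S" "bounded_linear Q" "bounded_linear Z" "bounded_linear K"
    and g_cont: "\<And>\<epsilon>. continuous_on {0..T} (g \<epsilon>)"
    and g_bound: "\<And>\<epsilon> t. 0 < \<epsilon> \<Longrightarrow> \<epsilon> \<le> 1 \<Longrightarrow> t \<in> {0..T} \<Longrightarrow> norm (g \<epsilon> t) \<le> G"
    and "T \<ge> 0"
  shows "\<exists>\<epsilon>0>0. \<exists>D. \<forall>\<epsilon>. 0 < \<epsilon> \<and> \<epsilon> < \<epsilon>0 \<longrightarrow> (\<exists>z. continuous_on {0..T} z \<and>
      (\<forall>t\<in>{0..T}. norm (z t) \<le> D \<and>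
         z t = K (g \<epsilon> t + \<epsilon> *\<^sub>R (t *\<^sub>R S (z t) + Q (z t) + \<epsilon> *\<^sub>R Z (z t)))))"
proof -
  obtain s q y k where s: "s > 0" "\<And>x. norm (S x) \<le> norm x * s"
    and q: "q > 0" "\<And>x. norm (Q x) \<le> norm x * q" and y: "y > 0" "\<And>x. norm (Z x) \<le> norm x * y"
    and k: "k > 0" "\<And>x. norm (K x) \<le> norm x * k"
    using bl bounded_linear.pos_bounded by metis
  define \<beta> where "\<beta> = T * s + q + y"
  have \<beta>: "\<beta> > 0" using assms(7) s q y by (simp add: \<beta>_def add_nonneg_pos)
  \<comment> \<open>\<beta> bounds \<open>t S + Q + \<epsilon> Z\<close> for
    \<open>t \<le> T\<close> and \<open>\<epsilon> \<le> 1\<close>; this threshold makes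
    \<open>\<epsilon> * k * \<beta>\<close> at most 1/2.\<close>
  define \<epsilon>0 where "\<epsilon>0 = min 1 (1 / (2 * k * \<beta>))"
  have \<epsilon>0: "\<epsilon>0 > 0" using k \<beta> by (simp add: \<epsilon>0_def)
  interpret S: bounded_linear S by fact
  interpret Q: bounded_linear Q by fact
  interpret Z: bounded_linear Z by fact
  interpret K: bounded_linear K by fact
  have ex: "\<exists>z. continuous_on {0..T} z \<and>
      (\<forall>t\<in>{0..T}. norm (z t) \<le> 2 * k * G \<and>
         z t = K (g \<epsilon> t + \<epsilon> *\<^sub>R (t *\<^sub>R S (z t) + Q (z t) + \<epsilon> *\<^sub>R Z (z t))))"
    if \<epsilon>: "0 < \<epsilon>" "\<epsilon> < \<epsilon>0" for \<epsilon>
  proof -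
    define B where "B t x = t *\<^sub>R S x + Q x + \<epsilon> *\<^sub>R Z x" for t x
    have \<epsilon>1: "\<epsilon> \<le> 1" "\<epsilon> * (2 * k * \<beta>) \<le> 1"
      using \<epsilon> k \<beta> by (auto simp: \<epsilon>0_def field_simps)
    have linB: "linear (\<lambda>x. \<epsilon> *\<^sub>R K (B t x))" for t
      unfolding B_def
      by (intro linearI) (simp_all add: S.add Q.add Z.add K.add S.scaleR Q.scaleR Z.scaleR K.scaleR algebra_simps)
    have bB: "norm (B t x) \<le> norm x * \<beta>" if "t \<in> {0..T}" for t x
    proof -
      have "norm (B t x) \<le> norm (t *\<^sub>R S x) + norm (Q x) + norm (\<epsilon> *\<^sub>R Z x)"
        unfolding B_def by (intro norm_triangle_le add_mono order_refl)
      also have "\<dots> \<le> T * (norm x * s) + norm x * q + 1 * (norm x * y)"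
      proof (intro add_mono)
        show "norm (t *\<^sub>R S x) \<le> T * (norm x * s)"
          using that s by (auto intro!: mult_mono)
        show "norm (\<epsilon> *\<^sub>R Z x) \<le> 1 * (norm x * y)"
          using \<epsilon> \<epsilon>1 y(2)[of x] by (simp only: norm_scaleR) (intro mult_mono, auto)
      qed (use q in simp)
      finally show ?thesis by (simp add: \<beta>_def algebra_simps)
    qed
    have half: "norm (\<epsilon> *\<^sub>R K (B t x)) \<le> norm x / 2" if "t \<in> {0..T}" for t x
    proof -
      have "norm (\<epsilon> *\<^sub>R K (B t x)) \<le> \<epsilon> * (norm (B t x) * k)" using k(2) \<epsilon> by simp
      also have "\<dots> \<le> \<epsilon> * ((norm x * \<beta>) * k)" using bB[OF that] k \<epsilon> by (intro mult_left_mono mult_right_mono) auto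
      also have "\<dots> = norm x / 2 * (\<epsilon> * (2 * k * \<beta>))" by simp
      also have "\<dots> \<le> norm x / 2 * 1" using \<epsilon>1 by (intro mult_left_mono) auto
      finally show ?thesis by simp
    qed
    have "\<forall>t\<in>{0..T}. \<exists>z. z = K (g \<epsilon> t) + \<epsilon> *\<^sub>R K (B t z)"
      using neumann_fixpoint[OF linB] half by blast
    then obtain z where z: "\<And>t. t \<in> {0..T} \<Longrightarrow> z t = K (g \<epsilon> t) + \<epsilon> *\<^sub>R K (B t (z t))"
      by metis
    have bound: "norm (z t) \<le> 2 * k * G" if t: "t \<in> {0..T}" for t
    proof -
      have "norm (z t) \<le> norm (K (g \<epsilon> t)) + norm (z t) / 2"
        using z[OF t] half[OF t, of "z t"] norm_triangle_ineq[of "K (g \<epsilon> t)" "\<epsilon> *\<^sub>R K (B t (z t))"]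
        by simp
      also have "norm (K (g \<epsilon> t)) \<le> G * k"
        using k(2)[of "g \<epsilon> t"] g_bound[OF \<epsilon>(1) \<epsilon>1(1) t] k(1)
        by (meson mult_right_mono order_trans less_imp_le)
      finally show ?thesis by (simp add: algebra_simps)
    qed
    have cont: "continuous_on {0..T} z"
      unfolding continuous_on_def
    proof (intro ballI)
      fix t assume t: "t \<in> {0..T}"
      \<comment> \<open>The difference of the equations at \<open>x\<close> and \<open>t\<close> is
        again a fixed point equation for \<open>z x - z t\<close>; its contracted part is absorbed
        into the left side, hence the factor 2. The last term comes from the explicit
        \<open>t\<close> in front of \<open>S\<close>.\<close>
      have lip: "norm (z x - z t) \<le> 2 * norm (K (g \<epsilon> x) - K (g \<epsilon> t) + (\<epsilon> * (x - t)) *\<^sub>R K (S (z t)))"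
        if x: "x \<in> {0..T}" for x
      proof -
        have "z x - z t = (K (g \<epsilon> x) - K (g \<epsilon> t) + (\<epsilon> * (x - t)) *\<^sub>R K (S (z t))) + \<epsilon> *\<^sub>R K (B x (z x - z t))"
          by (subst z[OF x], subst z[OF t])
             (simp add: B_def S.add Q.add Z.add K.add S.scaleR Q.scaleR Z.scaleR K.scaleR
                S.diff Q.diff Z.diff K.diff algebra_simps)
        then have "norm (z x - z t) \<le> norm (K (g \<epsilon> x) - K (g \<epsilon> t) + (\<epsilon> * (x - t)) *\<^sub>R K (S (z t)))
            + norm (\<epsilon> *\<^sub>R K (B x (z x - z t)))"
          by (metis norm_triangle_ineq)
        with half[OF x, of "z x - z t"] show ?thesis by simp
      qed
      have "((\<lambda>x. 2 * norm (K (g \<epsilon> x) - K (g \<epsilon> t) + (\<epsilon> * (x - t)) *\<^sub>R K (S (z t)))) \<longlongrightarrow>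
          2 * norm (K (g \<epsilon> t) - K (g \<epsilon> t) + (\<epsilon> * (t - t)) *\<^sub>R K (S (z t)))) (at t within {0..T})"
        using g_cont t unfolding continuous_on_def by (intro tendsto_intros K.tendsto) auto
      then have lim: "((\<lambda>x. 2 * norm (K (g \<epsilon> x) - K (g \<epsilon> t) + (\<epsilon> * (x - t)) *\<^sub>R K (S (z t)))) \<longlongrightarrow> 0) (at t within {0..T})"
        by simp
      have "((\<lambda>x. z x - z t) \<longlongrightarrow> 0) (at t within {0..T})"
        by (rule Lim_null_comparison[OF _ lim]) (auto simp: eventually_at_filter lip intro!: always_eventually)
      then show "(z \<longlongrightarrow> z t) (at t within {0..T})" by (simp add: LIM_zero_iff)
    qed
    have "z t = K (g \<epsilon> t + \<epsilon> *\<^sub>R (t *\<^sub>R S (z t) + Q (z t) + \<epsilon> *\<^sub>R Z (z t)))" if "t \<in> {0..T}" for t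
      using z[OF that] by (simp add: K.add K.scaleR B_def)
    then show ?thesis using cont bound by blast
  qed
  show ?thesis using \<epsilon>0 ex by blast
qed

text \<open>
  Lyapunov--Schmidt reduction at a two-dimensional kernel. The ansatz is
  \<open>n\<^sub>j + \<epsilon> v\<^sub>j + \<epsilon>\<^sup>2 z\<^sub>j\<close> with \<open>L v\<^sub>j = (t S + Q) n\<^sub>j\<close>; the solvability conditions for the
  remainders \<open>z\<^sub>j\<close> form a real 2 by 2 matrix whose limit is diagonal.
\<close>

lemma bifurcation:
  fixes L :: "'a::banach \<Rightarrow> 'a \<Rightarrow> bool" and S Q Z K :: "'a \<Rightarrow> 'a" and l1 l2 :: "'a \<Rightarrow> real"
  assumes L_add: "\<And>a b f g. L a f \<Longrightarrow> L b g \<Longrightarrow> L (a + b) (f + g)"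
    and L_scale: "\<And>r a f. L a f \<Longrightarrow> L (r *\<^sub>R a) (r *\<^sub>R f)"
    and bl: "bounded_linear S" "bounded_linear Q" "bounded_linear Z" "bounded_linear K"
      "bounded_linear l1" "bounded_linear l2"
    and K: "\<And>f. L (K f) (f - l1 f *\<^sub>R e1 - l2 f *\<^sub>R e2)"
    and n: "L n1 0" "L n2 0"
    and v1: "L vS1 (S n1)" "L vQ1 (Q n1)" and v2: "L vS2 (S n2)" "L vQ2 (Q n2)"
    and M11: "\<And>t. l1 (t *\<^sub>R S (t *\<^sub>R vS1 + vQ1) + Q (t *\<^sub>R vS1 + vQ1) + Z n1) = A1 * t\<^sup>2 + C1"
    and M21: "\<And>t. l2 (t *\<^sub>R S (t *\<^sub>R vS1 + vQ1) + Q (t *\<^sub>R vS1 + vQ1) + Z n1) = 0"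
    and M12: "\<And>t. l1 (t *\<^sub>R S (t *\<^sub>R vS2 + vQ2) + Q (t *\<^sub>R vS2 + vQ2) + Z n2) = 0"
    and M22: "\<And>t. l2 (t *\<^sub>R S (t *\<^sub>R vS2 + vQ2) + Q (t *\<^sub>R vS2 + vQ2) + Z n2) = A2 * t\<^sup>2 + C2"
    and signs: "A1 * C1 < 0" "A2 * C2 \<ge> 0" "C2 \<noteq> 0"
  shows "\<exists>\<epsilon>0>0. \<exists>C. \<forall>\<epsilon>. 0 < \<epsilon> \<and> \<epsilon> < \<epsilon>0 \<longrightarrow> (\<exists>t>0. \<exists>y. norm (y - n1) \<le> C * \<epsilon> \<and>
            L y (\<epsilon> *\<^sub>R (t *\<^sub>R S y + Q y + \<epsilon> *\<^sub>R Z y)))"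
proof -
  interpret S: bounded_linear S by fact
  interpret Q: bounded_linear Q by fact
  interpret Z: bounded_linear Z by fact
  interpret l1: bounded_linear l1 by fact
  interpret l2: bounded_linear l2 by fact
  note lins = S.add Q.add Z.add l1.add l2.add S.scaleR Q.scaleR Z.scaleR l1.scaleR l2.scaleR
  note conts = S.continuous_on Q.continuous_on Z.continuous_on l1.continuous_on l2.continuous_on
  have L_diff: "L (a - b) (f - g)" if "L a f" "L b g" for a b f g
    using L_add[OF that(1) L_scale[OF that(2), of "-1"]] by simp
  have A1: "A1 \<noteq> 0" using signs by auto
  \<comment> \<open>Twice the positive root of \<open>A1 * t\<^sup>2 + C1\<close>, so that this
    polynomial equals \<open>- 3 * C1\<close> at \<open>T\<close> and \<open>C1\<close> at
    0.\<close>
  define T where "T = 2 * sqrt (- C1 / A1)"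
  have T2: "A1 * T\<^sup>2 = - 4 * C1" "T > 0"
  proof -
    have "- C1 / A1 > 0" using signs(1) by (auto simp: divide_less_0_iff mult_less_0_iff)
    then show "A1 * T\<^sup>2 = - 4 * C1" "T > 0"
      using A1 by (simp_all add: T_def power_mult_distrib)
  qed
  let ?g = "\<lambda>n vS vQ \<epsilon> t. t *\<^sub>R S (t *\<^sub>R vS + vQ) + Q (t *\<^sub>R vS + vQ) + Z n + \<epsilon> *\<^sub>R Z (t *\<^sub>R vS + vQ)"
  let ?B = "\<lambda>\<epsilon> t x. t *\<^sub>R S x + Q x + \<epsilon> *\<^sub>R Z x"
  have corr: "\<exists>\<epsilon>0>0. \<exists>D. \<forall>\<epsilon>. 0 < \<epsilon> \<and> \<epsilon> < \<epsilon>0 \<longrightarrow> (\<exists>z. continuous_on {0..T} z \<and>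
      (\<forall>t\<in>{0..T}. norm (z t) \<le> D \<and> z t = K (?g n vS vQ \<epsilon> t + \<epsilon> *\<^sub>R ?B \<epsilon> t (z t))))" for n vS vQ
  proof -
    have "bounded ((\<lambda>(\<epsilon>, t). ?g n vS vQ \<epsilon> t) ` ({0..1} \<times> {0..T}))"
      by (intro compact_imp_bounded compact_continuous_image compact_Times)
         (auto intro!: continuous_intros conts simp: split_beta)
    then obtain G where "\<forall>x \<in> (\<lambda>(\<epsilon>, t). ?g n vS vQ \<epsilon> t) ` ({0..1} \<times> {0..T}). norm x \<le> G"
      unfolding bounded_iff by blast
    then have G: "norm (?g n vS vQ \<epsilon> t) \<le> G" if "0 < \<epsilon>" "\<epsilon> \<le> 1" "t \<in> {0..T}" for \<epsilon> t
      using that by force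
    show ?thesis
      by (rule corrector_exists[OF bl(1-4), where G = G])
         (use G T2 in \<open>auto intro!: continuous_intros conts\<close>)
  qed
  from corr[where n = n1 and vS = vS1 and vQ = vQ1] obtain \<epsilon>1 D1 where E1: "\<epsilon>1 > 0" "\<forall>\<epsilon>. 0 < \<epsilon> \<and> \<epsilon> < \<epsilon>1 \<longrightarrow> (\<exists>z. continuous_on {0..T} z \<and>
      (\<forall>t\<in>{0..T}. norm (z t) \<le> D1 \<and> z t = K (?g n1 vS1 vQ1 \<epsilon> t + \<epsilon> *\<^sub>R ?B \<epsilon> t (z t))))"
    by (elim exE conjE) (rule that)
  from corr[where n = n2 and vS = vS2 and vQ = vQ2] obtain \<epsilon>2 D2 where E2: "\<epsilon>2 > 0" "\<forall>\<epsilon>. 0 < \<epsilon> \<and> \<epsilon> < \<epsilon>2 \<longrightarrow> (\<exists>z. continuous_on {0..T} z \<and>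
      (\<forall>t\<in>{0..T}. norm (z t) \<le> D2 \<and> z t = K (?g n2 vS2 vQ2 \<epsilon> t + \<epsilon> *\<^sub>R ?B \<epsilon> t (z t))))"
    by (elim exE conjE) (rule that)
  obtain s q y k1 k2 where s: "s > 0" "\<And>x. norm (S x) \<le> norm x * s"
    and q: "q > 0" "\<And>x. norm (Q x) \<le> norm x * q" and y: "y > 0" "\<And>x. norm (Z x) \<le> norm x * y"
    and k1: "k1 > 0" "\<And>x. norm (l1 x) \<le> norm x * k1" and k2: "k2 > 0" "\<And>x. norm (l2 x) \<le> norm x * k2"
    using bl bounded_linear.pos_bounded by metis
  define D where "D = max 0 (max D1 D2)"
  define V where "V = T * (norm vS1 + norm vS2) + norm vQ1 + norm vQ2"
  define R where "R = (V * y + D * (T * s + q + y)) * (k1 + k2)"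
  have V: "norm (t *\<^sub>R vS1 + vQ1) \<le> V" "norm (t *\<^sub>R vS2 + vQ2) \<le> V" if "t \<in> {0..T}" for t
  proof -
    have "norm (t *\<^sub>R v + v') \<le> T * norm v + norm v'" for v v' :: 'a
      using that by (intro norm_triangle_le add_mono) (auto intro!: mult_right_mono)
    moreover have "0 \<le> T * norm vS1" "0 \<le> T * norm vS2" using T2(2) by simp_all
    ultimately show "norm (t *\<^sub>R vS1 + vQ1) \<le> V" "norm (t *\<^sub>R vS2 + vQ2) \<le> V"
      using norm_ge_zero[of vQ1] norm_ge_zero[of vQ2] unfolding V_def distrib_left by (smt (verit))+
  qed
  have rem: "\<bar>l (Z v + ?B \<epsilon> t z)\<bar> \<le> R"
    if "0 < \<epsilon>" "\<epsilon> \<le> 1" "t \<in> {0..T}" "norm v \<le> V" "norm z \<le> D" and l: "l = l1 \<or> l = l2" for \<epsilon> t v z l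
  proof -
    have "norm (Z v + ?B \<epsilon> t z) \<le> norm (Z v) + (norm (t *\<^sub>R S z) + norm (Q z) + norm (\<epsilon> *\<^sub>R Z z))"
      by (intro norm_triangle_le add_mono order_refl)
    also have "\<dots> \<le> V * y + (T * (D * s) + D * q + 1 * (D * y))"
    proof (intro add_mono)
      have *: "norm (S z) \<le> D * s" "norm (Q z) \<le> D * q" "norm (Z z) \<le> D * y" "norm (Z v) \<le> V * y"
        using s q y that(4,5) by (meson mult_right_mono order_trans less_imp_le)+
      then show "norm (Z v) \<le> V * y" "norm (Q z) \<le> D * q" by auto
      have "0 \<le> D * s" "0 \<le> D * y" using *(1,3) norm_ge_zero order_trans by blast+
      then show "norm (t *\<^sub>R S z) \<le> T * (D * s)" "norm (\<epsilon> *\<^sub>R Z z) \<le> 1 * (D * y)"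
        using mult_mono[of t T "norm (S z)" "D * s"] mult_mono[of \<epsilon> 1 "norm (Z z)" "D * y"] * that
        by auto
    qed
    finally have *: "norm (Z v + ?B \<epsilon> t z) \<le> V * y + D * (T * s + q + y)" by (simp add: algebra_simps)
    have "\<bar>l (Z v + ?B \<epsilon> t z)\<bar> \<le> norm (Z v + ?B \<epsilon> t z) * (k1 + k2)"
    proof -
      have "\<bar>l1 x\<bar> \<le> norm x * (k1 + k2)" "\<bar>l2 x\<bar> \<le> norm x * (k1 + k2)" for x
        using k1(2)[of x] k2(2)[of x] mult_nonneg_nonneg[OF norm_ge_zero less_imp_le[OF k1(1)], of x]
          mult_nonneg_nonneg[OF norm_ge_zero less_imp_le[OF k2(1)], of x]
        unfolding distrib_left real_norm_def by linarith+
      then show ?thesis using l by blast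
    qed
    also have "\<dots> \<le> R" unfolding R_def using * k1 k2 by (intro mult_right_mono) auto
    finally show ?thesis .
  qed
  have R: "R \<ge> 0" 
  proof -
    have "0 \<le> V" using V[of 0] T2(2) by (auto intro: order_trans[OF norm_ge_zero])
    have "0 \<le> D" by (simp add: D_def)
    from rem[of 1 0 0 0 l1] \<open>0 \<le> V\<close> this T2(2) show ?thesis by simp
  qed
  define \<delta> where "\<delta> = \<bar>C2\<bar>"
  have \<delta>: "\<delta> > 0" using signs by (simp add: \<delta>_def)
  \<comment> \<open>\<open>A2\<close> and \<open>C2\<close> do not have opposite signs, so the
    second diagonal entry stays at distance at least \<open>\<bar>C2\<bar>\<close> from zero for
    every \<open>t\<close>.\<close>
  have M22_bound: "\<bar>A2 * t\<^sup>2 + C2\<bar> \<ge> \<delta>" for t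
  proof -
    have "A2 * t\<^sup>2 * C2 \<ge> 0"
      using mult_nonneg_nonneg[OF signs(2) zero_le_power2[of t]] by (simp add: ac_simps)
    then show ?thesis unfolding \<delta>_def by (auto simp: zero_le_mult_iff)
  qed
  \<comment> \<open>The threshold with \<open>R + 1\<close> keeps the second diagonal entry at least
    \<open>\<delta> / 2\<close> in modulus; the last two each limit one of the two perturbations of
    \<open>F\<close> to less than half of \<open>\<bar>C1\<bar>\<close>.\<close>
  define \<epsilon>0 where "\<epsilon>0 = min 1 (min (min \<epsilon>1 \<epsilon>2) (min (\<delta> / (2 * (R + 1)))
      (min (\<bar>C1\<bar> / (2 * R + 2)) (\<delta> * \<bar>C1\<bar> / (4 * R * R + 4)))))"
  have C1: "\<bar>C1\<bar> > 0" using signs by auto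
  have \<epsilon>0: "\<epsilon>0 > 0" unfolding \<epsilon>0_def using E1 E2 \<delta> R C1
    by (auto simp: add_nonneg_pos)
  define C where "C = V + D + 2 * R / \<delta> * (norm n2 + V + D)"
  have "\<exists>t>0. \<exists>y. norm (y - n1) \<le> C * \<epsilon> \<and> L y (\<epsilon> *\<^sub>R ?B \<epsilon> t y)" if \<epsilon>: "0 < \<epsilon>" "\<epsilon> < \<epsilon>0" for \<epsilon>
  proof -
    have \<epsilon>': "\<epsilon> \<le> 1" "\<epsilon> < \<epsilon>1" "\<epsilon> < \<epsilon>2" "\<epsilon> < \<delta> / (2 * (R + 1))" "\<epsilon> < \<bar>C1\<bar> / (2 * R + 2)" "\<epsilon> < \<delta> * \<bar>C1\<bar> / (4 * R * R + 4)"
      using \<epsilon>(2) unfolding \<epsilon>0_def min_less_iff_conj by linarith+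
    from E1(2)[rule_format, OF conjI[OF \<epsilon>(1) \<epsilon>'(2)]]
    obtain z1 where z1: "continuous_on {0..T} z1" "\<forall>t\<in>{0..T}. norm (z1 t) \<le> D1 \<and>
        z1 t = K (?g n1 vS1 vQ1 \<epsilon> t + \<epsilon> *\<^sub>R ?B \<epsilon> t (z1 t))"
      by (elim exE conjE) (rule that)
    from E2(2)[rule_format, OF conjI[OF \<epsilon>(1) \<epsilon>'(3)]]
    obtain z2 where z2: "continuous_on {0..T} z2" "\<forall>t\<in>{0..T}. norm (z2 t) \<le> D2 \<and>
        z2 t = K (?g n2 vS2 vQ2 \<epsilon> t + \<epsilon> *\<^sub>R ?B \<epsilon> t (z2 t))"
      by (elim exE conjE) (rule that)
    define h1 where "h1 t = ?g n1 vS1 vQ1 \<epsilon> t + \<epsilon> *\<^sub>R ?B \<epsilon> t (z1 t)" for t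
    define h2 where "h2 t = ?g n2 vS2 vQ2 \<epsilon> t + \<epsilon> *\<^sub>R ?B \<epsilon> t (z2 t)" for t
    have h_cont: "continuous_on {0..T} h1" "continuous_on {0..T} h2"
      unfolding h1_def h2_def by (auto intro!: continuous_intros conts z1 z2)
    have D: "norm (z1 t) \<le> D" "norm (z2 t) \<le> D" if "t \<in> {0..T}" for t
      using z1(2)[rule_format, OF that, THEN conjunct1] z2(2)[rule_format, OF that, THEN conjunct1]
      by (simp_all add: D_def)
    have split: "l (?g n vS vQ \<epsilon> t + \<epsilon> *\<^sub>R ?B \<epsilon> t z) = l (t *\<^sub>R S (t *\<^sub>R vS + vQ) + Q (t *\<^sub>R vS + vQ) + Z n)
         + \<epsilon> * l (Z (t *\<^sub>R vS + vQ) + ?B \<epsilon> t z)" if "l = l1 \<or> l = l2" for l n vS vQ z t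
      using that by (auto simp: lins algebra_simps)
    define r11 where "r11 t = l1 (Z (t *\<^sub>R vS1 + vQ1) + ?B \<epsilon> t (z1 t))" for t
    define r21 where "r21 t = l2 (Z (t *\<^sub>R vS1 + vQ1) + ?B \<epsilon> t (z1 t))" for t
    define r12 where "r12 t = l1 (Z (t *\<^sub>R vS2 + vQ2) + ?B \<epsilon> t (z2 t))" for t
    define r22 where "r22 t = l2 (Z (t *\<^sub>R vS2 + vQ2) + ?B \<epsilon> t (z2 t))" for t
    have m: "l1 (h1 t) = A1 * t\<^sup>2 + C1 + \<epsilon> * r11 t" "l2 (h1 t) = \<epsilon> * r21 t"
       "l1 (h2 t) = \<epsilon> * r12 t" "l2 (h2 t) = A2 * t\<^sup>2 + C2 + \<epsilon> * r22 t" for t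
      unfolding h1_def h2_def r11_def r12_def r21_def r22_def
      using split[of l1] split[of l2] M11 M12 M21 M22 by simp_all
    have r: "\<bar>r11 t\<bar> \<le> R" "\<bar>r12 t\<bar> \<le> R" "\<bar>r21 t\<bar> \<le> R" "\<bar>r22 t\<bar> \<le> R" if "t \<in> {0..T}" for t
      unfolding r11_def r12_def r21_def r22_def
      using rem[OF \<epsilon>(1) \<epsilon>'(1) that] V[OF that] D[OF that] by blast+
    have d22: "\<bar>l2 (h2 t)\<bar> \<ge> \<delta> / 2" if "t \<in> {0..T}" for t
    proof -
      have "\<bar>\<epsilon> * r22 t\<bar> \<le> \<epsilon> * R" using r(4)[OF that] \<epsilon> by (simp add: abs_mult)
      also have "\<dots> \<le> \<delta> / 2" using \<epsilon>'(4) R \<delta> \<epsilon> by (simp add: field_simps)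
      finally show ?thesis using M22_bound[of t] unfolding m by linarith
    qed
    \<comment> \<open>The amplitude of the second kernel vector is chosen to cancel the defect along
      \<open>e2\<close>. It is of order \<epsilon> because the off-diagonal entry
      \<open>l2 (h1 t)\<close> vanishes in the limit.\<close>
    define \<alpha> where "\<alpha> t = - (l2 (h1 t) / l2 (h2 t))" for t
    have \<alpha>: "\<bar>\<alpha> t\<bar> \<le> 2 * R / \<delta> * \<epsilon>" if "t \<in> {0..T}" for t
    proof -
      have "\<bar>\<alpha> t\<bar> = (\<epsilon> * \<bar>r21 t\<bar>) / \<bar>l2 (h2 t)\<bar>" using \<epsilon> by (simp add: \<alpha>_def m(2) abs_mult)
      also have "\<dots> \<le> (\<epsilon> * R) / (\<delta> / 2)"
        using d22[OF that] r(3)[OF that] \<epsilon> \<delta> R by (intro frac_le mult_left_mono) auto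
      finally show ?thesis by (simp add: field_simps)
    qed
    \<comment> \<open>The solvability condition that is left: the defect along \<open>e1\<close>
      after elimination of the second amplitude.\<close>
    define F where "F t = l1 (h1 t) + \<alpha> t * l1 (h2 t)" for t
    have F_cont: "continuous_on {0..T} F"
      unfolding F_def \<alpha>_def using d22 \<delta>
      by (intro continuous_intros conts h_cont) fastforce
    have F_near: "\<bar>F t - (A1 * t\<^sup>2 + C1)\<bar> < \<bar>C1\<bar>" if t: "t \<in> {0..T}" for t
    proof -
      have "\<bar>F t - (A1 * t\<^sup>2 + C1)\<bar> = \<bar>\<epsilon> * r11 t + \<alpha> t * (\<epsilon> * r12 t)\<bar>" by (simp add: F_def m)
      also have "\<dots> \<le> \<epsilon> * \<bar>r11 t\<bar> + \<bar>\<alpha> t\<bar> * (\<epsilon> * \<bar>r12 t\<bar>)"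
        using \<epsilon> abs_triangle_ineq[of "\<epsilon> * r11 t" "\<alpha> t * (\<epsilon> * r12 t)"] by (simp add: abs_mult)
      also have "\<dots> \<le> \<epsilon> * R + (2 * R / \<delta> * \<epsilon>) * (1 * R)"
        using \<epsilon> \<epsilon>' r[OF t] \<alpha>[OF t] R \<delta> by (intro add_mono mult_mono) auto
      also have "\<epsilon> * R < \<bar>C1\<bar> / 2"
      proof -
        have "\<epsilon> * (2 * R + 2) < \<bar>C1\<bar>" using \<epsilon>'(5) R by (simp add: pos_less_divide_eq)
        then show ?thesis using \<epsilon> by (simp add: algebra_simps)
      qed
      also have "(2 * R / \<delta> * \<epsilon>) * (1 * R) < \<bar>C1\<bar> / 2"
      proof -
        have "\<epsilon> * (4 * R * R + 4) < \<delta> * \<bar>C1\<bar>"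
          using \<epsilon>'(6) R by (subst (asm) pos_less_divide_eq) (auto simp: add_nonneg_pos)
        then have "\<epsilon> * (4 * R * R) < \<delta> * \<bar>C1\<bar>" using \<epsilon> by (simp add: algebra_simps)
        then show ?thesis using \<delta> by (simp add: field_simps)
      qed
      finally show ?thesis by simp
    qed
    \<comment> \<open>\<open>F 0\<close> is within \<open>\<bar>C1\<bar>\<close> of
      \<open>C1\<close> and \<open>F T\<close> within \<open>\<bar>C1\<bar>\<close> of
      \<open>- 3 * C1\<close>, strictly in both cases, so the signs differ.\<close>
    have "F 0 * F T < 0"
      using F_near[of 0] F_near[of T] T2 C1 by (auto simp: mult_less_0_iff)
    then have "\<exists>t\<in>{0..T}. F t = 0"
      using IVT'[of F 0 0 T, OF _ _ _ F_cont] IVT2'[of F T 0 0, OF _ _ _ F_cont] T2(2)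
      unfolding mult_less_0_iff Bex_def atLeastAtMost_iff by (meson less_imp_le)
    then obtain t where t: "t \<in> {0..T}" "F t = 0" by blast
    have "t \<noteq> 0" using F_near[of 0] t T2(2) by auto
    define y where "y = (n1 + \<epsilon> *\<^sub>R (t *\<^sub>R vS1 + vQ1) + \<epsilon>\<^sup>2 *\<^sub>R z1 t)
      + \<alpha> t *\<^sub>R (n2 + \<epsilon> *\<^sub>R (t *\<^sub>R vS2 + vQ2) + \<epsilon>\<^sup>2 *\<^sub>R z2 t)"
    have zero: "l1 (h1 t) + \<alpha> t * l1 (h2 t) = 0" "l2 (h1 t) + \<alpha> t * l2 (h2 t) = 0"
      using t d22[OF t(1)] \<delta> by (auto simp: F_def \<alpha>_def)
    have Lz: "L (z1 t) (h1 t - l1 (h1 t) *\<^sub>R e1 - l2 (h1 t) *\<^sub>R e2)"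
      "L (z2 t) (h2 t - l1 (h2 t) *\<^sub>R e1 - l2 (h2 t) *\<^sub>R e2)"
      unfolding h1_def h2_def 
      by (subst z1(2)[rule_format, OF t(1), THEN conjunct2], rule K,
          subst z2(2)[rule_format, OF t(1), THEN conjunct2], rule K)
    \<comment> \<open>Each \<open>z\<close> solves its equation only up to multiples of
      \<open>e1\<close> and \<open>e2\<close>; in the sum those multiples carry the factors that
      \<open>zero\<close> annihilates.\<close>
    have "L y ((0 + \<epsilon> *\<^sub>R (t *\<^sub>R S n1 + Q n1) + \<epsilon>\<^sup>2 *\<^sub>R (h1 t - l1 (h1 t) *\<^sub>R e1 - l2 (h1 t) *\<^sub>R e2))
      + \<alpha> t *\<^sub>R (0 + \<epsilon> *\<^sub>R (t *\<^sub>R S n2 + Q n2) + \<epsilon>\<^sup>2 *\<^sub>R (h2 t - l1 (h2 t) *\<^sub>R e1 - l2 (h2 t) *\<^sub>R e2)))"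
      unfolding y_def by (intro L_add L_scale n v1 v2 Lz)
    also have "((0 + \<epsilon> *\<^sub>R (t *\<^sub>R S n1 + Q n1) + \<epsilon>\<^sup>2 *\<^sub>R (h1 t - l1 (h1 t) *\<^sub>R e1 - l2 (h1 t) *\<^sub>R e2))
      + \<alpha> t *\<^sub>R (0 + \<epsilon> *\<^sub>R (t *\<^sub>R S n2 + Q n2) + \<epsilon>\<^sup>2 *\<^sub>R (h2 t - l1 (h2 t) *\<^sub>R e1 - l2 (h2 t) *\<^sub>R e2)))
      = \<epsilon> *\<^sub>R (t *\<^sub>R S n1 + Q n1) + \<epsilon>\<^sup>2 *\<^sub>R h1 t + \<alpha> t *\<^sub>R (\<epsilon> *\<^sub>R (t *\<^sub>R S n2 + Q n2) + \<epsilon>\<^sup>2 *\<^sub>R h2 t)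
       - (\<epsilon>\<^sup>2 * (l1 (h1 t) + \<alpha> t * l1 (h2 t))) *\<^sub>R e1 - (\<epsilon>\<^sup>2 * (l2 (h1 t) + \<alpha> t * l2 (h2 t))) *\<^sub>R e2"
      by (simp add: algebra_simps)
    also have "\<dots> = \<epsilon> *\<^sub>R ?B \<epsilon> t y"
      unfolding zero by (simp add: y_def h1_def h2_def lins algebra_simps power2_eq_square)
    finally have Ly: "L y (\<epsilon> *\<^sub>R ?B \<epsilon> t y)" .
    have yn: "norm (y - n1) \<le> C * \<epsilon>"
    proof -
      have *: "norm (\<epsilon> *\<^sub>R v + \<epsilon>\<^sup>2 *\<^sub>R z) \<le> \<epsilon> * (V + D)" if "norm v \<le> V" "norm z \<le> D" for v z :: 'a
      proof -
        have "norm (\<epsilon> *\<^sub>R v + \<epsilon>\<^sup>2 *\<^sub>R z) \<le> \<epsilon> * norm v + \<epsilon> * (\<epsilon> * norm z)"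
          using norm_triangle_ineq[of "\<epsilon> *\<^sub>R v" "\<epsilon>\<^sup>2 *\<^sub>R z"] \<epsilon> by (simp add: power2_eq_square)
        also have "\<dots> \<le> \<epsilon> * V + \<epsilon> * (1 * D)"
          using that \<epsilon> \<epsilon>' by (intro add_mono mult_mono) auto
        finally show ?thesis by (simp add: algebra_simps)
      qed
      have "y - n1 = (\<epsilon> *\<^sub>R (t *\<^sub>R vS1 + vQ1) + \<epsilon>\<^sup>2 *\<^sub>R z1 t) + \<alpha> t *\<^sub>R (n2 + (\<epsilon> *\<^sub>R (t *\<^sub>R vS2 + vQ2) + \<epsilon>\<^sup>2 *\<^sub>R z2 t))"
        by (simp add: y_def algebra_simps)
      also have "norm \<dots> \<le> \<epsilon> * (V + D) + \<bar>\<alpha> t\<bar> * (norm n2 + \<epsilon> * (V + D))"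
      proof -
        have "norm (n2 + (\<epsilon> *\<^sub>R (t *\<^sub>R vS2 + vQ2) + \<epsilon>\<^sup>2 *\<^sub>R z2 t)) \<le> norm n2 + \<epsilon> * (V + D)"
          by (intro norm_triangle_le add_mono order_refl * V D t)
        then show ?thesis
          by (intro norm_triangle_le add_mono * V D t)
             (simp_all add: mult_left_mono)
      qed
      also have "\<dots> \<le> \<epsilon> * (V + D) + (2 * R / \<delta> * \<epsilon>) * (norm n2 + 1 * (V + D))"
        using \<alpha>[OF t(1)] \<epsilon> \<epsilon>' *[OF V(1)[OF t(1)] D(1)[OF t(1)]] R \<delta>
          order_trans[OF norm_ge_zero V(1)[OF t(1)]] order_trans[OF norm_ge_zero D(1)[OF t(1)]]
        by (intro add_mono mult_mono) auto
      also have "\<dots> = C * \<epsilon>" by (simp add: C_def algebra_simps)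
      finally show ?thesis .
    qed
    have "0 < t" using t(1) \<open>t \<noteq> 0\<close> by simp
    then show ?thesis by (intro exI[of _ t] exI[of _ y] conjI yn Ly)
  qed
  note main = this
  show ?thesis
    by (rule exI[of _ \<epsilon>0], rule conjI[OF \<epsilon>0], rule exI[of _ C], intro allI impI, elim conjE) (rule main)
qed

section \<open>Scalar Dirac equations with a known kernel\<close>

text \<open>The equation \<open>- \<i> a' + \<alpha> a + \<beta> cnj a = f\<close> solved for the
  derivative. It is a relation between solution and right-hand side, since the operator is unbounded
  in the weighted spaces, and it is only real-linear because of \<open>cnj\<close>.\<close>

definition dirac_eq :: "(real \<Rightarrow> real) \<Rightarrow> (real \<Rightarrow> complex) \<Rightarrow> (real \<Rightarrow> complex) \<Rightarrow> (real \<Rightarrow> complex) \<Rightarrow> bool" where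
  "dirac_eq \<alpha> \<beta> a f \<longleftrightarrow> (\<forall>x. (a has_vector_derivative
     \<i> * (f x - of_real (\<alpha> x) * a x - \<beta> x * cnj (a x))) (at x))"

lemma dirac_eq_add:
  "dirac_eq \<alpha> \<beta> a f \<Longrightarrow> dirac_eq \<alpha> \<beta> b g \<Longrightarrow> dirac_eq \<alpha> \<beta> (\<lambda>x. a x + b x) (\<lambda>x. f x + g x)"
  unfolding dirac_eq_def
  by (auto intro!: derivative_eq_intros simp: algebra_simps)

lemma dirac_eq_scale:
  "dirac_eq \<alpha> \<beta> a f \<Longrightarrow> dirac_eq \<alpha> \<beta> (\<lambda>x. r *\<^sub>R a x) (\<lambda>x. r *\<^sub>R f x)"
  unfolding dirac_eq_def
  by (auto intro!: derivative_eq_intros simp: algebra_simps scaleR_conv_of_real)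

section \<open>Exponential weights, primitives and growth bounds\<close>

lemma exp_abs_integrals:
  fixes m :: real
  assumes "m > 0"
  shows integrable_exp_abs: "integrable lborel (\<lambda>x. exp (- m * \<bar>x\<bar>))"
    and integral_exp_abs_right: "x \<ge> 0 \<Longrightarrow> (LINT y|lborel. indicator {x..} y * exp (- m * \<bar>y\<bar>)) = exp (- m * \<bar>x\<bar>) / m"
    and integral_exp_abs_left: "x \<le> 0 \<Longrightarrow> (LINT y|lborel. indicator {..x} y * exp (- m * \<bar>y\<bar>)) = exp (- m * \<bar>x\<bar>) / m"
proof -
  have r: "has_bochner_integral lborel (\<lambda>y. indicator {x..} y * exp (- m * \<bar>y\<bar>)) (exp (- m * \<bar>x\<bar>) / m)"
    if "x \<ge> 0" for x
  proof -
    have "((\<lambda>y. exp (- m * y)) has_integral exp (- m * x) / m) {x..}"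
      using has_integral_exp_minus_to_infinity[OF assms] .
    then have "((\<lambda>y. indicator {x..} y * exp (- m * y)) has_integral exp (- m * x) / m) UNIV"
      by (subst (asm) has_integral_restrict_UNIV[symmetric], elim has_integral_eq[rotated])
         (auto simp: indicator_def)
    then have "has_bochner_integral lborel (\<lambda>y. indicator {x..} y * exp (- m * y)) (exp (- m * x) / m)"
      using nn_integral_has_integral_lborel[of "\<lambda>y. indicator {x..} y * exp (- m * y)" "exp (- m * x) / m"] assms
      by (intro has_bochner_integral_nn_integral) auto
    then show ?thesis
      by (rule has_bochner_integral_cong[THEN iffD1, rotated -1]) (use that in \<open>auto simp: indicator_def\<close>)
  qed
  have l: "has_bochner_integral lborel (\<lambda>y. indicator {..x} y * exp (- m * \<bar>y\<bar>)) (exp (- m * \<bar>x\<bar>) / m)"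
    if "x \<le> 0" for x
  proof -
    have "has_bochner_integral lborel (\<lambda>y. indicator {-x..} (0 + (-1) * y) * exp (- m * \<bar>0 + (-1) * y\<bar>)) (exp (- m * \<bar>-x\<bar>) / m)"
      using lborel_has_bochner_integral_real_affine_iff[of "-1"
          "\<lambda>y. indicator {-x..} y * exp (- m * \<bar>y\<bar>)" "exp (- m * \<bar>-x\<bar>) / m" 0] r[of "-x"] that by simp
    then show ?thesis
      by (rule has_bochner_integral_cong[THEN iffD1, rotated -1]) (auto simp: indicator_def)
  qed
  show "x \<ge> 0 \<Longrightarrow> (LINT y|lborel. indicator {x..} y * exp (- m * \<bar>y\<bar>)) = exp (- m * \<bar>x\<bar>) / m"
    "x \<le> 0 \<Longrightarrow> (LINT y|lborel. indicator {..x} y * exp (- m * \<bar>y\<bar>)) = exp (- m * \<bar>x\<bar>) / m"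
    using r l by (auto simp: has_bochner_integral_iff)
  have "integrable lborel (\<lambda>y. indicator {0..} y * exp (- m * \<bar>y\<bar>) + indicator {..0} y * exp (- m * \<bar>y\<bar>))"
    using r[of 0] l[of 0] by (auto simp: has_bochner_integral_iff)
  then show "integrable lborel (\<lambda>x. exp (- m * \<bar>x\<bar>))"
    by (rule Bochner_Integration.integrable_bound) (auto simp: indicator_def)
qed

lemma integrable_exp_bound:
  fixes g :: "real \<Rightarrow> 'a::euclidean_space"
  assumes "continuous_on UNIV g" "m > 0" "\<And>x. norm (g x) \<le> M * exp (- m * \<bar>x\<bar>)"
  shows "integrable lborel g"
proof (rule Bochner_Integration.integrable_bound)
  show "integrable lborel (\<lambda>x. M * exp (- m * \<bar>x\<bar>))" using integrable_exp_abs[OF assms(2)] by simp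
  show "g \<in> borel_measurable lborel" using assms(1) by (simp add: borel_measurable_continuous_onI)
  show "AE x in lborel. norm (g x) \<le> norm (M * exp (- m * \<bar>x\<bar>))"
    using assms(3) by (auto intro!: AE_I2 order_trans[OF assms(3)])
qed

lemma integral_pos:
  fixes f :: "real \<Rightarrow> real"
  assumes "integrable lborel f" "\<And>x. f x > 0"
  shows "(LINT x|lborel. f x) > 0"
proof -
  have "(LINT x|lborel. f x) \<noteq> 0"
  proof
    assume "(LINT x|lborel. f x) = 0"
    then have "AE x in lborel. f x = 0"
      using integral_nonneg_eq_0_iff_AE[OF assms(1)] assms(2) by (simp add: less_imp_le)
    then have "AE x::real in lborel. False" by eventually_elim (metis assms(2) less_irrefl)
    then show False by (simp add: eventually_False ae_filter_eq_bot_iff)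
  qed
  moreover have "0 \<le> (LINT x|lborel. f x)" using assms(2) by (intro integral_nonneg_AE AE_I2 less_imp_le)
  ultimately show ?thesis by simp
qed

definition cumulative :: "(real \<Rightarrow> real) \<Rightarrow> real \<Rightarrow> real" where
  "cumulative g x = (LINT y|lborel. indicator {..x} y * g y)"

lemma cumulative_has_derivative:
  assumes "continuous_on UNIV g" "integrable lborel g"
  shows "(cumulative g has_real_derivative g x) (at x)"
proof -
  \<comment> \<open>A base point strictly left of \<open>x\<close> splits off a tail that is
    constant near \<open>x\<close>; what remains is an integral over a compact interval.\<close>
  define a where "a = x - 1"
  have si: "set_integrable lborel A g" if "A \<in> sets borel" for A
    unfolding set_integrable_def using assms(2) that integrable_mult_indicator[of A lborel g] by simp
  have eq: "cumulative g u = (LINT y:{..<a}|lborel. g y) + integral {a..u} g" if "u \<ge> a" for u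
  proof -
    have "cumulative g u = (LINT y:{..<a} \<union> {a..u}|lborel. g y)"
      unfolding cumulative_def set_lebesgue_integral_def
      by (intro Bochner_Integration.integral_cong) (use that in \<open>auto simp: indicator_def\<close>)
    also have "\<dots> = (LINT y:{..<a}|lborel. g y) + (LINT y:{a..u}|lborel. g y)"
      by (intro set_integral_Un si) auto
    also have "(LINT y:{a..u}|lborel. g y) = integral {a..u} g"
      by (intro set_borel_integral_eq_integral si) auto
    finally show ?thesis .
  qed
  have "((\<lambda>u. integral {a..u} g) has_real_derivative g x) (at x within {a..x+1})"
    by (intro integral_has_real_derivative continuous_on_subset[OF assms(1)]) (auto simp: a_def)
  then have "((\<lambda>u. integral {a..u} g) has_real_derivative g x) (at x)"
    by (subst (asm) at_within_interior) (auto simp: a_def interior_atLeastAtMost_real)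
  then have "((\<lambda>u. (LINT y:{..<a}|lborel. g y) + integral {a..u} g) has_real_derivative g x) (at x)"
    by (auto intro!: derivative_eq_intros)
  then show ?thesis
  proof (rule DERIV_cong_ev[THEN iffD1, rotated -1, OF _ refl _ refl])
    show "\<forall>\<^sub>F u in nhds x. (LINT y:{..<a}|lborel. g y) + integral {a..u} g = cumulative g u"
      using eventually_nhds_in_open[of "{a<..}" x] by (auto elim!: eventually_mono simp: eq a_def)
  qed
qed

text \<open>The mean zero condition makes the primitive decay at both ends.\<close>

lemma cumulative_bound:
  assumes "continuous_on UNIV g" "m > 0" "\<And>x. \<bar>g x\<bar> \<le> M * exp (- m * \<bar>x\<bar>)" "(LINT x|lborel. g x) = 0"
  shows "\<bar>cumulative g x\<bar> \<le> M / m * exp (- m * \<bar>x\<bar>)"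
proof -
  have int: "integrable lborel g" using assms(1-3) by (intro integrable_exp_bound) auto
  have inti: "integrable lborel (\<lambda>y. indicator A y * g y)" if "A \<in> sets borel" for A
    using int that integrable_mult_indicator[of A lborel g] by simp
  have bd: "\<bar>LINT y|lborel. indicator A y * g y\<bar> \<le> M * (LINT y|lborel. indicator A y * exp (- m * \<bar>y\<bar>))"
    if "A \<in> sets borel" for A
  proof -
    have "\<bar>LINT y|lborel. indicator A y * g y\<bar> \<le> (LINT y|lborel. \<bar>indicator A y * g y\<bar>)"
      using integral_norm_bound[of lborel "\<lambda>y. indicator A y * g y"] by simp
    also have "\<dots> \<le> (LINT y|lborel. M * (indicator A y * exp (- m * \<bar>y\<bar>)))"
      using integrable_mult_indicator[OF _ integrable_exp_abs[OF assms(2)], of A] that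
      by (intro integral_mono integrable_abs inti integrable_mult_right)
         (use assms(3) in \<open>auto simp: indicator_def\<close>)
    finally show ?thesis by simp
  qed
  show ?thesis
  proof (cases "x \<le> 0")
    case True
    then show ?thesis using bd[of "{..x}"] integral_exp_abs_left[OF assms(2) True]
      by (simp add: cumulative_def)
  next
    case False
    have "cumulative g x + (LINT y|lborel. indicator {x..} y * g y) = (LINT y|lborel. g y)"
      unfolding cumulative_def
    proof (subst Bochner_Integration.integral_add[symmetric, OF inti inti])
      show "(LINT y|lborel. indicator {..x} y * g y + indicator {x..} y * g y) = (LINT y|lborel. g y)"
      proof (rule integral_cong_AE)
        show "AE y in lborel. indicator {..x} y * g y + indicator {x..} y * g y = g y"
          using AE_lborel_singleton[of x] by eventually_elim (auto simp: indicator_def)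
      qed (use borel_measurable_integrable[OF int] in measurable)
    qed auto
    then have "cumulative g x = - (LINT y|lborel. indicator {x..} y * g y)" using assms(4) by simp
    then show ?thesis using bd[of "{x..}"] integral_exp_abs_right[OF assms(2), of x] False by simp
  qed
qed

text \<open>On the right half-line \<open>u x - M / \<nu> * exp (\<nu> * x)\<close> is
  nonincreasing. Applied to \<open>s\<close> and \<open>- s\<close>, and to both after reflection of
  the argument, this gives the two-sided bound.\<close>

lemma exp_growth_bound:
  fixes s :: "real \<Rightarrow> real"
  assumes s: "s 0 = 0" "\<And>x. (s has_real_derivative h x) (at x)"
    and h: "\<And>x. \<bar>h x\<bar> \<le> M * exp (\<nu> * \<bar>x\<bar>)" and "\<nu> > 0"
  shows "\<bar>s x\<bar> \<le> M / \<nu> * exp (\<nu> * \<bar>x\<bar>)"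
proof -
  have M: "M \<ge> 0" using h[of 0] by simp
  have *: "u x \<le> M / \<nu> * exp (\<nu> * x)"
    if x: "x \<ge> 0" and u: "u 0 = 0" "\<And>x. (u has_real_derivative k x) (at x)" "\<And>x. \<bar>k x\<bar> \<le> M * exp (\<nu> * \<bar>x\<bar>)"
    for x u k
  proof -
    have "u x - M / \<nu> * exp (\<nu> * x) \<le> u 0 - M / \<nu> * exp (\<nu> * 0)"
    proof (rule DERIV_nonpos_imp_nonincreasing[OF x])
      fix y :: real assume y: "0 \<le> y" "y \<le> x"
      have "((\<lambda>x. u x - M / \<nu> * exp (\<nu> * x)) has_real_derivative k y - M * exp (\<nu> * y)) (at y)"
        using \<open>\<nu> > 0\<close> by (auto intro!: derivative_eq_intros u)
      moreover have "k y - M * exp (\<nu> * y) \<le> 0" using u(3)[of y] y by simp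
      ultimately show "\<exists>d. ((\<lambda>x. u x - M / \<nu> * exp (\<nu> * x)) has_real_derivative d) (at y) \<and> d \<le> 0"
        by blast
    qed
    then show ?thesis using u(1) divide_nonneg_pos[OF M \<open>\<nu> > 0\<close>] by simp
  qed
  have m: "((\<lambda>x. s (- x)) has_real_derivative - h (- x)) (at x)" for x
    using DERIV_mirror[THEN iffD1, OF s(2)] .
  have p: "((\<lambda>x. - s x) has_real_derivative - h x) (at x)" 
       "((\<lambda>x. - s (- x)) has_real_derivative h (- x)) (at x)" for x
    using s(2) m by (auto intro!: derivative_eq_intros)
  have h': "\<bar>- h x\<bar> \<le> M * exp (\<nu> * \<bar>x\<bar>)" "\<bar>h (- x)\<bar> \<le> M * exp (\<nu> * \<bar>x\<bar>)" "\<bar>- h (- x)\<bar> \<le> M * exp (\<nu> * \<bar>x\<bar>)" for x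
    using h[of x] h[of "-x"] by simp_all
  show ?thesis
  proof (cases "x \<ge> 0")
    case True
    show ?thesis
      using *[OF True s(1) s(2) h] *[OF True _ p(1) h'(1)] s(1) True by (simp add: abs_le_iff)
  next
    case False
    then have "-x \<ge> 0" by simp
    from *[OF this _ m h'(3)] *[OF this _ p(2) h'(2)] s(1) False show ?thesis
      by (simp add: abs_le_iff)
  qed
qed

section \<open>Decaying functions and the explicit solution operator\<close>

definition decaying :: "real \<Rightarrow> (real \<Rightarrow> complex) \<Rightarrow> real \<Rightarrow> bool" where
  "decaying \<kappa> f M \<longleftrightarrow> continuous_on UNIV f \<and> (\<forall>x. norm (f x) \<le> M * exp (- \<kappa> * \<bar>x\<bar>))"

lemma decaying_linear:
  assumes "decaying \<kappa> f M" "decaying \<kappa> g M'"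
  shows "decaying \<kappa> (\<lambda>x. f x + g x) (M + M')" "decaying \<kappa> (\<lambda>x. r *\<^sub>R f x) (\<bar>r\<bar> * M)"
  using assms unfolding decaying_def
  by (auto intro!: continuous_intros norm_triangle_le simp: distrib_right add_mono mult_left_mono mult.assoc)

lemma decaying_mono: "decaying \<kappa> f M \<Longrightarrow> M \<le> M' \<Longrightarrow> decaying \<kappa> f M'"
  unfolding decaying_def by (meson exp_ge_zero mult_right_mono order_trans)

lemma decaying_nonneg: "decaying \<kappa> f M \<Longrightarrow> M \<ge> 0"
  unfolding decaying_def
  by (metis abs_zero exp_zero mult.right_neutral mult_zero_right norm_ge_zero order_trans)

text \<open>Only the real part enters because the equations are real-linear. For this form the Dirac
  operators are symmetric, so pairing with the kernel function expresses solvability.\<close>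

definition real_pairing :: "(real \<Rightarrow> complex) \<Rightarrow> (real \<Rightarrow> complex) \<Rightarrow> real" where
  "real_pairing f g = (LINT x|lborel. Re (f x * cnj (g x)))"

text \<open>The two-sided bound on \<open>\<psi>\<close> allows division by it without losing track
  of exponential rates. The weight \<kappa> lies strictly below \<mu>, so quotients by
  \<open>\<psi>\<close> may grow, at the positive rate \<open>\<mu> - \<kappa>\<close>.\<close>

locale dirac_kernel =
  fixes \<alpha> :: "real \<Rightarrow> real" and \<beta> \<psi> :: "real \<Rightarrow> complex" and \<mu> \<kappa> c C b :: real
  assumes kappa: "0 < \<kappa>" "\<kappa> < \<mu>"
    and cont: "continuous_on UNIV \<alpha>" "continuous_on UNIV \<beta>"
    and \<beta>_bound: "\<And>x. norm (\<beta> x) \<le> b"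
    and kernel: "dirac_eq \<alpha> \<beta> \<psi> (\<lambda>_. 0)"
    and c: "0 < c" and lower: "\<And>x. c * exp (- \<mu> * \<bar>x\<bar>) \<le> norm (\<psi> x)"
    and upper: "\<And>x. norm (\<psi> x) \<le> C * exp (- \<mu> * \<bar>x\<bar>)"
begin

lemma psi_deriv: "(\<psi> has_vector_derivative - \<i> * (of_real (\<alpha> x) * \<psi> x + \<beta> x * cnj (\<psi> x))) (at x)"
proof -
  have "(\<psi> has_vector_derivative \<i> * (0 - of_real (\<alpha> x) * \<psi> x - \<beta> x * cnj (\<psi> x))) (at x)"
    using kernel unfolding dirac_eq_def by blast
  then show ?thesis by (rule has_vector_derivative_eq_rhs) (simp add: algebra_simps)
qed

lemma psi_cont: "continuous_on UNIV \<psi>"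
  using psi_deriv by (auto simp: continuous_on_eq_continuous_at intro: has_vector_derivative_continuous)

lemma psi_nonzero [simp]: "\<psi> x \<noteq> 0"
  using lower[of x] c by (metis exp_gt_zero mult_pos_pos norm_zero not_less)

lemma psi_upper_kappa: "norm (\<psi> x) \<le> C * exp (- \<kappa> * \<bar>x\<bar>)"
proof -
  have "0 \<le> C * exp (- \<mu> * \<bar>x\<bar>)" using upper[of x] norm_ge_zero order_trans by blast
  then have "C \<ge> 0" by (simp add: zero_le_mult_iff)
  moreover have "exp (- \<mu> * \<bar>x\<bar>) \<le> exp (- \<kappa> * \<bar>x\<bar>)" using kappa by (simp add: mult_right_mono)
  ultimately show ?thesis using upper[of x] by (meson mult_left_mono order_trans)
qed

lemma C_pos: "C > 0"
proof -
  have "c \<le> C" using lower[of 0] upper[of 0] by simp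
  then show ?thesis using c by simp
qed

abbreviation pairing :: "(real \<Rightarrow> complex) \<Rightarrow> real" where
  "pairing f \<equiv> real_pairing f \<psi>"

definition flux :: "(real \<Rightarrow> complex) \<Rightarrow> real \<Rightarrow> real" where
  "flux f = cumulative (\<lambda>x. Re (f x * cnj (\<psi> x)))"

text \<open>The derivative of the real factor \<open>s\<close> in the ansatz
  \<open>\<psi> (s + \<i> r)\<close> with \<open>r = flux f / |\<psi>|^2\<close>. It is the real
  part of \<open>\<i> f / \<psi> - 2 r \<beta> cnj \<psi> / \<psi>\<close>.\<close>

definition slope :: "(real \<Rightarrow> complex) \<Rightarrow> real \<Rightarrow> real" where
  "slope f x = - 2 * (flux f x / (norm (\<psi> x))\<^sup>2) * Re (\<beta> x * cnj (\<psi> x) / \<psi> x) - Im (f x / \<psi> x)"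

text \<open>
  Writing the solution as \<open>\<psi> (s + i r)\<close>, the quantity \<open>|\<psi>|\<^sup>2 r\<close> is a primitive of
  \<open>Re (f cnj \<psi>)\<close>, and \<open>s\<close> is then obtained by one more integration.
\<close>

definition green :: "(real \<Rightarrow> complex) \<Rightarrow> real \<Rightarrow> complex" where
  "green f x = \<psi> x * Complex (LBINT y=0..x. slope f y) (flux f x / (norm (\<psi> x))\<^sup>2)"

lemma pair_bound:
  assumes "decaying \<kappa> f M"
  shows "\<bar>Re (f x * cnj (\<psi> x))\<bar> \<le> M * C * exp (- (\<kappa> + \<mu>) * \<bar>x\<bar>)"
proof -
  have "\<bar>Re (f x * cnj (\<psi> x))\<bar> \<le> norm (f x) * norm (\<psi> x)"
    using abs_Re_le_cmod[of "f x * cnj (\<psi> x)"] by (simp add: norm_mult)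
  also have "\<dots> \<le> (M * exp (- \<kappa> * \<bar>x\<bar>)) * (C * exp (- \<mu> * \<bar>x\<bar>))"
    using assms upper[of x] unfolding decaying_def
    by (intro mult_mono') auto
  also have "\<dots> = M * C * exp (- (\<kappa> + \<mu>) * \<bar>x\<bar>)"
    by (simp add: exp_add[symmetric] algebra_simps)
  finally show ?thesis .
qed

lemma pair_cont:
  assumes "decaying \<kappa> f M"
  shows "continuous_on UNIV (\<lambda>x. Re (f x * cnj (\<psi> x)))"
  using assms psi_cont unfolding decaying_def by (intro continuous_intros) auto

lemma pair_integrable:
  assumes "decaying \<kappa> f M"
  shows "integrable lborel (\<lambda>x. Re (f x * cnj (\<psi> x)))"
  using pair_bound[OF assms] kappa by (intro integrable_exp_bound[OF pair_cont[OF assms], of "\<kappa> + \<mu>"]) auto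

lemma flux_deriv:
  assumes "decaying \<kappa> f M"
  shows "(flux f has_real_derivative Re (f x * cnj (\<psi> x))) (at x)"
  unfolding flux_def by (rule cumulative_has_derivative[OF pair_cont[OF assms] pair_integrable[OF assms]])

lemma slope_cont:
  assumes "decaying \<kappa> f M"
  shows "continuous_on UNIV (slope f)"
proof -
  have "continuous_on UNIV (flux f)"
    by (simp add: continuous_at_imp_continuous_on DERIV_isCont[OF flux_deriv[OF assms]])
  then show ?thesis unfolding slope_def using assms psi_cont cont unfolding decaying_def
    by (intro continuous_intros) auto
qed

lemma slope_integral_deriv:
  assumes "decaying \<kappa> f M"
  shows "((\<lambda>x. LBINT y=0..x. slope f y) has_real_derivative slope f x) (at x)"
proof -
  define a where "a = \<bar>x\<bar> + 1"
  have "((\<lambda>x. LBINT y=0..x. slope f y) has_vector_derivative slope f x) (at x within {-a..a})"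
    unfolding zero_ereal_def
    by (rule interval_integral_FTC2) (auto simp: a_def intro!: continuous_on_subset[OF slope_cont[OF assms]])
  then show ?thesis
    by (subst (asm) at_within_interior)
       (auto simp: a_def interior_atLeastAtMost_real has_real_derivative_iff_has_vector_derivative)
qed

lemma green_solves:
  assumes "decaying \<kappa> f M"
  shows "dirac_eq \<alpha> \<beta> (green f) f"
  unfolding dirac_eq_def
proof
  fix x
  define r where "r x = flux f x / ((Re (\<psi> x))\<^sup>2 + (Im (\<psi> x))\<^sup>2)" for x
  define s where "s x = (LBINT y=0..x. slope f y)" for x :: real
  define N where "N = (Re (\<psi> x))\<^sup>2 + (Im (\<psi> x))\<^sup>2"
  have green_eq: "green f = (\<lambda>x. \<psi> x * (of_real (s x) + \<i> * of_real (r x)))"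
    unfolding green_def s_def r_def cmod_power2 
    by (simp add: Complex_eq)
  have N: "N \<noteq> 0" using psi_nonzero[of x] unfolding N_def by (simp add: complex_eq_iff del: psi_nonzero)
  define d where "d = - \<i> * (of_real (\<alpha> x) * \<psi> x + \<beta> x * cnj (\<psi> x))"
  have \<psi>': "(\<psi> has_vector_derivative d) (at x)" unfolding d_def by (rule psi_deriv)
  have ReIm: "((\<lambda>x. Re (\<psi> x)) has_real_derivative Re d) (at x)" "((\<lambda>x. Im (\<psi> x)) has_real_derivative Im d) (at x)"
    using \<psi>' by (auto simp: has_real_derivative_iff_has_vector_derivative
        intro: bounded_linear.has_vector_derivative[OF bounded_linear_Re] bounded_linear.has_vector_derivative[OF bounded_linear_Im])
  define s' where "s' = slope f x"
  define r' where "r' = (Re (f x * cnj (\<psi> x)) * N - flux f x * (2 * Re (\<psi> x) * Re d + 2 * Im (\<psi> x) * Im d)) / (N * N)"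
  have r': "(r has_real_derivative r') (at x)"
  proof -
    have "((\<lambda>x. (Re (\<psi> x))\<^sup>2 + (Im (\<psi> x))\<^sup>2) has_real_derivative 2 * Re (\<psi> x) * Re d + 2 * Im (\<psi> x) * Im d) (at x)"
      using DERIV_add[OF DERIV_power[OF ReIm(1), of 2] DERIV_power[OF ReIm(2), of 2]] by (simp add: mult_ac)
    from DERIV_divide[OF flux_deriv[OF assms] this] N show ?thesis
      unfolding r_def r'_def N_def by simp
  qed
  have s': "(s has_real_derivative s') (at x)"
    using slope_integral_deriv[OF assms] unfolding s_def s'_def .
  have "(green f has_vector_derivative d * (of_real (s x) + \<i> * of_real (r x)) + \<psi> x * (of_real s' + \<i> * of_real r')) (at x)"
    unfolding green_eq using s' r' \<psi>'
    by (auto intro!: derivative_eq_intros has_vector_derivative_of_real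
        simp: has_real_derivative_iff_has_vector_derivative algebra_simps)
  moreover have "d * (of_real (s x) + \<i> * of_real (r x)) + \<psi> x * (of_real s' + \<i> * of_real r')
      = \<i> * (f x - of_real (\<alpha> x) * green f x - \<beta> x * cnj (green f x))"
  proof -
    \<comment> \<open>Dividing by \<open>\<psi> x\<close> turns \<open>\<beta> cnj \<psi>\<close>
      and \<open>f\<close> into the factors \<open>q\<close> and \<open>h\<close>; the equation to
      be checked becomes \<open>s' + \<i> r' = \<i> h - 2 r q\<close>, whose imaginary part is the
      flux identity.\<close>
    define q where "q = \<beta> x * cnj (\<psi> x) / \<psi> x"
    define h where "h = f x / \<psi> x"
    have q: "\<beta> x * cnj (\<psi> x) = q * \<psi> x" and h: "f x = h * \<psi> x" by (simp_all add: q_def h_def)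
    have NN: "\<psi> x * cnj (\<psi> x) = of_real N" by (simp add: N_def complex_mult_cnj)
    have s'_eq: "s' = - 2 * r x * Re q - Im h"
      by (simp add: s'_def slope_def r_def q_def h_def cmod_power2)
    have d: "d = - \<i> * (of_real (\<alpha> x) + q) * \<psi> x" unfolding d_def q by (simp add: algebra_simps)
    have "2 * Re (\<psi> x) * Re d + 2 * Im (\<psi> x) * Im d = 2 * Re (d * cnj (\<psi> x))" by simp
    also have "d * cnj (\<psi> x) = - \<i> * (of_real (\<alpha> x) + q) * of_real N"
      unfolding d NN[symmetric] by (simp add: algebra_simps)
    finally have "2 * Re (\<psi> x) * Re d + 2 * Im (\<psi> x) * Im d = 2 * Im q * N" by simp
    moreover have "Re (f x * cnj (\<psi> x)) = Re h * N"
      unfolding h mult.assoc NN by simp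
    moreover have "flux f x = r x * N" using N by (simp add: r_def N_def)
    ultimately have "r' = (Re h * N * N - r x * N * (2 * Im q * N)) / (N * N)"
      unfolding r'_def by simp
    also have "\<dots> = Re h - 2 * r x * Im q" using N by (simp add: field_simps)
    finally have r'_eq: "r' = Re h - 2 * r x * Im q" .
    have *: "of_real s' + \<i> * of_real r' = \<i> * h - 2 * of_real (r x) * q"
      unfolding s'_eq r'_eq by (simp add: complex_eq_iff)
    have cg: "\<beta> x * cnj (green f x) = q * \<psi> x * (of_real (s x) - \<i> * of_real (r x))"
      unfolding green_eq q[symmetric] by simp
    show ?thesis unfolding * cg unfolding d h green_eq
      by (simp add: algebra_simps)
  qed
  ultimately show "(green f has_vector_derivative \<i> * (f x - of_real (\<alpha> x) * green f x - \<beta> x * cnj (green f x))) (at x)"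
    by simp
qed

lemma exp_ratio:
  assumes "M \<ge> 0"
  shows "M * exp (- (\<kappa> + \<mu>) * \<bar>x\<bar>) / (norm (\<psi> x))\<^sup>2 \<le> M / c\<^sup>2 * exp ((\<mu> - \<kappa>) * \<bar>x\<bar>)"
    and "M * exp (- \<kappa> * \<bar>x\<bar>) / norm (\<psi> x) \<le> M / c * exp ((\<mu> - \<kappa>) * \<bar>x\<bar>)"
proof -
  have pos: "0 < c * exp (- \<mu> * \<bar>x\<bar>)" using c by simp
  have "M * exp (- \<kappa> * \<bar>x\<bar>) / norm (\<psi> x) \<le> M * exp (- \<kappa> * \<bar>x\<bar>) / (c * exp (- \<mu> * \<bar>x\<bar>))"
    using pos lower[of x] assms by (intro divide_left_mono) (auto intro!: mult_pos_pos)
  also have "\<dots> = M / c * exp ((\<mu> - \<kappa>) * \<bar>x\<bar>)"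
    by (simp add: exp_diff exp_minus exp_add field_simps)
  finally show "M * exp (- \<kappa> * \<bar>x\<bar>) / norm (\<psi> x) \<le> M / c * exp ((\<mu> - \<kappa>) * \<bar>x\<bar>)" .
  have "(c * exp (- \<mu> * \<bar>x\<bar>))\<^sup>2 \<le> (norm (\<psi> x))\<^sup>2"
    using pos lower[of x] by (intro power_mono) auto
  then have "M * exp (- (\<kappa> + \<mu>) * \<bar>x\<bar>) / (norm (\<psi> x))\<^sup>2 \<le> M * exp (- (\<kappa> + \<mu>) * \<bar>x\<bar>) / (c * exp (- \<mu> * \<bar>x\<bar>))\<^sup>2"
    using pos assms c by (intro divide_left_mono) auto
  also have "\<dots> = M / c\<^sup>2 * exp ((\<mu> - \<kappa>) * \<bar>x\<bar>)"
  proof -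
    have "exp (- (\<kappa> + \<mu>) * \<bar>x\<bar>) = exp ((\<mu> - \<kappa>) * \<bar>x\<bar>) * (exp (- \<mu> * \<bar>x\<bar>))\<^sup>2"
      by (simp add: exp_add[symmetric] power2_eq_square algebra_simps)
    then show ?thesis using c by (simp add: power_mult_distrib)
  qed
  finally show "M * exp (- (\<kappa> + \<mu>) * \<bar>x\<bar>) / (norm (\<psi> x))\<^sup>2 \<le> M / c\<^sup>2 * exp ((\<mu> - \<kappa>) * \<bar>x\<bar>)" .
qed

definition flux_const :: real where "flux_const = C / ((\<kappa> + \<mu>) * c\<^sup>2)"
definition slope_const :: real where "slope_const = 2 * flux_const * b + 1 / c"
definition green_const :: real where "green_const = C * (slope_const / (\<mu> - \<kappa>) + flux_const)"

text \<open>Zero mean makes \<open>flux f\<close> decay at both ends at the rate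
  \<open>\<kappa> + \<mu>\<close>. Division by the square of \<open>\<psi>\<close> leaves growth at
  the rate \<open>\<mu> - \<kappa>\<close>, integration of \<open>slope f\<close> keeps that rate
  because it is positive, and the final factor \<open>\<psi>\<close> turns it into decay at the rate
  \<kappa>.\<close>

lemma green_bound:
  assumes f: "decaying \<kappa> f M" and mean: "pairing f = 0"
  shows "norm (green f x) \<le> green_const * M * exp (- \<kappa> * \<bar>x\<bar>)"
proof -
  have M: "M \<ge> 0" using decaying_nonneg[OF f] .
  have b: "b \<ge> 0" using \<beta>_bound[of 0] norm_ge_zero order_trans by blast
  have flux: "\<bar>flux f x / (norm (\<psi> x))\<^sup>2\<bar> \<le> flux_const * M * exp ((\<mu> - \<kappa>) * \<bar>x\<bar>)" for x
  proof -
    have "\<bar>flux f x\<bar> \<le> M * C / (\<kappa> + \<mu>) * exp (- (\<kappa> + \<mu>) * \<bar>x\<bar>)"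
      unfolding flux_def using kappa mean unfolding real_pairing_def
      by (intro cumulative_bound pair_cont[OF f] pair_bound[OF f]) auto
    then have "\<bar>flux f x\<bar> / (norm (\<psi> x))\<^sup>2 \<le> M * C / (\<kappa> + \<mu>) * exp (- (\<kappa> + \<mu>) * \<bar>x\<bar>) / (norm (\<psi> x))\<^sup>2"
      by (rule divide_right_mono) simp
    then have "\<bar>flux f x / (norm (\<psi> x))\<^sup>2\<bar> \<le> M * C / (\<kappa> + \<mu>) * exp (- (\<kappa> + \<mu>) * \<bar>x\<bar>) / (norm (\<psi> x))\<^sup>2"
      by simp
    also have "\<dots> \<le> M * C / (\<kappa> + \<mu>) / c\<^sup>2 * exp ((\<mu> - \<kappa>) * \<bar>x\<bar>)"
      using M C_pos kappa by (intro exp_ratio) simp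
    finally show ?thesis by (simp add: flux_const_def mult_ac)
  qed
  have slope: "\<bar>slope f x\<bar> \<le> slope_const * M * exp ((\<mu> - \<kappa>) * \<bar>x\<bar>)" for x
  proof -
    have "\<bar>Re (\<beta> x * cnj (\<psi> x) / \<psi> x)\<bar> \<le> b"
      using abs_Re_le_cmod[of "\<beta> x * cnj (\<psi> x) / \<psi> x"] \<beta>_bound[of x] by (simp add: norm_mult norm_divide)
    then have 1: "\<bar>flux f x / (norm (\<psi> x))\<^sup>2\<bar> * \<bar>Re (\<beta> x * cnj (\<psi> x) / \<psi> x)\<bar> \<le> (flux_const * M * exp ((\<mu> - \<kappa>) * \<bar>x\<bar>)) * b"
      using flux[of x] by (intro mult_mono') auto
    have "\<bar>Im (f x / \<psi> x)\<bar> \<le> norm (f x) / norm (\<psi> x)"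
      using abs_Im_le_cmod[of "f x / \<psi> x"] by (simp add: norm_divide)
    also have "\<dots> \<le> M * exp (- \<kappa> * \<bar>x\<bar>) / norm (\<psi> x)"
      using f unfolding decaying_def by (intro divide_right_mono) auto
    also have "\<dots> \<le> M / c * exp ((\<mu> - \<kappa>) * \<bar>x\<bar>)" by (rule exp_ratio[OF M])
    finally have 2: "\<bar>Im (f x / \<psi> x)\<bar> \<le> M / c * exp ((\<mu> - \<kappa>) * \<bar>x\<bar>)" .
    have "\<bar>slope f x\<bar> \<le> 2 * (\<bar>flux f x / (norm (\<psi> x))\<^sup>2\<bar> * \<bar>Re (\<beta> x * cnj (\<psi> x) / \<psi> x)\<bar>) + \<bar>Im (f x / \<psi> x)\<bar>"
    proof -
      have "\<bar>- 2 * r * q - i\<bar> \<le> 2 * (\<bar>r\<bar> * \<bar>q\<bar>) + \<bar>i\<bar>" for r q i :: real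
        using abs_triangle_ineq4[of "- 2 * r * q" i] by (simp add: abs_mult)
      then show ?thesis unfolding slope_def .
    qed
    also have "\<dots> \<le> 2 * ((flux_const * M * exp ((\<mu> - \<kappa>) * \<bar>x\<bar>)) * b) + M / c * exp ((\<mu> - \<kappa>) * \<bar>x\<bar>)"
      using 1 2 by simp
    finally show ?thesis by (simp add: slope_const_def algebra_simps)
  qed
  have "\<bar>LBINT y=0..x. slope f y\<bar> \<le> slope_const * M / (\<mu> - \<kappa>) * exp ((\<mu> - \<kappa>) * \<bar>x\<bar>)"
    using kappa slope_integral_deriv[OF f] slope
    by (intro exp_growth_bound[where s = "\<lambda>x. LBINT y=0..x. slope f y" and h = "slope f"])
       (auto simp: zero_ereal_def interval_integral_endpoints_same)
  then have "\<bar>LBINT y=0..x. slope f y\<bar> + \<bar>flux f x / (norm (\<psi> x))\<^sup>2\<bar>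
      \<le> (slope_const / (\<mu> - \<kappa>) + flux_const) * M * exp ((\<mu> - \<kappa>) * \<bar>x\<bar>)"
    using flux[of x] by (simp add: algebra_simps)
  then have "norm (Complex (LBINT y=0..x. slope f y) (flux f x / (norm (\<psi> x))\<^sup>2))
      \<le> (slope_const / (\<mu> - \<kappa>) + flux_const) * M * exp ((\<mu> - \<kappa>) * \<bar>x\<bar>)"
    using cmod_le[of "Complex (LBINT y=0..x. slope f y) (flux f x / (norm (\<psi> x))\<^sup>2)"] by simp
  then have "norm (green f x) \<le> (C * exp (- \<mu> * \<bar>x\<bar>)) * ((slope_const / (\<mu> - \<kappa>) + flux_const) * M * exp ((\<mu> - \<kappa>) * \<bar>x\<bar>))"
    unfolding green_def norm_mult using upper[of x] by (intro mult_mono') auto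
  also have "\<dots> = green_const * M * exp (- \<kappa> * \<bar>x\<bar>)"
    by (simp add: green_const_def exp_add[symmetric] algebra_simps)
  finally show ?thesis .
qed

lemma pairing_linear:
  assumes "decaying \<kappa> f M" "decaying \<kappa> g M'"
  shows "pairing (\<lambda>x. f x + g x) = pairing f + pairing g" "pairing (\<lambda>x. r *\<^sub>R f x) = r * pairing f"
proof -
  show "pairing (\<lambda>x. f x + g x) = pairing f + pairing g"
    unfolding real_pairing_def
    by (subst Bochner_Integration.integral_add[symmetric, OF assms[THEN pair_integrable]]) (simp add: algebra_simps)
  show "pairing (\<lambda>x. r *\<^sub>R f x) = r * pairing f"
    unfolding real_pairing_def by (subst Bochner_Integration.integral_mult_right_zero[symmetric]) (simp add: algebra_simps)
qed

lemma flux_linear: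
  assumes "decaying \<kappa> f M" "decaying \<kappa> g M'"
  shows "flux (\<lambda>x. f x + g x) x = flux f x + flux g x" "flux (\<lambda>x. r *\<^sub>R f x) x = r * flux f x"
proof -
  have i: "integrable lborel (\<lambda>y. indicator {..x} y * Re (h y * cnj (\<psi> y)))" if "decaying \<kappa> h M" for h M
    using integrable_mult_indicator[OF _ pair_integrable[OF that], of "{..x}"] by simp
  show "flux (\<lambda>x. f x + g x) x = flux f x + flux g x"
    unfolding flux_def cumulative_def
    by (subst Bochner_Integration.integral_add[symmetric, OF assms[THEN i]]) (simp add: algebra_simps)
  show "flux (\<lambda>x. r *\<^sub>R f x) x = r * flux f x"
    unfolding flux_def cumulative_def
    by (subst Bochner_Integration.integral_mult_right_zero[symmetric]) (simp add: algebra_simps)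
qed

lemma green_linear:
  assumes "decaying \<kappa> f M" "decaying \<kappa> g M'"
  shows "green (\<lambda>x. f x + g x) x = green f x + green g x" "green (\<lambda>x. r *\<^sub>R f x) x = r *\<^sub>R green f x"
proof -
  have i: "interval_lebesgue_integrable lborel 0 (ereal x) (slope h)" if "decaying \<kappa> h M" for h M
    unfolding zero_ereal_def using slope_cont[OF that]
    by (intro interval_integrable_isCont) (simp add: continuous_on_eq_continuous_at)
  have "slope (\<lambda>x. f x + g x) = (\<lambda>y. slope f y + slope g y)"
    by (auto simp: slope_def flux_linear[OF assms] add_divide_distrib algebra_simps)
  then show "green (\<lambda>x. f x + g x) x = green f x + green g x"
    unfolding green_def
    by (simp add: interval_lebesgue_integral_add[OF assms[THEN i]] flux_linear[OF assms] complex_eq_iff algebra_simps add_divide_distrib)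
  have "slope (\<lambda>x. r *\<^sub>R f x) = (\<lambda>y. r * slope f y)"
    unfolding slope_def flux_linear[OF assms]
    by (simp add: fun_eq_iff algebra_simps scaleR_conv_of_real flip: times_divide_eq_right)
  then show "green (\<lambda>x. r *\<^sub>R f x) x = r *\<^sub>R green f x"
    unfolding green_def
    by (simp add: flux_linear[OF assms] complex_eq_iff algebra_simps)
qed

end

section \<open>Weighted spaces of decaying functions as Banach spaces\<close>

definition weighted :: "real \<Rightarrow> (real \<Rightarrow>\<^sub>C complex) \<Rightarrow> real \<Rightarrow> complex" where
  "weighted \<kappa> g x = exp (- \<kappa> * \<bar>x\<bar>) *\<^sub>R g x"

text \<open>An abstraction function is applied to the rescaled function, so the value is meaningful
  only if \<open>f\<close> decays at the rate \<kappa>; hence the \<open>decaying\<close> hypotheses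
  below.\<close>

definition unweighted :: "real \<Rightarrow> (real \<Rightarrow> complex) \<Rightarrow> (real \<Rightarrow>\<^sub>C complex)" where
  "unweighted \<kappa> f = Bcontfun (\<lambda>x. exp (\<kappa> * \<bar>x\<bar>) *\<^sub>R f x)"

lemma decaying_weighted: "decaying \<kappa> (weighted \<kappa> g) (norm g)"
  unfolding decaying_def weighted_def
  by (auto intro!: continuous_intros mult_right_mono norm_bounded simp: mult.commute)

lemma weighted_linear:
  "weighted \<kappa> (f + g) = (\<lambda>x. weighted \<kappa> f x + weighted \<kappa> g x)"
  "weighted \<kappa> (f - g) = (\<lambda>x. weighted \<kappa> f x - weighted \<kappa> g x)"
  "weighted \<kappa> (r *\<^sub>R f) = (\<lambda>x. r *\<^sub>R weighted \<kappa> f x)"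
  "weighted \<kappa> 0 = (\<lambda>x. 0)"
  by (auto simp: weighted_def algebra_simps)

lemma weighted_inject: "weighted \<kappa> f = weighted \<kappa> g \<Longrightarrow> f = g"
  by (rule bcontfun_eqI) (metis weighted_def scaleR_cancel_left exp_not_eq_zero)

lemma
  assumes "decaying \<kappa> f M"
  shows weighted_unweighted: "weighted \<kappa> (unweighted \<kappa> f) = f"
    and norm_unweighted: "norm (unweighted \<kappa> f) \<le> M"
proof -
  have bd: "norm (exp (\<kappa> * \<bar>x\<bar>) *\<^sub>R f x) \<le> M" for x
  proof -
    have "norm (exp (\<kappa> * \<bar>x\<bar>) *\<^sub>R f x) \<le> exp (\<kappa> * \<bar>x\<bar>) * (M * exp (- \<kappa> * \<bar>x\<bar>))"
      using assms unfolding decaying_def by simp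
    also have "\<dots> = M" by (simp add: exp_minus field_simps)
    finally show ?thesis .
  qed
  have app: "apply_bcontfun (unweighted \<kappa> f) x = exp (\<kappa> * \<bar>x\<bar>) *\<^sub>R f x" for x
    unfolding unweighted_def using assms bd unfolding decaying_def
    by (subst Bcontfun_inverse) (auto intro!: bcontfun_normI continuous_intros)
  show "weighted \<kappa> (unweighted \<kappa> f) = f"
    by (auto simp: weighted_def app exp_minus)
  show "norm (unweighted \<kappa> f) \<le> M" by (rule norm_bound) (simp only: app bd)
qed

text \<open>The operators are written on plain functions, while linearity and boundedness are
  demanded only on decaying ones. \<open>lift_operator\<close> carries them to bounded continuous
  functions, where the abstract reduction applies.\<close>

definition decay_operator :: "real \<Rightarrow> ((real \<Rightarrow> complex) \<Rightarrow> real \<Rightarrow> complex) \<Rightarrow> bool" where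
  "decay_operator \<kappa> T \<longleftrightarrow> (\<exists>k. \<forall>f M. decaying \<kappa> f M \<longrightarrow> decaying \<kappa> (T f) (k * M)) \<and>
     (\<forall>f g M M'. decaying \<kappa> f M \<longrightarrow> decaying \<kappa> g M' \<longrightarrow> T (\<lambda>x. f x + g x) = (\<lambda>x. T f x + T g x)) \<and>
     (\<forall>f r M. decaying \<kappa> f M \<longrightarrow> T (\<lambda>x. r *\<^sub>R f x) = (\<lambda>x. r *\<^sub>R T f x))"

definition lift_operator :: "real \<Rightarrow> ((real \<Rightarrow> complex) \<Rightarrow> real \<Rightarrow> complex) \<Rightarrow> (real \<Rightarrow>\<^sub>C complex) \<Rightarrow> (real \<Rightarrow>\<^sub>C complex)" where
  "lift_operator \<kappa> T g = unweighted \<kappa> (T (weighted \<kappa> g))"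

lemma
  assumes "decay_operator \<kappa> T"
  shows weighted_lift: "weighted \<kappa> (lift_operator \<kappa> T g) = T (weighted \<kappa> g)"
    and bounded_linear_lift: "bounded_linear (lift_operator \<kappa> T)"
proof -
  obtain k where k: "\<And>f M. decaying \<kappa> f M \<Longrightarrow> decaying \<kappa> (T f) (k * M)"
    using assms unfolding decay_operator_def by blast
  have lin: "T (\<lambda>x. weighted \<kappa> f x + weighted \<kappa> g x) = (\<lambda>x. T (weighted \<kappa> f) x + T (weighted \<kappa> g) x)"
    "T (\<lambda>x. r *\<^sub>R weighted \<kappa> f x) = (\<lambda>x. r *\<^sub>R T (weighted \<kappa> f) x)" for f g r
    using assms decaying_weighted unfolding decay_operator_def by blast+
  show w: "weighted \<kappa> (lift_operator \<kappa> T g) = T (weighted \<kappa> g)" for g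
    unfolding lift_operator_def by (rule weighted_unweighted[OF k[OF decaying_weighted]])
  show "bounded_linear (lift_operator \<kappa> T)"
  proof
    show "lift_operator \<kappa> T (f + g) = lift_operator \<kappa> T f + lift_operator \<kappa> T g" for f g
      by (rule weighted_inject[of \<kappa>]) (simp add: weighted_linear w lin)
    show "lift_operator \<kappa> T (r *\<^sub>R f) = r *\<^sub>R lift_operator \<kappa> T f" for r f
      by (rule weighted_inject[of \<kappa>]) (simp add: weighted_linear w lin)
    show "\<exists>K. \<forall>f. norm (lift_operator \<kappa> T f) \<le> norm f * K"
      unfolding lift_operator_def using norm_unweighted[OF k[OF decaying_weighted]]
      by (metis mult.commute)
  qed
qed

context dirac_kernel
begin

definition mass :: real where "mass = pairing \<psi>"

lemma decaying_psi: "decaying \<kappa> \<psi> C"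
  using psi_cont psi_upper_kappa by (auto simp: decaying_def)

lemma mass_pos: "mass > 0"
proof -
  have eq: "Re (\<psi> x * cnj (\<psi> x)) = (norm (\<psi> x))\<^sup>2" for x 
    by (simp only: cmod_power2) (simp add: power2_eq_square)
  show ?thesis
    unfolding mass_def real_pairing_def
    by (rule integral_pos[OF pair_integrable[OF decaying_psi]]) (simp only: eq, simp)
qed

text \<open>Removal of the component along \<open>\<psi>\<close>, which produces the zero mean
  required by \<open>green_bound\<close>.\<close>

definition corrected :: "(real \<Rightarrow> complex) \<Rightarrow> real \<Rightarrow> complex" where
  "corrected f x = f x + (- pairing f / mass) *\<^sub>R \<psi> x"

lemma pairing_bound:
  assumes "decaying \<kappa> f M"
  shows "\<bar>pairing f\<bar> \<le> C * (LINT x|lborel. exp (- (\<kappa> + \<mu>) * \<bar>x\<bar>)) * M"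
proof -
  have "\<bar>pairing f\<bar> \<le> (LINT x|lborel. \<bar>Re (f x * cnj (\<psi> x))\<bar>)"
    unfolding real_pairing_def using integral_norm_bound[of lborel "\<lambda>x. Re (f x * cnj (\<psi> x))"] by simp
  also have "\<dots> \<le> (LINT x|lborel. M * C * exp (- (\<kappa> + \<mu>) * \<bar>x\<bar>))"
    using kappa pair_bound[OF assms]
    by (intro integral_mono integrable_abs pair_integrable[OF assms] integrable_mult_right integrable_exp_abs) auto
  finally show ?thesis by (simp add: mult_ac)
qed

lemma
  assumes "decaying \<kappa> f M"
  shows decaying_corrected: "decaying \<kappa> (corrected f)
      ((1 + C * (LINT x|lborel. exp (- (\<kappa> + \<mu>) * \<bar>x\<bar>)) / mass * C) * M)"
    and pairing_corrected: "pairing (corrected f) = 0"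
proof -
  have *: "decaying \<kappa> (corrected f) (M + \<bar>- pairing f / mass\<bar> * C)"
    unfolding corrected_def
    by (rule decaying_linear(1)[OF assms decaying_linear(2)[OF decaying_psi decaying_psi]])
  define I where "I = (LINT x|lborel. exp (- (\<kappa> + \<mu>) * \<bar>x\<bar>))"
  have "\<bar>- pairing f / mass\<bar> * C \<le> C * I * M / mass * C"
    using pairing_bound[OF assms] mass_pos C_pos unfolding I_def
    by (auto intro!: mult_right_mono divide_right_mono)
  moreover have "(1 + C * I / mass * C) * M = M + C * I * M / mass * C" by (simp add: algebra_simps)
  ultimately show "decaying \<kappa> (corrected f) ((1 + C * (LINT x|lborel. exp (- (\<kappa> + \<mu>) * \<bar>x\<bar>)) / mass * C) * M)"
    unfolding I_def[symmetric] by (intro decaying_mono[OF *]) linarith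
  have "pairing (corrected f) = pairing f + (- pairing f / mass) * mass"
    unfolding corrected_def mass_def
    by (subst pairing_linear(1)[OF assms decaying_linear(2)[OF decaying_psi decaying_psi]],
        subst pairing_linear(2)[OF decaying_psi decaying_psi], rule refl)
  then show "pairing (corrected f) = 0" using mass_pos by simp
qed

lemma corrected_linear:
  assumes "decaying \<kappa> f M" "decaying \<kappa> g M'"
  shows "corrected (\<lambda>x. f x + g x) = (\<lambda>x. corrected f x + corrected g x)"
    "corrected (\<lambda>x. r *\<^sub>R f x) = (\<lambda>x. r *\<^sub>R corrected f x)"
  unfolding corrected_def
  by (auto simp: pairing_linear[OF assms] algebra_simps add_divide_distrib diff_divide_distrib)

lemma green_corrected: "decay_operator \<kappa> (\<lambda>f. green (corrected f))"
  unfolding decay_operator_def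
proof (intro conjI allI impI exI)
  fix f g M M' r assume f: "decaying \<kappa> f M"
  show "decaying \<kappa> (green (corrected f))
     ((green_const * (1 + C * (LINT x|lborel. exp (- (\<kappa> + \<mu>) * \<bar>x\<bar>)) / mass * C)) * M)"
    unfolding decaying_def
  proof (intro conjI allI)
    show "continuous_on UNIV (green (corrected f))"
      using green_solves[OF decaying_corrected[OF f]] unfolding dirac_eq_def
      by (auto simp: continuous_on_eq_continuous_at intro: has_vector_derivative_continuous)
  qed (use green_bound[OF decaying_corrected[OF f] pairing_corrected[OF f]] in \<open>simp add: mult.assoc\<close>)
  show "green (corrected (\<lambda>x. r *\<^sub>R f x)) = (\<lambda>x. r *\<^sub>R green (corrected f) x)"
    using green_linear(2)[OF decaying_corrected[OF f] decaying_corrected[OF f]] corrected_linear[OF f f] by auto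
  assume g: "decaying \<kappa> g M'"
  show "green (corrected (\<lambda>x. f x + g x)) = (\<lambda>x. green (corrected f) x + green (corrected g) x)"
    using green_linear(1)[OF decaying_corrected[OF f] decaying_corrected[OF g]] corrected_linear[OF f g] by auto
qed

lemma bounded_linear_pairing: "bounded_linear (\<lambda>g. pairing (weighted \<kappa> g))"
proof
  show "pairing (weighted \<kappa> (f + g)) = pairing (weighted \<kappa> f) + pairing (weighted \<kappa> g)"
    "pairing (weighted \<kappa> (r *\<^sub>R f)) = r *\<^sub>R pairing (weighted \<kappa> f)" for f g r
    using pairing_linear[OF decaying_weighted decaying_weighted] by (simp_all add: weighted_linear)
  show "\<exists>K. \<forall>g. norm (pairing (weighted \<kappa> g)) \<le> norm g * K"
    using pairing_bound[OF decaying_weighted] by (metis mult.commute real_norm_def)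
qed

lemma green_corrected_solves:
  assumes "decaying \<kappa> f M"
  shows "dirac_eq \<alpha> \<beta> (green (corrected f)) (\<lambda>x. f x - (pairing f / mass) *\<^sub>R \<psi> x)"
  using green_solves[OF decaying_corrected[OF assms]] unfolding dirac_eq_def corrected_def
  by simp

end

text \<open>The class needed to apply \<open>bifurcation\<close> to pairs of weighted
  functions.\<close>

instance bcontfun :: (metric_space, banach) banach ..

lemma decay_operator_mult:
  fixes z :: complex
  shows "decay_operator \<kappa> (\<lambda>f x. z * f x)"
  unfolding decay_operator_def decaying_def
proof (intro conjI exI[of _ "norm z"] allI impI)
  fix f :: "real \<Rightarrow> complex" and M x :: real
  assume *: "continuous_on UNIV f \<and> (\<forall>x. norm (f x) \<le> M * exp (- \<kappa> * \<bar>x\<bar>))"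
  then show "continuous_on UNIV (\<lambda>x. z * f x)" by (intro continuous_intros) auto
  show "norm (z * f x) \<le> norm z * M * exp (- \<kappa> * \<bar>x\<bar>)"
    using * by (simp add: norm_mult mult_left_mono mult.assoc)
qed (auto simp: algebra_simps)

text \<open>The functions \<open>v\<close> and \<open>w\<close> are first-order responses to the
  eigenvalue term and to \<open>q\<close>. Both terms exchange the two equations, so the responses
  live in the opposite component and a second application returns to the original one. Hence the
  off-diagonal entries of the limit matrix vanish, \<open>B1\<close> and \<open>B2\<close> remove
  the part linear in \<open>t\<close>, and the diagonal entries are
  \<open>A1 * t\<^sup>2 + D1\<close> and \<open>A2 * t\<^sup>2 + D2\<close>.\<close>

lemma coupled_bifurcation:
  fixes s1 s2 \<zeta> :: real
  assumes k1: "dirac_kernel \<alpha>1 \<beta>1 \<psi>1 \<mu> \<kappa> c1 C1 b1" and k2: "dirac_kernel \<alpha>2 \<beta>2 \<psi>2 \<mu> \<kappa> c2 C2 b2"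
    and q: "decay_operator \<kappa> q"
    and v1: "dirac_eq \<alpha>2 \<beta>2 v1 (\<lambda>x. (\<i> * of_real s2) * \<psi>1 x)" "decaying \<kappa> v1 V1"
    and w1: "dirac_eq \<alpha>2 \<beta>2 w1 (q \<psi>1)" "decaying \<kappa> w1 W1"
    and v2: "dirac_eq \<alpha>1 \<beta>1 v2 (\<lambda>x. (\<i> * of_real s1) * \<psi>2 x)" "decaying \<kappa> v2 V2"
    and w2: "dirac_eq \<alpha>1 \<beta>1 w2 (q \<psi>2)" "decaying \<kappa> w2 W2"
    and A1: "real_pairing (\<lambda>x. (\<i> * of_real s1) * v1 x) \<psi>1 = A1"
    and B1: "real_pairing (\<lambda>x. (\<i> * of_real s1) * w1 x) \<psi>1 + real_pairing (q v1) \<psi>1 = 0"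
    and D1: "real_pairing (q w1) \<psi>1 + \<zeta> * real_pairing \<psi>1 \<psi>1 = D1"
    and A2: "real_pairing (\<lambda>x. (\<i> * of_real s2) * v2 x) \<psi>2 = A2"
    and B2: "real_pairing (\<lambda>x. (\<i> * of_real s2) * w2 x) \<psi>2 + real_pairing (q v2) \<psi>2 = 0"
    and D2: "real_pairing (q w2) \<psi>2 + \<zeta> * real_pairing \<psi>2 \<psi>2 = D2"
    and signs: "A1 * D1 < 0" "A2 * D2 \<ge> 0" "D2 \<noteq> 0"
  shows "\<exists>\<epsilon>0>0. \<exists>C. \<forall>\<epsilon>. 0 < \<epsilon> \<and> \<epsilon> < \<epsilon>0 \<longrightarrow> (\<exists>t>0. \<exists>a b.
      dirac_eq \<alpha>1 \<beta>1 a (\<lambda>x. \<epsilon> *\<^sub>R (t *\<^sub>R ((\<i> * of_real s1) * b x) + q b x + \<epsilon> *\<^sub>R (\<zeta> *\<^sub>R a x))) \<and>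
      dirac_eq \<alpha>2 \<beta>2 b (\<lambda>x. \<epsilon> *\<^sub>R (t *\<^sub>R ((\<i> * of_real s2) * a x) + q a x + \<epsilon> *\<^sub>R (\<zeta> *\<^sub>R b x))) \<and>
      decaying \<kappa> (\<lambda>x. a x - \<psi>1 x) (C * \<epsilon>) \<and> decaying \<kappa> b (C * \<epsilon>))"
proof -
  interpret k1: dirac_kernel \<alpha>1 \<beta>1 \<psi>1 \<mu> \<kappa> c1 C1 b1 by fact
  interpret k2: dirac_kernel \<alpha>2 \<beta>2 \<psi>2 \<mu> \<kappa> c2 C2 b2 by fact
  define S1 where "S1 = lift_operator \<kappa> (\<lambda>f x. (\<i> * of_real s1) * f x)"
  define S2 where "S2 = lift_operator \<kappa> (\<lambda>f x. (\<i> * of_real s2) * f x)"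
  define q' where "q' = lift_operator \<kappa> q"
  define K1 where "K1 = lift_operator \<kappa> (\<lambda>f. k1.green (k1.corrected f))"
  define K2 where "K2 = lift_operator \<kappa> (\<lambda>f. k2.green (k2.corrected f))"
  define l1 where "l1 g = k1.pairing (weighted \<kappa> g)" for g
  define l2 where "l2 g = k2.pairing (weighted \<kappa> g)" for g
  let ?W = "weighted \<kappa>" and ?U = "unweighted \<kappa>"
  note decs = k1.decaying_psi k2.decaying_psi v1(2) w1(2) v2(2) w2(2)
  note WU = decs[THEN weighted_unweighted]
  have W: "?W (S1 g) = (\<lambda>x. (\<i> * of_real s1) * ?W g x)" "?W (S2 g) = (\<lambda>x. (\<i> * of_real s2) * ?W g x)"
    "?W (q' g) = q (?W g)" "?W (K1 g) = k1.green (k1.corrected (?W g))"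
    "?W (K2 g) = k2.green (k2.corrected (?W g))" for g
    unfolding S1_def S2_def q'_def K1_def K2_def
    by (rule weighted_lift decay_operator_mult q k1.green_corrected k2.green_corrected)+
  have bl: "bounded_linear S1" "bounded_linear S2" "bounded_linear q'" "bounded_linear K1" "bounded_linear K2"
    "bounded_linear l1" "bounded_linear l2"
    unfolding S1_def S2_def q'_def K1_def K2_def l1_def l2_def
    by (rule bounded_linear_lift decay_operator_mult q k1.green_corrected k2.green_corrected
       k1.bounded_linear_pairing k2.bounded_linear_pairing)+
  interpret S1: bounded_linear S1 by fact
  interpret S2: bounded_linear S2 by fact
  interpret q': bounded_linear q' by fact
  interpret l1: bounded_linear l1 by fact
  interpret l2: bounded_linear l2 by fact
  define L where "L p f \<longleftrightarrow> dirac_eq \<alpha>1 \<beta>1 (?W (fst p)) (?W (fst f)) \<and> dirac_eq \<alpha>2 \<beta>2 (?W (snd p)) (?W (snd f))"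
    for p f :: "(real \<Rightarrow>\<^sub>C complex) \<times> (real \<Rightarrow>\<^sub>C complex)"
  have zero: "dirac_eq \<alpha> \<beta> (\<lambda>x. 0) (\<lambda>x. 0)" for \<alpha> \<beta> by (auto simp: dirac_eq_def)
  note fs = bounded_linear_fst bounded_linear_snd
  have "\<exists>\<epsilon>0>0. \<exists>C. \<forall>\<epsilon>. 0 < \<epsilon> \<and> \<epsilon> < \<epsilon>0 \<longrightarrow> (\<exists>t>0. \<exists>y. norm (y - (?U \<psi>1, 0)) \<le> C * \<epsilon> \<and>
     L y (\<epsilon> *\<^sub>R (t *\<^sub>R (S1 (snd y), S2 (fst y)) + (q' (snd y), q' (fst y)) + \<epsilon> *\<^sub>R (\<zeta> *\<^sub>R y))))"
  \<comment> \<open>\<open>L\<close> acts componentwise while \<open>S\<close> and \<open>Q\<close>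
    swap the components; \<open>e1\<close> and \<open>e2\<close> are the kernel functions divided by
    their masses, since that is the defect left by \<open>corrected\<close>.\<close>
  proof (rule bifurcation[where S = "\<lambda>p. (S1 (snd p), S2 (fst p))" and Q = "\<lambda>p. (q' (snd p), q' (fst p))"
        and Z = "\<lambda>p. \<zeta> *\<^sub>R p" and K = "\<lambda>p. (K1 (fst p), K2 (snd p))"
        and ?l1.0 = "\<lambda>p. l1 (fst p)" and ?l2.0 = "\<lambda>p. l2 (snd p)"
        and ?e1.0 = "((1 / k1.mass) *\<^sub>R ?U \<psi>1, 0)" and ?e2.0 = "(0, (1 / k2.mass) *\<^sub>R ?U \<psi>2)"
        and ?n2.0 = "(0, ?U \<psi>2)" and ?vS1.0 = "(0, ?U v1)" and ?vQ1.0 = "(0, ?U w1)"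
        and ?vS2.0 = "(?U v2, 0)" and ?vQ2.0 = "(?U w2, 0)"
        and ?A1.0 = A1 and ?C1.0 = D1 and ?A2.0 = A2 and ?C2.0 = D2])
    show "L (a + b) (f + g)" if "L a f" "L b g" for a b f g
      using that by (auto simp: L_def weighted_linear intro: dirac_eq_add)
    show "L (r *\<^sub>R a) (r *\<^sub>R f)" if "L a f" for r a f
      using that by (auto simp: L_def weighted_linear intro: dirac_eq_scale)
    show "bounded_linear (\<lambda>p. (S1 (snd p), S2 (fst p)))" "bounded_linear (\<lambda>p. (q' (snd p), q' (fst p)))"
      "bounded_linear (\<lambda>p :: (real \<Rightarrow>\<^sub>C complex) \<times> (real \<Rightarrow>\<^sub>C complex). \<zeta> *\<^sub>R p)"
      "bounded_linear (\<lambda>p. (K1 (fst p), K2 (snd p)))" "bounded_linear (\<lambda>p. l1 (fst p))" "bounded_linear (\<lambda>p. l2 (snd p))"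
      by (intro bounded_linear_Pair bounded_linear_scaleR_right bl[THEN bounded_linear_compose] fs)+
    show "L (K1 (fst f), K2 (snd f)) (f - l1 (fst f) *\<^sub>R ((1 / k1.mass) *\<^sub>R ?U \<psi>1, 0) - l2 (snd f) *\<^sub>R (0, (1 / k2.mass) *\<^sub>R ?U \<psi>2))" for f
      unfolding L_def
      using k1.green_corrected_solves[OF decaying_weighted, of "fst f"]
        k2.green_corrected_solves[OF decaying_weighted, of "snd f"]
      by (simp add: W weighted_linear WU l1_def l2_def)
    show "L (?U \<psi>1, 0) 0" "L (0, ?U \<psi>2) 0"
      using k1.kernel k2.kernel by (simp_all add: L_def weighted_linear WU zero)
    show "L (0, ?U v1) (S1 (snd (?U \<psi>1, 0)), S2 (fst (?U \<psi>1, 0)))"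
      "L (0, ?U w1) (q' (snd (?U \<psi>1, 0)), q' (fst (?U \<psi>1, 0)))"
      "L (?U v2, 0) (S1 (snd (0, ?U \<psi>2)), S2 (fst (0, ?U \<psi>2)))"
      "L (?U w2, 0) (q' (snd (0, ?U \<psi>2)), q' (fst (0, ?U \<psi>2)))"
      using v1(1) w1(1) v2(1) w2(1)
      by (simp_all add: L_def weighted_linear WU W zero S1.zero S2.zero q'.zero)
    note lin = S1.add S2.add q'.add l1.add l2.add S1.scaleR S2.scaleR q'.scaleR l1.scaleR l2.scaleR
      S1.zero S2.zero q'.zero l1.zero l2.zero
    have l: "l1 (S1 (?U v1)) = A1" "l1 (S1 (?U w1)) = - l1 (q' (?U v1))" "l1 (q' (?U w1)) + \<zeta> * l1 (?U \<psi>1) = D1"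
      "l2 (S2 (?U v2)) = A2" "l2 (S2 (?U w2)) = - l2 (q' (?U v2))" "l2 (q' (?U w2)) + \<zeta> * l2 (?U \<psi>2) = D2"
      using A1 B1 D1 A2 B2 D2 by (simp_all add: l1_def l2_def W WU)
    fix t :: real
    show "l1 (fst (t *\<^sub>R (S1 (snd (t *\<^sub>R (0, ?U v1) + (0, ?U w1))), S2 (fst (t *\<^sub>R (0, ?U v1) + (0, ?U w1)))) +
         (q' (snd (t *\<^sub>R (0, ?U v1) + (0, ?U w1))), q' (fst (t *\<^sub>R (0, ?U v1) + (0, ?U w1)))) + \<zeta> *\<^sub>R (?U \<psi>1, 0))) = A1 * t\<^sup>2 + D1"
      "l2 (snd (t *\<^sub>R (S1 (snd (t *\<^sub>R (?U v2, 0) + (?U w2, 0))), S2 (fst (t *\<^sub>R (?U v2, 0) + (?U w2, 0)))) +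
         (q' (snd (t *\<^sub>R (?U v2, 0) + (?U w2, 0))), q' (fst (t *\<^sub>R (?U v2, 0) + (?U w2, 0)))) + \<zeta> *\<^sub>R (0, ?U \<psi>2))) = A2 * t\<^sup>2 + D2"
      using l by (simp_all add: lin power2_eq_square algebra_simps)
    show "l2 (snd (t *\<^sub>R (S1 (snd (t *\<^sub>R (0, ?U v1) + (0, ?U w1))), S2 (fst (t *\<^sub>R (0, ?U v1) + (0, ?U w1)))) +
         (q' (snd (t *\<^sub>R (0, ?U v1) + (0, ?U w1))), q' (fst (t *\<^sub>R (0, ?U v1) + (0, ?U w1)))) + \<zeta> *\<^sub>R (?U \<psi>1, 0))) = 0"
      "l1 (fst (t *\<^sub>R (S1 (snd (t *\<^sub>R (?U v2, 0) + (?U w2, 0))), S2 (fst (t *\<^sub>R (?U v2, 0) + (?U w2, 0)))) +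
         (q' (snd (t *\<^sub>R (?U v2, 0) + (?U w2, 0))), q' (fst (t *\<^sub>R (?U v2, 0) + (?U w2, 0)))) + \<zeta> *\<^sub>R (0, ?U \<psi>2))) = 0"
      by (simp_all add: lin)
  qed (use signs in auto)
  then obtain \<epsilon>0 C where \<epsilon>0: "\<epsilon>0 > 0" and main: "\<And>\<epsilon>. 0 < \<epsilon> \<Longrightarrow> \<epsilon> < \<epsilon>0 \<Longrightarrow> \<exists>t>0. \<exists>y. norm (y - (?U \<psi>1, 0)) \<le> C * \<epsilon> \<and>
     L y (\<epsilon> *\<^sub>R (t *\<^sub>R (S1 (snd y), S2 (fst y)) + (q' (snd y), q' (fst y)) + \<epsilon> *\<^sub>R (\<zeta> *\<^sub>R y)))"
    by blast
  show ?thesis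
  proof (rule exI[of _ \<epsilon>0], rule conjI[OF \<epsilon>0], rule exI[of _ C], intro allI impI, elim conjE)
    fix \<epsilon> assume "0 < \<epsilon>" "\<epsilon> < \<epsilon>0"
    from main[OF this] obtain t a b where t: "t > 0" and n: "norm ((a, b) - (?U \<psi>1, 0)) \<le> C * \<epsilon>" and
     L: "L (a, b) (\<epsilon> *\<^sub>R (t *\<^sub>R (S1 b, S2 a) + (q' b, q' a) + \<epsilon> *\<^sub>R (\<zeta> *\<^sub>R (a, b))))"
      by fastforce
    have na: "norm (a - ?U \<psi>1) \<le> C * \<epsilon>" and nb: "norm b \<le> C * \<epsilon>"
      using n norm_fst_le[of "a - ?U \<psi>1" b] norm_snd_le[of b "a - ?U \<psi>1"] by auto
    show "\<exists>t>0. \<exists>a b.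
      dirac_eq \<alpha>1 \<beta>1 a (\<lambda>x. \<epsilon> *\<^sub>R (t *\<^sub>R ((\<i> * of_real s1) * b x) + q b x + \<epsilon> *\<^sub>R (\<zeta> *\<^sub>R a x))) \<and>
      dirac_eq \<alpha>2 \<beta>2 b (\<lambda>x. \<epsilon> *\<^sub>R (t *\<^sub>R ((\<i> * of_real s2) * a x) + q a x + \<epsilon> *\<^sub>R (\<zeta> *\<^sub>R b x))) \<and>
      decaying \<kappa> (\<lambda>x. a x - \<psi>1 x) (C * \<epsilon>) \<and> decaying \<kappa> b (C * \<epsilon>)"
    proof (rule exI[of _ t], rule conjI[OF t], rule exI[of _ "?W a"], rule exI[of _ "?W b"], intro conjI)
    qed (use L decaying_mono[OF decaying_weighted na, of \<kappa>] decaying_mono[OF decaying_weighted nb, of \<kappa>]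
        in \<open>simp_all add: L_def weighted_linear W WU\<close>)
  qed
qed

section \<open>Soliton profiles and bifurcation coefficients\<close>

lemma integral_derivative:
  fixes F :: "real \<Rightarrow> real"
  assumes F: "\<And>x. (F has_real_derivative f x) (at x)" and f: "continuous_on UNIV f" "integrable lborel f"
    and lim: "(F \<longlongrightarrow> A) at_bot" "(F \<longlongrightarrow> B) at_top"
  shows "(LINT x|lborel. f x) = B - A"
proof -
  have "(LBINT x=-\<infinity>..\<infinity>. f x) = B - A"
    using f lim F
    by (intro interval_integral_FTC_integrable)
       (auto simp: ereal_tendsto_simps set_integrable_def continuous_on_eq_continuous_at
          has_real_derivative_iff_has_vector_derivative)
  then show ?thesis
    by (simp add: interval_lebesgue_integral_def set_lebesgue_integral_def)
qed

lemma exp_decay_tendsto: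
  fixes F :: "real \<Rightarrow> real"
  assumes "m > 0" "\<And>x. \<bar>F x\<bar> \<le> M * exp (- m * \<bar>x\<bar>)"
  shows "(F \<longlongrightarrow> 0) at_bot" "(F \<longlongrightarrow> 0) at_top"
proof -
  have top: "((\<lambda>x. M * exp (- m * \<bar>x\<bar>)) \<longlongrightarrow> 0) at_top"
  proof -
    have "((\<lambda>x::real. exp (- m * x)) \<longlongrightarrow> 0) at_top"
      using filterlim_tendsto_pos_mult_at_top[OF tendsto_const assms(1) filterlim_ident]
      by (intro filterlim_compose[OF exp_at_bot]) (simp add: filterlim_uminus_at_bot)
    then have "((\<lambda>x::real. M * exp (- m * x)) \<longlongrightarrow> 0) at_top" by (rule tendsto_mult_right_zero)
    then show ?thesis
      by (rule Lim_transform_eventually) (rule eventually_mono[OF eventually_ge_at_top[of "0::real"]], simp)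
  qed
  have bot: "((\<lambda>x. M * exp (- m * \<bar>x\<bar>)) \<longlongrightarrow> 0) at_bot"
    using filterlim_compose[OF top filterlim_uminus_at_top_at_bot] by simp
  show "(F \<longlongrightarrow> 0) at_bot" by (rule Lim_null_comparison[OF _ bot]) (use assms(2) in simp)
  show "(F \<longlongrightarrow> 0) at_top" by (rule Lim_null_comparison[OF _ top]) (use assms(2) in simp)
qed

lemma integral_odd:
  fixes f :: "real \<Rightarrow> real"
  assumes "\<And>x. f (- x) = - f x"
  shows "(LINT x|lborel. f x) = 0"
proof -
  have "(LINT x|lborel. f x) = (LINT x|lborel. f (- x))"
    using lborel_integral_real_affine[of "-1" f 0] by simp
  also have "\<dots> = - (LINT x|lborel. f x)" by (simp add: assms)
  finally show ?thesis by simp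
qed

lemma abs_mult_exp_bound:
  fixes x :: real
  assumes "m > 0"
  shows "\<bar>x\<bar> * exp (- m * \<bar>x\<bar>) \<le> 1 / m"
proof -
  have "m * \<bar>x\<bar> \<le> exp (m * \<bar>x\<bar>)" using exp_ge_add_one_self[of "m * \<bar>x\<bar>"] by linarith
  then have "m * (\<bar>x\<bar> * exp (- m * \<bar>x\<bar>)) \<le> 1" by (simp add: exp_minus field_simps)
  then show ?thesis using assms by (simp add: field_simps)
qed

text \<open>\<open>g\<close> is 0 for Thirring and 1 for Gross--Neveu, so that one profile equation
  covers both. That equation is Hamiltonian and \<open>first_integral\<close> is its zero energy
  level. \<open>nondegenerate\<close> keeps the derivative comparable with \<open>U\<close>, which
  lets it serve as \<open>\<psi>\<close> in \<open>dirac_kernel\<close>.\<close>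

locale soliton_profile =
  fixes U :: "real \<Rightarrow> complex" and \<omega> \<mu> g c C k :: real
  assumes mu: "0 < \<mu>" and g: "0 \<le> g" "g \<le> 1"
    and U_deriv: "\<And>x. (U has_vector_derivative
        - \<i> * (\<omega> * U x - cnj (U x) + U x * cnj (U x) * U x + g * cnj (U x) ^ 3)) (at x)"
    and U_sym: "\<And>x. U (- x) = cnj (U x)"
    and first_integral: "\<And>x. 2 * \<omega> * (norm (U x))\<^sup>2 + (norm (U x)) ^ 4 + g * Re (U x ^ 4) = 2 * Re ((U x)\<^sup>2)"
    and c: "0 < c" and lower: "\<And>x. c * exp (- \<mu> * \<bar>x\<bar>) \<le> norm (U x)"
    and upper: "\<And>x. norm (U x) \<le> C * exp (- \<mu> * \<bar>x\<bar>)"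
    and k: "0 < k" and nondegenerate: "\<And>x. k * norm (U x) \<le>
        norm (\<omega> * U x - cnj (U x) + U x * cnj (U x) * U x + g * cnj (U x) ^ 3)"
begin

definition dU :: "real \<Rightarrow> complex" where
  "dU x = - \<i> * (\<omega> * U x - cnj (U x) + U x * cnj (U x) * U x + g * cnj (U x) ^ 3)"

text \<open>The suffix \<open>p\<close> stands for sums of components, where the coefficients are
  the linearization of the profile equation, and \<open>m\<close> for differences.\<close>

definition \<alpha>p :: "real \<Rightarrow> real" where "\<alpha>p x = \<omega> + 2 * (norm (U x))\<^sup>2"
definition \<beta>p :: "real \<Rightarrow> complex" where "\<beta>p x = -1 + (U x)\<^sup>2 + 3 * g * (cnj (U x))\<^sup>2"
definition \<alpha>m :: "real \<Rightarrow> real" where "\<alpha>m x = \<omega>"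
definition \<beta>m :: "real \<Rightarrow> complex" where "\<beta>m x = 1 - (U x)\<^sup>2 - g * (cnj (U x))\<^sup>2"

text \<open>Half of the decay rate of the soliton leaves room for a factor \<open>x\<close>: both
  \<open>boost\<close> and the functions used for \<open>dw\<close> contain one.\<close>

abbreviation \<kappa> :: real where "\<kappa> \<equiv> \<mu> / 2"

lemma U_deriv' [derivative_intros]: "(U has_vector_derivative dU x) (at x)"
  unfolding dU_def by (rule U_deriv)

lemma U_cont [continuous_intros]: "continuous_on A U"
  by (rule continuous_on_subset[of UNIV])
     (auto simp: continuous_on_eq_continuous_at intro: has_vector_derivative_continuous U_deriv)

lemma dU_cont [continuous_intros]: "continuous_on A dU"
  unfolding dU_def by (intro continuous_intros)

lemma dU_sym: "dU (- x) = - cnj (dU x)"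
  by (simp add: dU_def U_sym algebra_simps)

lemma dU_deriv [derivative_intros]:
  "(dU has_vector_derivative - \<i> * (\<omega> * dU x - cnj (dU x) + (2 * U x * cnj (U x) * dU x + (U x)\<^sup>2 * cnj (dU x))
     + 3 * g * (cnj (U x))\<^sup>2 * cnj (dU x))) (at x)"
proof -
  have dU_fun: "(\<lambda>x. - \<i> * (\<omega> * U x - cnj (U x) + U x * cnj (U x) * U x + g * cnj (U x) ^ 3)) = dU"
    by (rule ext) (rule dU_def[symmetric])
  have "((\<lambda>x. - \<i> * (\<omega> * U x - cnj (U x) + U x * cnj (U x) * U x + g * cnj (U x) ^ 3)) has_vector_derivative
     - \<i> * (\<omega> * dU x - cnj (dU x) + (2 * U x * cnj (U x) * dU x + (U x)\<^sup>2 * cnj (dU x))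
     + 3 * g * (cnj (U x))\<^sup>2 * cnj (dU x))) (at x)"
    unfolding power3_eq_cube
    by (auto intro!: derivative_eq_intros simp: power2_eq_square algebra_simps)
  then show ?thesis unfolding dU_fun .
qed

lemma norm_sq: "(complex_of_real (norm z))\<^sup>2 = z * cnj z"
  using complex_norm_square[of z] by simp

text \<open>Translation invariance: this is the derivative of the profile equation.\<close>

lemma kernel_p: "dirac_eq \<alpha>p \<beta>p dU (\<lambda>_. 0)"
  unfolding dirac_eq_def \<alpha>p_def \<beta>p_def
  by (intro allI has_vector_derivative_eq_rhs[OF dU_deriv])
     (simp add: norm_sq algebra_simps)

text \<open>Gauge invariance: this is the profile equation multiplied by \<open>\<i>\<close>; the
  sign in \<open>cnj (\<i> * U x) = - \<i> * cnj (U x)\<close> accounts for the opposite signs in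
  \<open>\<beta>m\<close>.\<close>

lemma kernel_m: "dirac_eq \<alpha>m \<beta>m (\<lambda>x. \<i> * U x) (\<lambda>_. 0)"
  unfolding dirac_eq_def \<alpha>m_def \<beta>m_def
  by (auto intro!: derivative_eq_intros simp: dU_def algebra_simps power2_eq_square power3_eq_cube)

text \<open>The infinitesimal Lorentz boost of the standing wave at time zero; it is the generalized
  kernel function attached to \<open>dU\<close>.\<close>

definition boost :: "real \<Rightarrow> complex" where "boost x = - U x / 2 + \<i> * \<omega> * x * U x"

lemma boost_eq: "dirac_eq \<alpha>m \<beta>m boost (\<lambda>x. \<i> * dU x)"
  unfolding dirac_eq_def \<alpha>m_def \<beta>m_def boost_def[abs_def]
  by (auto intro!: derivative_eq_intros has_vector_derivative_of_real simp: dU_def field_simps power2_eq_square power3_eq_cube)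

lemma boost_sym: "boost (- x) = cnj (boost x)"
  by (simp add: boost_def U_sym)

lemma C_pos: "C > 0" using lower[of 0] upper[of 0] c by simp

lemma U_bound: "norm (U x) \<le> C"
proof -
  have "C * exp (- \<mu> * \<bar>x\<bar>) \<le> C * 1" using C_pos mu by (intro mult_left_mono) auto
  then show ?thesis using upper[of x] by simp
qed

lemma U_kappa: "norm (U x) \<le> C * exp (- \<kappa> * \<bar>x\<bar>)"
proof -
  have "exp (- \<mu> * \<bar>x\<bar>) \<le> exp (- \<kappa> * \<bar>x\<bar>)" using mu by simp
  then show ?thesis using upper[of x] C_pos by (meson less_imp_le mult_left_mono order_trans)
qed

lemma decaying_U: "decaying \<kappa> U C"
  using U_kappa by (auto simp: decaying_def intro!: continuous_intros)

lemma xU_bound: "norm (of_real x * U x) \<le> C / \<kappa> * exp (- \<kappa> * \<bar>x\<bar>)"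
proof -
  have "norm (of_real x * U x) = \<bar>x\<bar> * norm (U x)" by (simp add: norm_mult)
  also have "\<dots> \<le> \<bar>x\<bar> * (C * exp (- \<mu> * \<bar>x\<bar>))" by (intro mult_left_mono upper) auto
  also have "exp (- \<mu> * \<bar>x\<bar>) = exp (- \<kappa> * \<bar>x\<bar>) * exp (- \<kappa> * \<bar>x\<bar>)" by (simp flip: exp_add)
  also have "\<bar>x\<bar> * (C * (exp (- \<kappa> * \<bar>x\<bar>) * exp (- \<kappa> * \<bar>x\<bar>))) = C * exp (- \<kappa> * \<bar>x\<bar>) * (\<bar>x\<bar> * exp (- \<kappa> * \<bar>x\<bar>))" by simp
  also have "\<dots> \<le> C * exp (- \<kappa> * \<bar>x\<bar>) * (1 / \<kappa>)"
    using C_pos mu by (intro mult_left_mono abs_mult_exp_bound) auto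
  finally show ?thesis by (simp add: mult_ac)
qed

definition B :: real where "B = \<bar>\<omega>\<bar> + 1 + 2 * C\<^sup>2"

lemma dU_norm: "norm (dU x) \<le> B * norm (U x)"
proof -
  have "norm (dU x) \<le> norm (\<omega> * U x) + norm (cnj (U x)) + norm (U x * cnj (U x) * U x) + norm (g * cnj (U x) ^ 3)"
  proof -
    have "norm (dU x) = norm (\<omega> * U x - cnj (U x) + U x * cnj (U x) * U x + g * cnj (U x) ^ 3)"
      unfolding dU_def norm_mult by simp
    also have "\<dots> \<le> norm (\<omega> * U x) + norm (cnj (U x)) + norm (U x * cnj (U x) * U x) + norm (g * cnj (U x) ^ 3)"
      by (intro norm_triangle_le add_mono order_refl norm_triangle_ineq4)
    finally show ?thesis .
  qed
  also have "\<dots> = (\<bar>\<omega>\<bar> + 1 + (1 + g) * (norm (U x))\<^sup>2) * norm (U x)"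
    using g by (simp add: norm_mult norm_power algebra_simps power2_eq_square power3_eq_cube)
  also have "\<dots> \<le> B * norm (U x)"
    unfolding B_def using g by (intro mult_right_mono add_mono mult_mono power_mono U_bound order_refl) auto
  finally show ?thesis .
qed

lemma B_pos: "B > 0" unfolding B_def by (simp add: add_nonneg_pos add_pos_nonneg)

lemma decaying_scaled:
  assumes "continuous_on UNIV f" "\<And>x. norm (f x) \<le> K * norm (U x)"
  shows "decaying \<kappa> f (\<bar>K\<bar> * C)"
  unfolding decaying_def
proof (intro conjI allI assms(1))
  fix x
  have "norm (f x) \<le> \<bar>K\<bar> * norm (U x)" using assms(2)[of x] by (meson abs_ge_self mult_right_mono norm_ge_zero order_trans)
  also have "\<dots> \<le> \<bar>K\<bar> * (C * exp (- \<kappa> * \<bar>x\<bar>))" by (intro mult_left_mono U_kappa) auto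
  finally show "norm (f x) \<le> \<bar>K\<bar> * C * exp (- \<kappa> * \<bar>x\<bar>)" by simp
qed

lemma decaying_dU: "decaying \<kappa> dU (\<bar>B\<bar> * C)"
  by (intro decaying_scaled dU_norm continuous_intros)

lemma decaying_boost: "\<exists>M. decaying \<kappa> boost M"
proof -
  have "decaying \<kappa> boost (C / 2 + \<bar>\<omega>\<bar> * (C / \<kappa>))"
    unfolding decaying_def
  proof (intro conjI allI)
    show "continuous_on UNIV boost" unfolding boost_def by (auto intro!: continuous_intros)
    fix x
    have "norm (boost x) \<le> norm (- U x / 2) + norm (\<i> * \<omega> * (x * U x))"
      unfolding boost_def using norm_triangle_ineq[of "- U x / 2" "\<i> * \<omega> * (x * U x)"] by (simp add: mult.assoc)
    also have "norm (\<i> * \<omega> * (x * U x)) = \<bar>\<omega>\<bar> * norm (x * U x)" by (simp add: norm_mult)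
    also have "norm (- U x / 2) + \<bar>\<omega>\<bar> * norm (x * U x) \<le> C / 2 * exp (- \<kappa> * \<bar>x\<bar>) + \<bar>\<omega>\<bar> * (C / \<kappa> * exp (- \<kappa> * \<bar>x\<bar>))"
      using U_kappa[of x] by (intro add_mono mult_left_mono xU_bound) (auto simp: norm_divide)
    finally show "norm (boost x) \<le> (C / 2 + \<bar>\<omega>\<bar> * (C / \<kappa>)) * exp (- \<kappa> * \<bar>x\<bar>)" by (simp add: algebra_simps)
  qed
  then show ?thesis by blast
qed

lemma beta_bound: "norm (\<beta>p x) \<le> 1 + 4 * C\<^sup>2" "norm (\<beta>m x) \<le> 1 + 4 * C\<^sup>2"
proof -
  have s: "norm ((U x)\<^sup>2) \<le> C\<^sup>2" "norm (of_real g * (cnj (U x))\<^sup>2) \<le> 1 * C\<^sup>2" "norm (3 * of_real g * (cnj (U x))\<^sup>2) \<le> 3 * C\<^sup>2"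
    using g U_bound[of x] power_mono[OF U_bound[of x], of 2] mult_mono[of g 1 "(norm (U x))\<^sup>2" "C\<^sup>2"]
    by (auto simp: norm_mult norm_power)
  have "norm (\<beta>p x) \<le> 1 + norm ((U x)\<^sup>2) + norm (3 * of_real g * (cnj (U x))\<^sup>2)"
    unfolding \<beta>p_def by (intro norm_triangle_le add_mono) auto
  then show "norm (\<beta>p x) \<le> 1 + 4 * C\<^sup>2" using s by simp
  have "norm (\<beta>m x) \<le> 1 + norm ((U x)\<^sup>2) + norm (of_real g * (cnj (U x))\<^sup>2)"
    unfolding \<beta>m_def by (intro order_trans[OF norm_triangle_ineq4] add_mono) auto
  then show "norm (\<beta>m x) \<le> 1 + 4 * C\<^sup>2" using s zero_le_power2[of C] by linarith
qed

lemma dirac_kernels: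
  shows dirac_kernel_p: "dirac_kernel \<alpha>p \<beta>p dU \<mu> \<kappa> (k * c) (B * C) (1 + 4 * C\<^sup>2)"
    and dirac_kernel_m: "dirac_kernel \<alpha>m \<beta>m (\<lambda>x. \<i> * U x) \<mu> \<kappa> c C (1 + 4 * C\<^sup>2)"
proof -
  show "dirac_kernel \<alpha>p \<beta>p dU \<mu> \<kappa> (k * c) (B * C) (1 + 4 * C\<^sup>2)"
  proof
    show "continuous_on UNIV \<alpha>p" "continuous_on UNIV \<beta>p" unfolding \<alpha>p_def \<beta>p_def by (intro continuous_intros)+
    fix x
    have "k * c * exp (- \<mu> * \<bar>x\<bar>) \<le> k * norm (U x)" using lower[of x] k by simp
    also have "\<dots> \<le> norm (dU x)" using nondegenerate[of x] unfolding dU_def norm_mult norm_minus_cancel norm_ii by simp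
    finally show "k * c * exp (- \<mu> * \<bar>x\<bar>) \<le> norm (dU x)" .
    have "norm (dU x) \<le> B * norm (U x)" by (rule dU_norm)
    also have "\<dots> \<le> B * (C * exp (- \<mu> * \<bar>x\<bar>))" using B_pos by (intro mult_left_mono upper) auto
    finally show "norm (dU x) \<le> B * C * exp (- \<mu> * \<bar>x\<bar>)" by simp
  qed (use mu k c kernel_p beta_bound in auto)
  show "dirac_kernel \<alpha>m \<beta>m (\<lambda>x. \<i> * U x) \<mu> \<kappa> c C (1 + 4 * C\<^sup>2)"
    by standard (use mu c kernel_m beta_bound lower upper
      in \<open>auto simp: \<alpha>m_def[abs_def] \<beta>m_def[abs_def] norm_mult intro!: continuous_intros\<close>)
qed

sublocale p: dirac_kernel \<alpha>p \<beta>p dU \<mu> \<kappa> "k * c" "B * C" "1 + 4 * C\<^sup>2" by (rule dirac_kernel_p)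
sublocale m: dirac_kernel \<alpha>m \<beta>m "\<lambda>x. \<i> * U x" \<mu> \<kappa> c C "1 + 4 * C\<^sup>2" by (rule dirac_kernel_m)

lemma integrable_scaled:
  fixes f :: "real \<Rightarrow> real"
  assumes "continuous_on UNIV f" "\<And>x. \<bar>f x\<bar> \<le> K * norm (U x)"
  shows "integrable lborel f"
proof (rule integrable_exp_bound[OF assms(1), of \<kappa> "\<bar>K\<bar> * C"])
  fix x
  have "\<bar>f x\<bar> \<le> \<bar>K\<bar> * norm (U x)" using assms(2)[of x] by (meson abs_ge_self mult_right_mono norm_ge_zero order_trans)
  also have "\<dots> \<le> \<bar>K\<bar> * (C * exp (- \<kappa> * \<bar>x\<bar>))" by (intro mult_left_mono U_kappa) auto
  finally show "norm (f x) \<le> \<bar>K\<bar> * C * exp (- \<kappa> * \<bar>x\<bar>)" by simp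
qed (use mu in auto)

lemma ReU2_integrable: "integrable lborel (\<lambda>x. Re ((U x)\<^sup>2))"
proof (rule integrable_scaled)
  show "\<bar>Re ((U x)\<^sup>2)\<bar> \<le> C * norm (U x)" for x
    using abs_Re_le_cmod[of "(U x)\<^sup>2"] mult_right_mono[OF U_bound[of x] norm_ge_zero[of "U x"]]
    by (simp add: norm_power power2_eq_square norm_mult)
qed (intro continuous_intros)

lemma norm2_deriv: "((\<lambda>x. (norm (U x))\<^sup>2) has_real_derivative 2 * Re (U x * cnj (dU x))) (at x)"
proof -
  have "((\<lambda>x. Re (U x * cnj (U x))) has_vector_derivative Re (U x * cnj (dU x) + dU x * cnj (U x))) (at x)"
    by (intro bounded_linear.has_vector_derivative[OF bounded_linear_Re] has_vector_derivative_mult derivative_intros)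
  moreover have "(\<lambda>x. Re (U x * cnj (U x))) = (\<lambda>x. (norm (U x))\<^sup>2)"
    by (simp only: cmod_power2) (simp add: power2_eq_square)
  ultimately show ?thesis
    by (simp add: has_real_derivative_iff_has_vector_derivative algebra_simps)
qed

text \<open>Exact derivatives of decaying functions do not contribute to the bifurcation coefficients.\<close>

lemma x_norm2_integral:
  shows "integrable lborel (\<lambda>x. (norm (U x))\<^sup>2 + x * (2 * Re (U x * cnj (dU x))))"
    and "(LINT x|lborel. (norm (U x))\<^sup>2 + x * (2 * Re (U x * cnj (dU x)))) = 0"
proof -
  have b: "\<bar>x * (2 * Re (U x * cnj (dU x)))\<bar> \<le> 2 * (C / \<kappa>) * B * norm (U x)" for x
  proof -
    have "\<bar>x * (2 * Re (U x * cnj (dU x)))\<bar> \<le> 2 * (\<bar>x\<bar> * (norm (U x) * norm (dU x)))"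
    proof -
      have "\<bar>x * (2 * r)\<bar> = 2 * (\<bar>x\<bar> * \<bar>r\<bar>)" for r by (simp add: abs_mult)
      moreover have "\<bar>Re (U x * cnj (dU x))\<bar> \<le> norm (U x) * norm (dU x)"
        using abs_Re_le_cmod[of "U x * cnj (dU x)"] by (simp only: norm_mult complex_mod_cnj)
      ultimately show ?thesis by (metis abs_ge_zero mult_left_mono zero_le_numeral)
    qed
    also have "\<dots> = 2 * (norm (x * U x) * norm (dU x))" by (simp add: norm_mult)
    also have "\<dots> \<le> 2 * ((C / \<kappa>) * (B * norm (U x)))"
    proof (intro mult_left_mono mult_mono dU_norm)
      have "C / \<kappa> * exp (- \<kappa> * \<bar>x\<bar>) \<le> C / \<kappa> * 1" using mu C_pos by (intro mult_left_mono) auto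
      then show "norm (x * U x) \<le> C / \<kappa>" using xU_bound[of x] by simp
    qed (use mu C_pos in auto)
    finally show ?thesis by simp
  qed
  have u2: "(norm (U x))\<^sup>2 \<le> C * norm (U x)" for x
    using mult_right_mono[OF U_bound[of x] norm_ge_zero[of "U x"]] by (simp add: power2_eq_square)
  have cont: "continuous_on UNIV (\<lambda>x. (norm (U x))\<^sup>2 + x * (2 * Re (U x * cnj (dU x))))"
    by (intro continuous_intros)
  show int: "integrable lborel (\<lambda>x. (norm (U x))\<^sup>2 + x * (2 * Re (U x * cnj (dU x))))"
  proof (rule integrable_scaled[OF cont])
    show "\<bar>(norm (U x))\<^sup>2 + x * (2 * Re (U x * cnj (dU x)))\<bar> \<le> (C + 2 * (C / \<kappa>) * B) * norm (U x)" for x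
      using u2[of x] b[of x] abs_triangle_ineq[of "(norm (U x))\<^sup>2" "x * (2 * Re (U x * cnj (dU x)))"]
      unfolding distrib_right by (simp only: abs_power2 abs_norm_cancel)
  qed
  have d: "((\<lambda>x. x * (norm (U x))\<^sup>2) has_real_derivative (norm (U x))\<^sup>2 + x * (2 * Re (U x * cnj (dU x)))) (at x)" for x
    by (rule derivative_eq_intros norm2_deriv refl | simp)+
  have lim: "\<bar>x * (norm (U x))\<^sup>2\<bar> \<le> (C / \<kappa> * C) * exp (- \<kappa> * \<bar>x\<bar>)" for x
  proof -
    have "\<bar>x * (norm (U x))\<^sup>2\<bar> = norm (x * U x) * norm (U x)" by (simp add: abs_mult norm_mult power2_eq_square)
    also have "\<dots> \<le> (C / \<kappa> * exp (- \<kappa> * \<bar>x\<bar>)) * C"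
      using mu C_pos by (intro mult_mono xU_bound U_bound) auto
    finally show ?thesis by (simp add: mult_ac)
  qed
  show "(LINT x|lborel. (norm (U x))\<^sup>2 + x * (2 * Re (U x * cnj (dU x)))) = 0"
    using integral_derivative[OF d cont int exp_decay_tendsto[OF _ lim]] mu by simp
qed

lemma current: "Re (\<i> * U x * cnj (dU x)) =
    Re ((U x)\<^sup>2) - \<omega> * (norm (U x))\<^sup>2 - (norm (U x)) ^ 4 - g * Re (U x ^ 4)"
proof -
  have "\<i> * U x * cnj (dU x) = - (\<omega> * (U x * cnj (U x)) - (U x)\<^sup>2 + (U x * cnj (U x))\<^sup>2 + g * U x ^ 4)"
    by (simp add: dU_def algebra_simps power2_eq_square power3_eq_cube power4_eq_xxxx)
  also have "U x * cnj (U x) = of_real ((norm (U x))\<^sup>2)" by (simp add: norm_sq)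
  finally show ?thesis by (simp flip: of_real_power of_real_mult)
qed

text \<open>By \<open>current\<close> and \<open>first_integral\<close>,
  \<open>Re (\<i> U cnj dU)\<close> equals \<open>\<omega> |U|^2 - Re (U^2)\<close>. Together with
  the term containing \<open>x\<close>, the part with \<omega> is the derivative of
  \<open>- \<omega> / 2 * x * |U|^2\<close> and integrates to zero.\<close>

lemma pairing_boost: "real_pairing (\<lambda>x. \<i> * boost x) dU = (LINT x|lborel. Re ((U x)\<^sup>2)) / 2"
proof -
  have "Re (\<i> * boost x * cnj (dU x)) = Re ((U x)\<^sup>2) / 2
     + (- \<omega> / 2) * ((norm (U x))\<^sup>2 + x * (2 * Re (U x * cnj (dU x))))" for x
  proof -
    have "\<i> * boost x * cnj (dU x) = (- 1 / 2) * (\<i> * U x * cnj (dU x)) - of_real (\<omega> * x) * (U x * cnj (dU x))"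
      by (simp add: boost_def algebra_simps)
    moreover have "Re ((- 1 / 2) * P - of_real r * Q) = - Re P / 2 - r * Re Q" for P Q :: complex and r
      by simp
    ultimately have "Re (\<i> * boost x * cnj (dU x)) = - Re (\<i> * U x * cnj (dU x)) / 2 - \<omega> * x * Re (U x * cnj (dU x))"
      by (simp only:)
    then show ?thesis unfolding current using first_integral[of x] by (simp add: algebra_simps)
  qed
  then show ?thesis
    unfolding real_pairing_def using x_norm2_integral ReU2_integrable by simp
qed

end

text \<open>The Boolean chooses between the local form, by conjugation, and the nonlocal form, by
  reflection. On functions with \<open>f (- x) = - cnj (f x)\<close>, such as both kernel functions,
  the two differ only by a sign, so one computation serves both.\<close>

definition coupling :: "real \<Rightarrow> bool \<Rightarrow> (real \<Rightarrow> complex) \<Rightarrow> real \<Rightarrow> complex" where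
  "coupling \<tau> r f x = \<tau> *\<^sub>R (if r then f (- x) else cnj (f x))"

lemma decay_operator_coupling: "decay_operator \<kappa> (coupling \<tau> r)"
  unfolding decay_operator_def
proof (intro conjI exI[of _ "\<bar>\<tau>\<bar>"] allI impI)
  fix f :: "real \<Rightarrow> complex" and M assume f: "decaying \<kappa> f M"
  show "decaying \<kappa> (coupling \<tau> r f) (\<bar>\<tau>\<bar> * M)"
    unfolding decaying_def
  proof (intro conjI allI)
    show "continuous_on UNIV (coupling \<tau> r f)"
    proof -
      have c: "continuous_on UNIV f" using f by (simp add: decaying_def)
      have "continuous_on UNIV (\<lambda>x. f (- x))"
        by (rule continuous_on_compose2[OF c]) (auto intro!: continuous_intros)
      with c show ?thesis unfolding coupling_def by (cases r) (auto intro!: continuous_intros)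
    qed
    fix x
    have "norm (f x) \<le> M * exp (- \<kappa> * \<bar>x\<bar>)" "norm (f (- x)) \<le> M * exp (- \<kappa> * \<bar>x\<bar>)"
      using f unfolding decaying_def by (auto dest: spec[of _ "- x"])
    then show "norm (coupling \<tau> r f x) \<le> \<bar>\<tau>\<bar> * M * exp (- \<kappa> * \<bar>x\<bar>)"
      unfolding coupling_def by (auto simp: mult.assoc intro!: mult_left_mono)
  qed
qed (auto simp: coupling_def algebra_simps)

lemma real_pairing_scale: "real_pairing (\<lambda>x. r *\<^sub>R f x) g = r * real_pairing f g"
  unfolding real_pairing_def by (subst Bochner_Integration.integral_mult_right_zero[symmetric]) (simp add: algebra_simps)

section \<open>Signs of the bifurcation coefficients\<close>

context soliton_profile
begin

lemma U_nonzero: "U x \<noteq> 0"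
  using lower[of x] c by (metis exp_gt_zero mult_pos_pos norm_zero not_less)

text \<open>For \<open>g = 1\<close> the quartic terms combine, since
  \<open>|U|^4 + Re (U^4) = 2 (Re (U^2))^2\<close>. The identity later forces
  \<open>Re (U^2) > 0\<close> for positive \<omega>.\<close>

lemma gross_neveu_first_integral:
  assumes "g = 1"
  shows "Re ((U x)\<^sup>2) - \<omega> * (norm (U x))\<^sup>2 = (Re ((U x)\<^sup>2))\<^sup>2"
proof -
  have "norm (U x) ^ 4 = (norm ((U x)\<^sup>2))\<^sup>2" by (simp add: norm_power)
  also have "\<dots> = (Re ((U x)\<^sup>2))\<^sup>2 + (Im ((U x)\<^sup>2))\<^sup>2" by (rule cmod_power2)
  finally have a: "norm (U x) ^ 4 = (Re ((U x)\<^sup>2))\<^sup>2 + (Im ((U x)\<^sup>2))\<^sup>2" .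
  have "U x ^ 4 = (U x)\<^sup>2 * (U x)\<^sup>2" by (simp add: power2_eq_square power4_eq_xxxx)
  then have "Re (U x ^ 4) = (Re ((U x)\<^sup>2))\<^sup>2 - (Im ((U x)\<^sup>2))\<^sup>2" by (simp only: times_complex.sel power2_eq_square)
  with a first_integral[of x] assms show ?thesis by simp
qed

lemma cnj_U_deriv: "((\<lambda>x. z * cnj (U x)) has_vector_derivative z * cnj (dU x)) (at x)"
  by (auto intro!: derivative_eq_intros)

lemma alpha_p_eq: "complex_of_real (\<alpha>p x) = \<omega> + 2 * (U x * cnj (U x))"
  by (simp add: \<alpha>p_def norm_sq)

text \<open>The function \<open>\<i> cnj U\<close> is an eigenfunction of the operator on sums with
  eigenvalue \<open>2 * \<omega>\<close>. This explicit preimage of the coupled gauge vector makes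
  the second-order coefficient computable.\<close>

lemma gross_neveu_cnj_p:
  assumes "g = 1" "\<omega> \<noteq> 0"
  shows "dirac_eq \<alpha>p \<beta>p (\<lambda>x. \<i> / (2 * \<omega>) * cnj (U x)) (\<lambda>x. \<i> * cnj (U x))"
  unfolding dirac_eq_def alpha_p_eq \<beta>p_def
  using assms(2)
  by (intro allI has_vector_derivative_eq_rhs[OF cnj_U_deriv], unfold dU_def)
     (simp add: assms(1) field_simps power2_eq_square power3_eq_cube)

text \<open>The counterpart for the coupled translation vector: the profile equation for
  \<open>U\<close> shows that a multiple of \<open>cnj U\<close> is a preimage of
  \<open>cnj dU\<close>.\<close>

lemma gross_neveu_cnj_m:
  assumes "g = 1"
  shows "dirac_eq \<alpha>m \<beta>m (\<lambda>x. \<i> / 2 * cnj (U x)) (\<lambda>x. cnj (dU x))"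
  unfolding dirac_eq_def \<alpha>m_def \<beta>m_def
  by (intro allI has_vector_derivative_eq_rhs[OF cnj_U_deriv], unfold dU_def)
     (simp add: assms field_simps power2_eq_square power3_eq_cube)

end

text \<open>The function \<open>dw\<close> plays the role of \<open>\<partial>U\<^sub>\<omega> / \<partial>\<omega>\<close>, and \<open>mass_decreasing\<close> that of the slope condition on the charge.\<close>

locale soliton_variation = soliton_profile +
  fixes dw :: "real \<Rightarrow> complex" and M :: real
  assumes dw_eq: "dirac_eq \<alpha>p \<beta>p dw (\<lambda>x. - U x)"
    and decaying_dw: "decaying \<kappa> dw M"
    and dw_sym: "\<And>x. dw (- x) = cnj (dw x)"
    and mass_decreasing: "real_pairing dw U < 0"
    and ReU2_pos: "0 < (LINT x|lborel. Re ((U x)\<^sup>2))"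
begin

text \<open>All sign information sits in four numbers: \<open>c1 > 0\<close> and
  \<open>c2 < 0\<close> multiply \<open>s1 * s2 * t\<^sup>2\<close>, while \<open>d1\<close> and
  \<open>d2\<close> both have the sign \<open>sg\<close>, which stands for the model. The factor
  \<open>s1 * s2\<close> then selects the kernel vector that bifurcates.\<close>

lemma bifurcation_branches:
  fixes \<tau> \<zeta> s1 s2 sg :: real and r :: bool
  assumes cases: "\<tau> = 0 \<and> \<zeta> = -1 \<and> sg = -1 \<or> \<tau>\<^sup>2 = 1 \<and> \<zeta> = 0 \<and> sg = 1 \<and> g = 1 \<and> \<omega> > 0"
  shows translation_branch: "s1 * s2 * sg < 0 \<Longrightarrow> \<exists>\<epsilon>0>0. \<exists>C. \<forall>\<epsilon>. 0 < \<epsilon> \<and> \<epsilon> < \<epsilon>0 \<longrightarrow> (\<exists>t>0. \<exists>a b.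
      dirac_eq \<alpha>p \<beta>p a (\<lambda>x. \<epsilon> *\<^sub>R (t *\<^sub>R ((\<i> * of_real s1) * b x) + coupling \<tau> r b x + \<epsilon> *\<^sub>R (\<zeta> *\<^sub>R a x))) \<and>
      dirac_eq \<alpha>m \<beta>m b (\<lambda>x. \<epsilon> *\<^sub>R (t *\<^sub>R ((\<i> * of_real s2) * a x) + coupling \<tau> r a x + \<epsilon> *\<^sub>R (\<zeta> *\<^sub>R b x))) \<and>
      decaying \<kappa> (\<lambda>x. a x - dU x) (C * \<epsilon>) \<and> decaying \<kappa> b (C * \<epsilon>))" (is "_ \<Longrightarrow> ?T")
    and gauge_branch: "s1 * s2 * sg > 0 \<Longrightarrow> \<exists>\<epsilon>0>0. \<exists>C. \<forall>\<epsilon>. 0 < \<epsilon> \<and> \<epsilon> < \<epsilon>0 \<longrightarrow> (\<exists>t>0. \<exists>b a.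
      dirac_eq \<alpha>m \<beta>m b (\<lambda>x. \<epsilon> *\<^sub>R (t *\<^sub>R ((\<i> * of_real s2) * a x) + coupling \<tau> r a x + \<epsilon> *\<^sub>R (\<zeta> *\<^sub>R b x))) \<and>
      dirac_eq \<alpha>p \<beta>p a (\<lambda>x. \<epsilon> *\<^sub>R (t *\<^sub>R ((\<i> * of_real s1) * b x) + coupling \<tau> r b x + \<epsilon> *\<^sub>R (\<zeta> *\<^sub>R a x))) \<and>
      decaying \<kappa> (\<lambda>x. b x - \<i> * U x) (C * \<epsilon>) \<and> decaying \<kappa> a (C * \<epsilon>))" (is "_ \<Longrightarrow> ?G")
proof -
  \<comment> \<open>The price of replacing conjugation by reflection on the kernel
    functions.\<close>
  define \<sigma> :: real where "\<sigma> = (if r then -1 else 1)"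
  define v1 where "v1 x = s2 *\<^sub>R boost x" for x
  define v2 where "v2 x = s1 *\<^sub>R dw x" for x
  define w1 where "w1 x = (\<tau> * \<sigma>) *\<^sub>R (\<i> / 2 * cnj (U x))" for x
  define w2 where "w2 x = (- \<tau> * \<sigma>) *\<^sub>R (\<i> / (2 * \<omega>) * cnj (U x))" for x
  obtain Mb where Mb: "decaying \<kappa> boost Mb" using decaying_boost by blast
  have cnjU: "decaying \<kappa> (\<lambda>x. z * cnj (U x)) (\<bar>norm z\<bar> * C)" for z
    by (rule decaying_scaled) (auto intro!: continuous_intros simp: norm_mult)
  have v1: "dirac_eq \<alpha>m \<beta>m v1 (\<lambda>x. (\<i> * of_real s2) * dU x)" "decaying \<kappa> v1 (\<bar>s2\<bar> * Mb)"
    using dirac_eq_scale[OF boost_eq, of s2] decaying_linear(2)[OF Mb Mb, of s2]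
    unfolding v1_def[abs_def] by (simp_all add: scaleR_conv_of_real mult_ac)
  have v2: "dirac_eq \<alpha>p \<beta>p v2 (\<lambda>x. (\<i> * of_real s1) * (\<i> * U x))" "decaying \<kappa> v2 (\<bar>s1\<bar> * M)"
    using dirac_eq_scale[OF dw_eq, of s1] decaying_linear(2)[OF decaying_dw decaying_dw, of s1]
    unfolding v2_def[abs_def] by (simp_all add: scaleR_conv_of_real mult_ac)
  have zero: "dirac_eq \<alpha> \<beta> (\<lambda>x. 0) (\<lambda>x. 0)" for \<alpha> \<beta> by (auto simp: dirac_eq_def)
  have q_dU: "coupling \<tau> r dU = (\<lambda>x. (\<tau> * \<sigma>) *\<^sub>R cnj (dU x))"
    by (auto simp: coupling_def \<sigma>_def dU_sym)
  have q_U: "coupling \<tau> r (\<lambda>x. \<i> * U x) = (\<lambda>x. (- \<tau> * \<sigma>) *\<^sub>R (\<i> * cnj (U x)))"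
    by (auto simp: coupling_def \<sigma>_def U_sym)
  have w1: "dirac_eq \<alpha>m \<beta>m w1 (coupling \<tau> r dU)"
    using cases unfolding w1_def[abs_def] q_dU
    by (elim disjE) (simp add: zero, intro dirac_eq_scale gross_neveu_cnj_m, simp)
  have w2: "dirac_eq \<alpha>p \<beta>p w2 (coupling \<tau> r (\<lambda>x. \<i> * U x))"
    using cases unfolding w2_def[abs_def] q_U
    by (elim disjE) (simp add: zero, intro dirac_eq_scale gross_neveu_cnj_p, simp_all)
  have dw: "decaying \<kappa> w1 (\<bar>\<tau> * \<sigma>\<bar> * (\<bar>norm (\<i> / 2)\<bar> * C))" "decaying \<kappa> w2 (\<bar>- \<tau> * \<sigma>\<bar> * (\<bar>norm (\<i> / (2 * \<omega>))\<bar> * C))"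
    unfolding w1_def[abs_def] w2_def[abs_def] by (rule decaying_linear(2)[OF cnjU cnjU])+
  define c1 where "c1 = (LINT x|lborel. Re ((U x)\<^sup>2)) / 2"
  define c2 where "c2 = real_pairing dw U"
  have c: "c1 > 0" "c2 < 0" using ReU2_pos mass_decreasing by (simp_all add: c1_def c2_def)
  have A1: "real_pairing (\<lambda>x. (\<i> * of_real s1) * v1 x) dU = s1 * s2 * c1"
    unfolding c1_def pairing_boost[symmetric] real_pairing_scale[symmetric] v1_def
    by (simp add: scaleR_conv_of_real mult_ac)
  have A2: "real_pairing (\<lambda>x. (\<i> * of_real s2) * v2 x) (\<lambda>x. \<i> * U x) = s1 * s2 * c2"
    unfolding c2_def real_pairing_scale[symmetric] v2_def
    by (simp add: real_pairing_def scaleR_conv_of_real algebra_simps)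
  \<comment> \<open>The coefficients linear in \<open>t\<close> vanish by parity: every integrand is
    odd in \<open>x\<close>.\<close>
  have B1: "real_pairing (\<lambda>x. (\<i> * of_real s1) * w1 x) dU + real_pairing (coupling \<tau> r v1) dU = 0"
  proof -
    have "real_pairing (\<lambda>x. (\<i> * of_real s1) * w1 x) dU = 0"
      unfolding real_pairing_def w1_def by (intro integral_odd) (simp add: U_sym dU_sym algebra_simps)
    moreover have "real_pairing (coupling \<tau> r v1) dU = 0"
      unfolding real_pairing_def v1_def coupling_def
      by (intro integral_odd) (simp add: boost_sym dU_sym algebra_simps)
    ultimately show ?thesis by simp
  qed
  have B2: "real_pairing (\<lambda>x. (\<i> * of_real s2) * w2 x) (\<lambda>x. \<i> * U x) + real_pairing (coupling \<tau> r v2) (\<lambda>x. \<i> * U x) = 0"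
  proof -
    have "real_pairing (\<lambda>x. (\<i> * of_real s2) * w2 x) (\<lambda>x. \<i> * U x) = 0"
      unfolding real_pairing_def w2_def by (intro integral_odd) (simp add: U_sym algebra_simps)
    moreover have "real_pairing (coupling \<tau> r v2) (\<lambda>x. \<i> * U x) = 0"
      unfolding real_pairing_def v2_def coupling_def
      by (intro integral_odd) (simp add: U_sym dw_sym algebra_simps)
    ultimately show ?thesis by simp
  qed
  define d1 where "d1 = real_pairing (coupling \<tau> r w1) dU + \<zeta> * real_pairing dU dU"
  define d2 where "d2 = real_pairing (coupling \<tau> r w2) (\<lambda>x. \<i> * U x) + \<zeta> * real_pairing (\<lambda>x. \<i> * U x) (\<lambda>x. \<i> * U x)"
  have m: "real_pairing dU dU > 0" "real_pairing (\<lambda>x. \<i> * U x) (\<lambda>x. \<i> * U x) > 0"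
    using p.mass_pos m.mass_pos unfolding p.mass_def m.mass_def by simp_all
  have d: "sg * d1 > 0" "sg * d2 > 0"
  proof -
    have z: "real_pairing (\<lambda>x. 0) f = 0" for f by (simp add: real_pairing_def)
    \<comment> \<open>Two applications of the coupling produce \<open>\<tau>\<^sup>2\<close>: the
      sign of \<tau> and the sign caused by reflection cancel.\<close>
    have q1: "coupling \<tau> r w1 = (\<lambda>x. (\<tau>\<^sup>2) *\<^sub>R (- (\<i> / 2) * U x))"
      and q2: "coupling \<tau> r w2 = (\<lambda>x. (\<tau>\<^sup>2 / (2 * \<omega>)) *\<^sub>R (\<i> * U x))"
      by (auto simp: coupling_def w1_def w2_def \<sigma>_def U_sym power2_eq_square scaleR_conv_of_real)
    have "sg * d1 > 0 \<and> sg * d2 > 0" using cases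
    proof (elim disjE conjE)
      assume "\<tau> = 0" "\<zeta> = -1" "sg = -1"
      then show ?thesis using m unfolding d1_def d2_def q1 q2 by (simp add: z)
    next
      assume *: "\<tau>\<^sup>2 = 1" "\<zeta> = 0" "sg = 1" "g = 1" "\<omega> > 0"
      \<comment> \<open>By \<open>current\<close> and the first integral the left side equals
        \<open>(Re (U^2))^2 / 2\<close>, so positivity holds at every point and not merely after
        integration.\<close>
      have pos: "Re (- (\<i> / 2) * U x * cnj (dU x)) > 0" for x
      proof -
        have "Re ((U x)\<^sup>2) \<noteq> 0"
          using gross_neveu_first_integral[OF *(4), of x] *(5) U_nonzero[of x] by auto
        moreover have "- (\<i> / 2) * U x * cnj (dU x) = of_real (- 1 / 2) * (\<i> * U x * cnj (dU x))" by simp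
        then have "Re (- (\<i> / 2) * U x * cnj (dU x)) = - 1 / 2 * Re (\<i> * U x * cnj (dU x))"
          by (simp only: Re_complex_of_real Im_complex_of_real times_complex.sel[of "of_real (- 1 / 2)"] mult_zero_left diff_zero)
        then have "Re (- (\<i> / 2) * U x * cnj (dU x)) = (Re ((U x)\<^sup>2))\<^sup>2 / 2"
          unfolding current gross_neveu_first_integral[OF *(4), symmetric]
        proof -
          have "y = - 1 / 2 * (R - w * a - n - h) \<Longrightarrow> 2 * w * a + n + h = 2 * R \<Longrightarrow> y = (R - w * a) / 2"
            for y R w a n h :: real by (simp add: field_simps)
          then show "Re (- (\<i> / 2) * U x * cnj (dU x)) = - 1 / 2 *
              (Re ((U x)\<^sup>2) - \<omega> * (norm (U x))\<^sup>2 - norm (U x) ^ 4 - g * Re (U x ^ 4)) \<Longrightarrow>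
              Re (- (\<i> / 2) * U x * cnj (dU x)) = (Re ((U x)\<^sup>2) - \<omega> * (norm (U x))\<^sup>2) / 2"
            using first_integral[of x] by blast
        qed
        ultimately show ?thesis by (metis half_gt_zero zero_less_power2)
      qed
      have "decaying \<kappa> (\<lambda>x. - (\<i> / 2) * U x) (\<bar>1 / 2\<bar> * C)"
        by (rule decaying_scaled) (auto intro!: continuous_intros simp: norm_mult)
      then have "real_pairing (\<lambda>x. - (\<i> / 2) * U x) dU > 0"
        unfolding real_pairing_def by (intro integral_pos p.pair_integrable pos)
      moreover have "real_pairing (\<lambda>x. (\<tau>\<^sup>2 / (2 * \<omega>)) *\<^sub>R (\<i> * U x)) (\<lambda>x. \<i> * U x) > 0"
        unfolding real_pairing_scale using m * by simp
      ultimately show ?thesis unfolding d1_def d2_def q1 q2 using * by simp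
    qed
    then show "sg * d1 > 0" "sg * d2 > 0" by auto
  qed
  have sgn: "(s1 * s2 * x) * y < 0 \<longleftrightarrow> (s1 * s2 * sg) * x * (sg * y) < 0" 
    "(s1 * s2 * x) * y \<ge> 0 \<longleftrightarrow> (s1 * s2 * sg) * x * (sg * y) \<ge> 0" for x y
  proof -
    have "sg * sg = 1" using cases by auto
    moreover have "(s1 * s2 * sg) * x * (sg * y) = (sg * sg) * ((s1 * s2 * x) * y)" by (simp only: mult_ac)
    ultimately have eq: "(s1 * s2 * sg) * x * (sg * y) = (s1 * s2 * x) * y" by (simp only: mult_1_left)
    show "(s1 * s2 * x) * y < 0 \<longleftrightarrow> (s1 * s2 * sg) * x * (sg * y) < 0" 
      "(s1 * s2 * x) * y \<ge> 0 \<longleftrightarrow> (s1 * s2 * sg) * x * (sg * y) \<ge> 0" unfolding eq by simp_all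
  qed
  show ?T if s: "s1 * s2 * sg < 0"
  proof (rule coupled_bifurcation[OF dirac_kernel_p dirac_kernel_m decay_operator_coupling v1 w1 dw(1) v2 w2 dw(2)
        A1 B1 d1_def[symmetric] A2 B2 d2_def[symmetric]])
    show "s1 * s2 * c1 * d1 < 0" unfolding sgn using s c d by (simp add: mult_neg_pos)
    show "0 \<le> s1 * s2 * c2 * d2" unfolding sgn using s c d by (simp add: mult_neg_neg less_imp_le)
  qed (use d in auto)
  show ?G if s: "s1 * s2 * sg > 0"
  proof (rule coupled_bifurcation[OF dirac_kernel_m dirac_kernel_p decay_operator_coupling v2 w2 dw(2) v1 w1 dw(1)
        A2 B2 d2_def[symmetric] A1 B1 d1_def[symmetric]])
    show "s1 * s2 * c2 * d2 < 0" unfolding sgn using s c d by (simp add: mult_pos_neg mult_neg_pos)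
    show "0 \<le> s1 * s2 * c1 * d1" unfolding sgn using s c d by simp
  qed (use d in auto)
qed

end

section \<open>Eigenvectors and convergence in \<open>L\<^sup>2\<close>\<close>

lemma vector4_axis: "(vector [a, b, c, d] :: complex^4) = axis 1 a + axis 2 b + axis 3 c + axis 4 d"
  by (simp add: vec_eq_iff forall_4 axis_def)

lemma bounded_linear_axis: "bounded_linear (axis k :: complex \<Rightarrow> complex^4)"
  by (rule linear_conv_bounded_linear[THEN iffD1], rule linearI) (auto simp: vec_eq_iff axis_def)

lemma vector4_has_vector_derivative:
  assumes "(a has_vector_derivative a') F" "(b has_vector_derivative b') F"
    "(c has_vector_derivative c') F" "(d has_vector_derivative d') F"
  shows "((\<lambda>x. vector [a x, b x, c x, d x] :: complex^4) has_vector_derivative vector [a', b', c', d']) F"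
  unfolding vector4_axis
  by (intro has_vector_derivative_add bounded_linear.has_vector_derivative[OF bounded_linear_axis] assms)

lemma vector4_continuous_on:
  fixes a b c d :: "real \<Rightarrow> complex"
  assumes "continuous_on S a" "continuous_on S b" "continuous_on S c" "continuous_on S d"
  shows "continuous_on S (\<lambda>x. vector [a x, b x, c x, d x] :: complex^4)"
  unfolding vector4_axis
  by (intro continuous_on_add bounded_linear.continuous_on[OF bounded_linear_axis] assms)

lemma norm_vector4_le: "norm (vector [a, b, c, d] :: complex^4) \<le> norm a + norm b + norm c + norm d"
proof -
  have "norm (vector [a, b, c, d] :: complex^4) \<le> (\<Sum>i\<in>UNIV. norm ((vector [a, b, c, d] :: complex^4) $ i))"
    unfolding norm_vec_def by (intro L2_set_le_sum) auto
  then show ?thesis by (simp add: sum_4)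
qed

lemma L2_exp_bound:
  fixes f :: "real \<Rightarrow> complex^4"
  assumes "continuous_on UNIV f" "\<kappa> > 0" "\<And>x. norm (f x) \<le> M * exp (- \<kappa> * \<bar>x\<bar>)"
  shows in_L2_exp_bound: "in_L2 f"
    and L2_norm_exp_bound: "L2_norm f \<le> M * sqrt (LINT x|lborel. exp (- (2 * \<kappa>) * \<bar>x\<bar>))"
proof -
  have M: "M \<ge> 0" using order_trans[OF norm_ge_zero assms(3)[of 0]] by simp
  have sq: "(norm (f x))\<^sup>2 \<le> M\<^sup>2 * exp (- (2 * \<kappa>) * \<bar>x\<bar>)" for x
  proof -
    have "(norm (f x))\<^sup>2 \<le> (M * exp (- \<kappa> * \<bar>x\<bar>))\<^sup>2" by (intro power_mono assms(3)) auto
    also have "\<dots> = M\<^sup>2 * exp (- (2 * \<kappa>) * \<bar>x\<bar>)"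
      by (simp add: power_mult_distrib flip: exp_of_nat_mult)
    finally show ?thesis .
  qed
  have int: "integrable lborel (\<lambda>x. (norm (f x))\<^sup>2)"
    by (rule integrable_exp_bound[of _ "2 * \<kappa>" "M\<^sup>2"]) (use assms sq in \<open>auto intro!: continuous_intros\<close>)
  then show "in_L2 f" using assms(1) by (simp add: in_L2_def borel_measurable_continuous_onI)
  have "(LINT x|lborel. (norm (f x))\<^sup>2) \<le> (LINT x|lborel. M\<^sup>2 * exp (- (2 * \<kappa>) * \<bar>x\<bar>))"
    using assms(2) by (intro integral_mono int integrable_mult_right integrable_exp_abs sq) auto
  then have "L2_norm f \<le> sqrt (M\<^sup>2 * (LINT x|lborel. exp (- (2 * \<kappa>) * \<bar>x\<bar>)))"
    unfolding L2_norm_def by simp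
  then show "L2_norm f \<le> M * sqrt (LINT x|lborel. exp (- (2 * \<kappa>) * \<bar>x\<bar>))"
    using M by (simp add: real_sqrt_mult)
qed

lemma integral_derivative_compact:
  fixes F :: "real \<Rightarrow> 'a::euclidean_space"
  assumes F: "\<And>x. (F has_vector_derivative f x) (at x)" and f: "continuous_on UNIV f" "integrable lborel f"
    and supp: "\<And>x. \<bar>x\<bar> > R \<Longrightarrow> F x = 0"
  shows "(LINT x|lborel. f x) = 0"
proof -
  have bot: "(F \<longlongrightarrow> 0) at_bot"
    by (rule tendsto_eventually, rule eventually_mono[OF eventually_le_at_bot[of "- \<bar>R\<bar> - 1"]]) (auto intro: supp)
  have top: "(F \<longlongrightarrow> 0) at_top"
    by (rule tendsto_eventually, rule eventually_mono[OF eventually_gt_at_top[of "\<bar>R\<bar>"]]) (auto intro: supp)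
  have "(LBINT x=-\<infinity>..\<infinity>. f x) = 0 - 0"
    using f bot top F
    by (intro interval_integral_FTC_integrable)
       (auto simp: ereal_tendsto_simps set_integrable_def continuous_on_eq_continuous_at)
  then show ?thesis
    by (simp add: interval_lebesgue_integral_def set_lebesgue_integral_def)
qed

lemma test_function_facts:
  assumes "test_function \<phi>"
  obtains K R where "\<And>x. (\<phi> has_real_derivative deriv \<phi> x) (at x)" "continuous_on UNIV (deriv \<phi>)"
    "\<And>x. \<bar>\<phi> x\<bar> \<le> K" "\<And>x. \<bar>deriv \<phi> x\<bar> \<le> K" "\<And>x. \<bar>x\<bar> > R \<Longrightarrow> \<phi> x = 0"
proof -
  have d: "(deriv ^^ n) \<phi> differentiable_on UNIV" for n using assms by (simp add: test_function_def)
  have dphi: "(\<phi> has_real_derivative deriv \<phi> x) (at x)" for x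
    using d[of 0] by (auto simp: differentiable_on_def DERIV_deriv_iff_real_differentiable)
  have cont: "continuous_on UNIV (deriv \<phi>)"
    using d[of 1] by (auto intro: differentiable_imp_continuous_on)
  have cont0: "continuous_on UNIV \<phi>"
    using d[of 0] by (auto intro: differentiable_imp_continuous_on)
  obtain R where R: "\<And>x. \<phi> x \<noteq> 0 \<Longrightarrow> \<bar>x\<bar> \<le> R"
    using assms by (auto simp: test_function_def bounded_iff)
  have R0: "deriv \<phi> x = 0" if "\<bar>x\<bar> > R" for x
  proof (rule DERIV_imp_deriv)
    have "((\<lambda>_. 0) has_real_derivative 0) (at x)" by simp
    moreover have "\<forall>\<^sub>F y in nhds x. 0 = \<phi> y"
    proof -
      have "open {y::real. \<bar>y\<bar> > R}" by (intro open_Collect_less continuous_intros)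
      then have "\<forall>\<^sub>F y in nhds x. y \<in> {y. \<bar>y\<bar> > R}" using that by (intro eventually_nhds_in_open) auto
      then show ?thesis by (rule eventually_mono) (use R in force)
    qed
    ultimately show "(\<phi> has_real_derivative 0) (at x)"
      by (subst (asm) DERIV_cong_ev[OF refl _ refl]) auto
  qed
  have "bounded (\<phi> ` {-R..R})" "bounded (deriv \<phi> ` {-R..R})"
    by (intro compact_imp_bounded compact_continuous_image continuous_on_subset[OF cont] continuous_on_subset[OF cont0]; simp)+
  then obtain K1 K2 where K: "\<And>x. x \<in> {-R..R} \<Longrightarrow> \<bar>\<phi> x\<bar> \<le> K1" "\<And>x. x \<in> {-R..R} \<Longrightarrow> \<bar>deriv \<phi> x\<bar> \<le> K2"
    unfolding bounded_iff by fastforce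
  show thesis
  proof (rule that[OF dphi cont])
    show "\<bar>\<phi> x\<bar> \<le> max 0 (max K1 K2)" "\<bar>deriv \<phi> x\<bar> \<le> max 0 (max K1 K2)" for x
    proof -
      have "\<bar>\<phi> x\<bar> \<le> max 0 (max K1 K2) \<and> \<bar>deriv \<phi> x\<bar> \<le> max 0 (max K1 K2)"
      proof (cases "\<bar>x\<bar> \<le> R")
        case True
        then have "x \<in> {-R..R}" by auto
        from K[OF this] show ?thesis by linarith
      next
        case False
        then have "\<phi> x = 0" "deriv \<phi> x = 0" using R[of x] R0[of x] by auto
        then show ?thesis by simp
      qed
      then show "\<bar>\<phi> x\<bar> \<le> max 0 (max K1 K2)" "\<bar>deriv \<phi> x\<bar> \<le> max 0 (max K1 K2)" by auto
    qed
    show "\<phi> x = 0" if "\<bar>x\<bar> > R" for x using R[of x] that by force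
  qed
qed

text \<open>Integration by parts: the product of the test function with \<open>u\<close> vanishes
  outside a compact set, so no boundary terms arise and the classical derivative is a weak
  one.\<close>

lemma H1_classical:
  fixes u u' :: "real \<Rightarrow> complex^4"
  assumes deriv: "\<And>x. (u has_vector_derivative u' x) (at x)" and cont: "continuous_on UNIV u'"
    and \<kappa>: "\<kappa> > 0" and bd: "\<And>x. norm (u x) \<le> M * exp (- \<kappa> * \<bar>x\<bar>)" "\<And>x. norm (u' x) \<le> M * exp (- \<kappa> * \<bar>x\<bar>)"
  shows "H1_with_deriv u u'"
  unfolding H1_with_deriv_def
proof (intro conjI allI impI)
  have cu: "continuous_on UNIV u"
    using deriv by (auto simp: continuous_on_eq_continuous_at intro: has_vector_derivative_continuous)
  show "in_L2 u" "in_L2 u'" by (rule in_L2_exp_bound[OF cu \<kappa> bd(1)], rule in_L2_exp_bound[OF cont \<kappa> bd(2)])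
  fix \<phi> assume "test_function \<phi>"
  then obtain K R where \<phi>: "\<And>x. (\<phi> has_real_derivative deriv \<phi> x) (at x)" "continuous_on UNIV (deriv \<phi>)"
    "\<And>x. \<bar>\<phi> x\<bar> \<le> K" "\<And>x. \<bar>deriv \<phi> x\<bar> \<le> K" "\<And>x. \<bar>x\<bar> > R \<Longrightarrow> \<phi> x = 0"
    by (rule test_function_facts) blast
  have c\<phi>: "continuous_on UNIV \<phi>"
    using \<phi>(1) by (meson DERIV_isCont continuous_at_imp_continuous_on)
  have prod: "norm (r *\<^sub>R v) \<le> (K * M) * exp (- \<kappa> * \<bar>x\<bar>)" if "\<bar>r\<bar> \<le> K" "norm v \<le> M * exp (- \<kappa> * \<bar>x\<bar>)" for r x and v :: "complex^4"
    using mult_mono[OF that] that(1) by (simp add: mult.assoc)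
  have i1: "integrable lborel (\<lambda>x. deriv \<phi> x *\<^sub>R u x)"
    by (rule integrable_exp_bound[OF _ \<kappa> prod[OF \<phi>(4) bd(1)]]) (intro continuous_intros \<phi> cu)
  have i2: "integrable lborel (\<lambda>x. \<phi> x *\<^sub>R u' x)"
    by (rule integrable_exp_bound[OF _ \<kappa> prod[OF \<phi>(3) bd(2)]]) (intro continuous_intros c\<phi> cont)
  have "(LINT x|lborel. \<phi> x *\<^sub>R u' x + deriv \<phi> x *\<^sub>R u x) = 0"
  proof (rule integral_derivative_compact)
    show "((\<lambda>x. \<phi> x *\<^sub>R u x) has_vector_derivative \<phi> x *\<^sub>R u' x + deriv \<phi> x *\<^sub>R u x) (at x)" for x
      by (intro has_vector_derivative_scaleR \<phi> deriv)
    show "continuous_on UNIV (\<lambda>x. \<phi> x *\<^sub>R u' x + deriv \<phi> x *\<^sub>R u x)"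
      by (intro continuous_intros c\<phi> cont \<phi> cu)
    show "\<phi> x *\<^sub>R u x = 0" if "\<bar>x\<bar> > R" for x using \<phi>(5)[OF that] by simp
  qed (intro Bochner_Integration.integrable_add i1 i2)
  then show "(LINT x|lborel. deriv \<phi> x *\<^sub>R u x) = - (LINT x|lborel. \<phi> x *\<^sub>R u' x)"
    using i1 i2 by (simp add: add_eq_0_iff)
qed

lemma continuous_not_AE_zero:
  fixes u :: "real \<Rightarrow> 'a::real_normed_vector"
  assumes "continuous_on UNIV u" "u x0 \<noteq> 0"
  shows "\<not> (AE x in lborel. u x = 0)"
proof
  assume ae: "AE x in lborel. u x = 0"
  have "open {x. u x \<noteq> 0}" by (intro open_Collect_neq assms continuous_intros)
  then obtain d where d: "d > 0" "\<And>x. \<bar>x - x0\<bar> < d \<Longrightarrow> u x \<noteq> 0"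
    using assms(2) unfolding open_dist dist_real_def by auto
  have "AE x in lborel. x \<notin> {x0 - d<..<x0 + d}"
    using ae by eventually_elim (use d(2) in \<open>force simp: abs_less_iff\<close>)
  then have "emeasure lborel {x0 - d<..<x0 + d} = 0"
    by (subst (asm) AE_iff_measurable[of "{x0 - d<..<x0 + d}"]) auto
  then show False using d(1) by simp
qed

lemma eigenvectorI:
  assumes "\<And>x. (u has_vector_derivative u' x) (at x)" "continuous_on UNIV u'" "\<kappa> > 0"
    "\<And>x. norm (u x) \<le> M * exp (- \<kappa> * \<bar>x\<bar>)" "\<And>x. norm (u' x) \<le> M * exp (- \<kappa> * \<bar>x\<bar>)" "u x0 \<noteq> 0"
    "\<And>x. (\<i> * l) *s (sigma *v u x) = D_omega \<omega> (u x) (u' x) + E_matrix m p *v u x + W_matrix m \<omega> x *v u x"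
  shows "eigenvector m \<omega> p l u"
proof -
  have "continuous_on UNIV u"
    using assms(1) by (auto simp: continuous_on_eq_continuous_at intro: has_vector_derivative_continuous)
  then show ?thesis
    unfolding eigenvector_def
    using H1_classical[OF assms(1-5)] continuous_not_AE_zero[of u x0] assms(6) assms(7) by blast
qed

lemma L2_tendsto_at_0:
  assumes "in_L2 f" "p0 > 0" "\<And>p. 0 < \<bar>p\<bar> \<Longrightarrow> \<bar>p\<bar> < p0 \<Longrightarrow> in_L2 (u p) \<and> L2_norm (\<lambda>x. u p x - f x) \<le> K * \<bar>p\<bar>"
  shows "L2_tendsto u f (at (0::real))"
  unfolding L2_tendsto_def
proof (intro conjI assms(1))
  have ev: "\<forall>\<^sub>F p in at (0::real). 0 < \<bar>p\<bar> \<and> \<bar>p\<bar> < p0"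
    unfolding eventually_at using assms(2) by (intro exI[of _ p0]) (auto simp: dist_real_def)
  then show "\<forall>\<^sub>F p in at 0. in_L2 (u p)" by eventually_elim (use assms(3) in blast)
  have lim: "((\<lambda>p. K * \<bar>p\<bar>) \<longlongrightarrow> 0) (at (0::real))" by (auto intro!: tendsto_eq_intros)
  show "((\<lambda>p. L2_norm (\<lambda>x. u p x - f x)) \<longlongrightarrow> 0) (at 0)"
  proof (rule Lim_null_comparison[OF _ lim])
    show "\<forall>\<^sub>F p in at 0. norm (L2_norm (\<lambda>x. u p x - f x)) \<le> K * \<bar>p\<bar>"
      using ev
    proof eventually_elim
      case (elim p)
      have "0 \<le> L2_norm (\<lambda>x. u p x - f x)" unfolding L2_norm_def by simp
      then show ?case using assms(3)[of p] elim by simp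
    qed
  qed
qed

section \<open>The explicit solitons\<close>

lemma has_vector_derivative_inverse:
  fixes f :: "real \<Rightarrow> complex"
  assumes "(f has_vector_derivative f') (at x)" "f x \<noteq> 0"
  shows "((\<lambda>x. inverse (f x)) has_vector_derivative - f' * inverse (f x) ^ 2) (at x)"
  using field_vector_diff_chain_at[OF assms(1) DERIV_inverse[OF assms(2)]]
  by (simp add: o_def power2_eq_square)

lemma half_cosh_bounds:
  fixes y :: real
  shows "exp \<bar>y\<bar> / 2 \<le> cosh y" "cosh y \<le> exp \<bar>y\<bar>"
  by (auto simp: cosh_def abs_if)

context
  fixes \<omega> :: real
  assumes omega: "\<bar>\<omega>\<bar> < 1"
begin

lemma mu_pos: "soliton_mu \<omega> > 0"
  using omega by (simp add: soliton_mu_def abs_square_less_1)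

lemma mu_sq: "(soliton_mu \<omega>)\<^sup>2 = 1 - \<omega>\<^sup>2"
  using omega by (simp add: soliton_mu_def abs_square_le_1)

lemma mu_prod: "soliton_mu \<omega> = sqrt (1 + \<omega>) * sqrt (1 - \<omega>)"
  unfolding soliton_mu_def real_sqrt_mult[symmetric] by (simp add: algebra_simps power2_eq_square)

lemma numerator_reflect: "soliton_numerator \<omega> (- x) = cnj (soliton_numerator \<omega> x)"
  by (simp add: soliton_numerator_def)

text \<open>The numerator solves a linear system with constant coefficients. Both solitons are
  rational functions of it and its conjugate, so their equations reduce to algebra.\<close>

lemma numerator_deriv: "(soliton_numerator \<omega> has_vector_derivative
    \<i> * (\<omega> * soliton_numerator \<omega> x - cnj (soliton_numerator \<omega> x))) (at x)"
proof -
  let ?m = "soliton_mu \<omega>" and ?a = "sqrt (1 + \<omega>)" and ?b = "sqrt (1 - \<omega>)"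
  have "(soliton_numerator \<omega> has_vector_derivative
      of_real (?a * (?m * sinh (?m * x))) - \<i> * of_real (?b * (?m * cosh (?m * x)))) (at x)"
    unfolding soliton_numerator_def[abs_def]
    by (intro derivative_intros has_vector_derivative_of_real has_vector_derivative_diff
          bounded_linear.has_vector_derivative[OF bounded_linear_mult_right])
       (auto intro!: derivative_eq_intros simp flip: has_real_derivative_iff_has_vector_derivative)
  moreover have "?a * ?m = (1 + \<omega>) * ?b" "?b * ?m = (1 - \<omega>) * ?a"
    using omega unfolding mu_prod by (simp_all add: algebra_simps real_sqrt_mult_self flip: mult.assoc) 
  then have "?a * (?m * y) = (1 + \<omega>) * ?b * y" "?b * (?m * y) = (1 - \<omega>) * ?a * y" for y
    by (metis mult.assoc)+
  ultimately have "(soliton_numerator \<omega> has_vector_derivative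
      of_real ((1 + \<omega>) * ?b * sinh (?m * x)) - \<i> * of_real ((1 - \<omega>) * ?a * cosh (?m * x))) (at x)"
    by (simp only:)
  then show ?thesis
    by (rule has_vector_derivative_eq_rhs)
       (simp add: soliton_numerator_def complex_eq_iff algebra_simps)
qed

lemma numerator_squares:
  shows "soliton_numerator \<omega> x * cnj (soliton_numerator \<omega> x) = of_real (\<omega> + cosh (2 * soliton_mu \<omega> * x))"
    and "Re ((soliton_numerator \<omega> x)\<^sup>2) = 1 + \<omega> * cosh (2 * soliton_mu \<omega> * x)"
proof -
  define C S where "C = cosh (soliton_mu \<omega> * x)" and "S = sinh (soliton_mu \<omega> * x)"
  have c2: "cosh (2 * soliton_mu \<omega> * x) = C\<^sup>2 + S\<^sup>2" unfolding C_def S_def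
    using cosh_double[of "soliton_mu \<omega> * x"] by (simp add: mult.assoc)
  have cs: "C\<^sup>2 = S\<^sup>2 + 1" unfolding C_def S_def by (rule cosh_square_eq)
  have s: "(sqrt (1 + \<omega>))\<^sup>2 = 1 + \<omega>" "(sqrt (1 - \<omega>))\<^sup>2 = 1 - \<omega>" using omega by auto
  have N: "soliton_numerator \<omega> x = Complex (sqrt (1 + \<omega>) * C) (- sqrt (1 - \<omega>) * S)"
    by (simp add: soliton_numerator_def C_def S_def complex_eq_iff)
  have "soliton_numerator \<omega> x * cnj (soliton_numerator \<omega> x) = of_real ((sqrt (1 + \<omega>))\<^sup>2 * C\<^sup>2 + (sqrt (1 - \<omega>))\<^sup>2 * S\<^sup>2)"
    unfolding N by (simp add: complex_eq_iff power2_eq_square algebra_simps)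
  then show "soliton_numerator \<omega> x * cnj (soliton_numerator \<omega> x) = of_real (\<omega> + cosh (2 * soliton_mu \<omega> * x))"
    unfolding s c2 cs by (simp add: algebra_simps)
  have "Re ((soliton_numerator \<omega> x)\<^sup>2) = (sqrt (1 + \<omega>))\<^sup>2 * C\<^sup>2 - (sqrt (1 - \<omega>))\<^sup>2 * S\<^sup>2"
    unfolding N by (simp add: power2_eq_square algebra_simps)
  then show "Re ((soliton_numerator \<omega> x)\<^sup>2) = 1 + \<omega> * cosh (2 * soliton_mu \<omega> * x)"
    unfolding s c2 cs by (simp add: algebra_simps)
qed

text \<open>A quadratic invariant of the linear system for the numerator; it ties the amplitude
  \<mu> of the solitons to the numerator.\<close>

lemma numerator_relation:
  "(soliton_numerator \<omega> x)\<^sup>2 + (cnj (soliton_numerator \<omega> x))\<^sup>2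
     - 2 * \<omega> * (soliton_numerator \<omega> x * cnj (soliton_numerator \<omega> x)) = 2 * of_real ((soliton_mu \<omega>)\<^sup>2)"
proof -
  have "(soliton_numerator \<omega> x)\<^sup>2 + (cnj (soliton_numerator \<omega> x))\<^sup>2 = of_real (2 * Re ((soliton_numerator \<omega> x)\<^sup>2))"
    using complex_add_cnj[of "(soliton_numerator \<omega> x)\<^sup>2"] by simp
  then show ?thesis
    unfolding numerator_squares mu_sq by (simp add: algebra_simps power2_eq_square)
qed

lemma numerator_nonzero: "soliton_numerator \<omega> x \<noteq> 0"
proof
  assume "soliton_numerator \<omega> x = 0"
  then have "\<omega> + cosh (2 * soliton_mu \<omega> * x) = 0" using numerator_squares(1)[of x] by (metis mult_zero_left of_real_eq_0_iff)
  then show False using cosh_real_ge_1[of "2 * soliton_mu \<omega> * x"] omega by linarith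
qed

text \<open>The Thirring denominator is the squared modulus of the numerator, so one factor
  cancels.\<close>

lemma thirring_quotient: "soliton Thirring \<omega> x = of_real (sqrt 2 * soliton_mu \<omega>) * inverse (cnj (soliton_numerator \<omega> x))"
proof -
  have "soliton Thirring \<omega> x = of_real (sqrt 2 * soliton_mu \<omega>) *
     (soliton_numerator \<omega> x / (soliton_numerator \<omega> x * cnj (soliton_numerator \<omega> x)))"
    by (simp only: soliton.simps numerator_squares)
  also have "soliton_numerator \<omega> x / (soliton_numerator \<omega> x * cnj (soliton_numerator \<omega> x)) = inverse (cnj (soliton_numerator \<omega> x))"
    using numerator_nonzero[of x] by (simp add: field_simps)
  finally show ?thesis .
qed

text \<open>Twice the Gross--Neveu denominator is the sum of the squares of the numerator and its
  conjugate.\<close>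

lemma gross_neveu_quotient: "soliton Gross_Neveu \<omega> x = of_real (2 * soliton_mu \<omega>) * (soliton_numerator \<omega> x *
    inverse ((soliton_numerator \<omega> x)\<^sup>2 + (cnj (soliton_numerator \<omega> x))\<^sup>2))"
proof -
  have "(soliton_numerator \<omega> x)\<^sup>2 + (cnj (soliton_numerator \<omega> x))\<^sup>2 = of_real (2 * Re ((soliton_numerator \<omega> x)\<^sup>2))"
    using complex_add_cnj[of "(soliton_numerator \<omega> x)\<^sup>2"] by simp
  then have D: "(soliton_numerator \<omega> x)\<^sup>2 + (cnj (soliton_numerator \<omega> x))\<^sup>2 = 2 * of_real (1 + \<omega> * cosh (2 * soliton_mu \<omega> * x))"
    unfolding numerator_squares by simp
  have "of_real m * (n / e) = of_real (2 * m) * (n * inverse (2 * e))" for m and n e :: complex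
    by (cases "e = 0") (simp_all add: field_simps)
  then show ?thesis unfolding soliton.simps D by blast
qed

lemma gross_neveu_denominator:
  assumes "\<omega> > 0"
  shows "(soliton_numerator \<omega> x)\<^sup>2 + (cnj (soliton_numerator \<omega> x))\<^sup>2 \<noteq> 0"
proof -
  have "(soliton_numerator \<omega> x)\<^sup>2 + (cnj (soliton_numerator \<omega> x))\<^sup>2 = of_real (2 * Re ((soliton_numerator \<omega> x)\<^sup>2))"
    using complex_add_cnj[of "(soliton_numerator \<omega> x)\<^sup>2"] by simp
  moreover have "2 * Re ((soliton_numerator \<omega> x)\<^sup>2) > 0"
    unfolding numerator_squares using assms cosh_real_ge_1[of "2 * soliton_mu \<omega> * x"] by (simp add: add_pos_nonneg)
  ultimately show ?thesis by (metis less_irrefl of_real_eq_0_iff)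
qed

text \<open>The numerator, its conjugate and their inverses are treated as independent unknowns
  subject to \<open>inv\<close> and \<open>s2\<close>; both claims then are polynomial
  identities.\<close>

lemma thirring_deriv:
  fixes U :: "real \<Rightarrow> complex"
  defines "U \<equiv> soliton Thirring \<omega>"
  shows "(U has_vector_derivative
        - \<i> * (\<omega> * U x - cnj (U x) + U x * cnj (U x) * U x + of_real 0 * cnj (U x) ^ 3)) (at x)"
    and "2 * of_real \<omega> * (U x * cnj (U x)) + (U x * cnj (U x))\<^sup>2 = (U x)\<^sup>2 + (cnj (U x))\<^sup>2"
proof -
  define N M s where "N = soliton_numerator \<omega> x" and "M = cnj N" and "s = complex_of_real (sqrt 2 * soliton_mu \<omega>)"
  define n m W where "n = inverse N" and "m = inverse M" and "W = complex_of_real \<omega>"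
  have U: "U = (\<lambda>x. s * inverse (cnj (soliton_numerator \<omega> x)))"
    unfolding U_def s_def by (rule ext) (rule thirring_quotient)
  define V V' where "V = U x" and "V' = cnj (U x)"
  have V: "V = s * m" "V' = s * n" unfolding V_def V'_def U by (simp_all add: N_def M_def m_def n_def s_def)
  have s2: "s\<^sup>2 = N\<^sup>2 + M\<^sup>2 - 2 * W * (N * M)"
    using numerator_relation[of x] unfolding N_def M_def s_def W_def by (simp add: power_mult_distrib flip: of_real_power)
  have inv: "N * n = 1" "M * m = 1" using numerator_nonzero[of x] by (simp_all add: N_def M_def n_def m_def)
  have "(U has_vector_derivative s * (- cnj (\<i> * (W * N - M)) * m\<^sup>2)) (at x)"
    unfolding U N_def M_def W_def m_def
    by (intro bounded_linear.has_vector_derivative[OF bounded_linear_mult_right] has_vector_derivative_inverse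
        has_vector_derivative_cnj numerator_deriv) (simp add: numerator_nonzero)
  moreover have "cnj (\<i> * (W * N - M)) = - \<i> * (W * M - N)" by (simp add: M_def W_def)
  moreover have "s * (- (- \<i> * (W * M - N)) * m\<^sup>2) = - \<i> * (W * V - V' + V * V' * V)"
    unfolding V using inv s2 by algebra
  ultimately show "(U has_vector_derivative
        - \<i> * (\<omega> * U x - cnj (U x) + U x * cnj (U x) * U x + of_real 0 * cnj (U x) ^ 3)) (at x)"
    by (simp add: V_def V'_def W_def)
  have "2 * W * (V * V') + (V * V')\<^sup>2 = V\<^sup>2 + V'\<^sup>2" unfolding V using inv s2 by algebra
  then show "2 * of_real \<omega> * (U x * cnj (U x)) + (U x * cnj (U x))\<^sup>2 = (U x)\<^sup>2 + (cnj (U x))\<^sup>2"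
    by (simp only: V_def V'_def W_def)
qed

lemma gross_neveu_deriv:
  fixes U :: "real \<Rightarrow> complex"
  assumes "\<omega> > 0"
  defines "U \<equiv> soliton Gross_Neveu \<omega>"
  shows "(U has_vector_derivative
        - \<i> * (\<omega> * U x - cnj (U x) + U x * cnj (U x) * U x + of_real 1 * cnj (U x) ^ 3)) (at x)"
    and "4 * of_real \<omega> * (U x * cnj (U x)) + 2 * (U x * cnj (U x))\<^sup>2 + (U x ^ 4 + cnj (U x) ^ 4) = 2 * ((U x)\<^sup>2 + (cnj (U x))\<^sup>2)"
proof -
  define N M s where "N = soliton_numerator \<omega> x" and "M = cnj N" and "s = complex_of_real (2 * soliton_mu \<omega>)"
  define D where "D x = (soliton_numerator \<omega> x)\<^sup>2 + (cnj (soliton_numerator \<omega> x))\<^sup>2" for x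
  define d W where "d = inverse (N\<^sup>2 + M\<^sup>2)" and "W = complex_of_real \<omega>"
  have U: "U = (\<lambda>x. s * (soliton_numerator \<omega> x * inverse (D x)))"
    unfolding U_def s_def D_def by (rule ext) (rule gross_neveu_quotient)
  define V V' where "V = U x" and "V' = cnj (U x)"
  have V: "V = s * (N * d)" "V' = s * (M * d)"
    unfolding V_def V'_def U by (simp_all add: N_def M_def s_def D_def d_def add.commute)
  have s2: "s\<^sup>2 = 2 * (N\<^sup>2 + M\<^sup>2 - 2 * W * (N * M))"
    using numerator_relation[of x] unfolding N_def M_def s_def W_def by (simp add: power_mult_distrib flip: of_real_power)
  have inv: "(N\<^sup>2 + M\<^sup>2) * d = 1"
    using gross_neveu_denominator[OF assms(1), of x] by (simp add: N_def M_def d_def)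
  have N': "(soliton_numerator \<omega> has_vector_derivative \<i> * (W * N - M)) (at x)"
    unfolding N_def M_def W_def by (rule numerator_deriv)
  have M': "((\<lambda>x. cnj (soliton_numerator \<omega> x)) has_vector_derivative - \<i> * (W * M - N)) (at x)"
    using has_vector_derivative_cnj[OF N'] by (simp add: M_def W_def)
  have D': "(D has_vector_derivative 2 * \<i> * W * (N\<^sup>2 - M\<^sup>2)) (at x)"
    unfolding D_def[abs_def] power2_eq_square
    by (rule has_vector_derivative_eq_rhs[OF has_vector_derivative_add[OF has_vector_derivative_mult[OF N' N'] has_vector_derivative_mult[OF M' M']]])
       (simp add: N_def M_def algebra_simps)
  have "((\<lambda>x. inverse (D x)) has_vector_derivative - (2 * \<i> * W * (N\<^sup>2 - M\<^sup>2)) * d\<^sup>2) (at x)"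
    using has_vector_derivative_inverse[OF D'] gross_neveu_denominator[OF assms(1), of x]
    by (simp add: D_def d_def N_def M_def)
  from has_vector_derivative_mult[OF N' this]
  have "(U has_vector_derivative s * (N * (- (2 * \<i> * W * (N\<^sup>2 - M\<^sup>2)) * d\<^sup>2) + \<i> * (W * N - M) * d)) (at x)"
    unfolding U using bounded_linear.has_vector_derivative[OF bounded_linear_mult_right]
    by (fastforce simp: D_def d_def N_def M_def)
  moreover have "s * (N * (- (2 * \<i> * W * (N\<^sup>2 - M\<^sup>2)) * d\<^sup>2) + \<i> * (W * N - M) * d) =
      - \<i> * (W * V - V' + V * V' * V + V' ^ 3)"
    unfolding V using inv s2 by algebra
  ultimately show "(U has_vector_derivative
        - \<i> * (\<omega> * U x - cnj (U x) + U x * cnj (U x) * U x + of_real 1 * cnj (U x) ^ 3)) (at x)"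
    by (simp add: V_def V'_def W_def)
  have "4 * W * (V * V') + 2 * (V * V')\<^sup>2 + (V ^ 4 + V' ^ 4) = 2 * (V\<^sup>2 + V'\<^sup>2)" unfolding V using inv s2 by algebra
  then show "4 * of_real \<omega> * (U x * cnj (U x)) + 2 * (U x * cnj (U x))\<^sup>2 + (U x ^ 4 + cnj (U x) ^ 4) = 2 * ((U x)\<^sup>2 + (cnj (U x))\<^sup>2)"
    by (simp only: V_def V'_def W_def)
qed

end

lemma twice_of_real_Re: "2 * complex_of_real (Re z) = z + cnj z"
  using complex_add_cnj[of z] by simp

text \<open>With \<open>a = |u|^2\<close> the first integral gives the exact value
  \<open>|T|^2 = (1 - \<omega>^2 - \<omega> a) a\<close> and also
  \<open>a \<le> 2 (1 - \<omega>)\<close>. For nonnegative \<omega> the factor is at least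
  \<open>(1 - \<omega>)^2\<close>, for negative \<omega> at least \<open>1 - \<omega>^2\<close>,
  which explains the minimum.\<close>

lemma thirring_nondegenerate:
  fixes u :: complex and \<omega> :: real
  assumes \<omega>: "\<bar>\<omega>\<bar> < 1" and first: "2 * \<omega> * (norm u)\<^sup>2 + norm u ^ 4 = 2 * Re (u\<^sup>2)" and "u \<noteq> 0"
  shows "min (1 - \<omega>) (sqrt (1 - \<omega>\<^sup>2)) * norm u \<le> norm (\<omega> * u - cnj u + u * cnj u * u)"
proof -
  define a R I T where "a = (norm u)\<^sup>2" and "R = Re (u\<^sup>2)" and "I = Im (u\<^sup>2)"
    and "T = \<omega> * u - cnj u + u * cnj u * u"
  have a: "a > 0" using assms(3) by (simp add: a_def)
  have a2: "a\<^sup>2 = R\<^sup>2 + I\<^sup>2"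
    unfolding a_def R_def I_def using cmod_power2[of "u\<^sup>2"] by (simp add: norm_power)
  have fi: "2 * \<omega> * a + a\<^sup>2 = 2 * R" using first by (simp add: a_def R_def)
  have ua: "u * cnj u = of_real a" unfolding a_def by (rule complex_norm_square[symmetric])
  have "T * cnj u = \<omega> * (u * cnj u) - cnj (u\<^sup>2) + (u * cnj u)\<^sup>2"
    by (simp add: T_def power2_eq_square algebra_simps)
  also have "cnj (u\<^sup>2) = Complex R (- I)" by (simp add: R_def I_def complex_eq_iff del: complex_cnj_power)
  also have "\<omega> * (u * cnj u) - Complex R (- I) + (u * cnj u)\<^sup>2 = Complex (\<omega> * a - R + a\<^sup>2) I"
    unfolding ua by (simp add: complex_eq_iff flip: of_real_power)
  finally have Tu: "(norm (T * cnj u))\<^sup>2 = (\<omega> * a - R + a\<^sup>2)\<^sup>2 + I\<^sup>2" by (simp add: cmod_power2)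
  have R: "R = \<omega> * a + a\<^sup>2 / 2" using fi by simp
  have "\<omega> * a - R + a\<^sup>2 = a\<^sup>2 / 2" unfolding R by simp
  moreover have "I\<^sup>2 = a\<^sup>2 - R\<^sup>2" using a2 by simp
  ultimately have "(norm (T * cnj u))\<^sup>2 = (a\<^sup>2 / 2)\<^sup>2 + (a\<^sup>2 - R\<^sup>2)" unfolding Tu by (simp only:)
  also have "\<dots> = a\<^sup>2 * (1 - \<omega>\<^sup>2 - \<omega> * a)" unfolding R by (simp add: power2_eq_square algebra_simps)
  finally have "(norm T)\<^sup>2 * a = a\<^sup>2 * (1 - \<omega>\<^sup>2 - \<omega> * a)" by (simp add: norm_mult power_mult_distrib a_def)
  then have T2: "(norm T)\<^sup>2 = (1 - \<omega>\<^sup>2 - \<omega> * a) * a" using a by (simp add: power2_eq_square)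
  have "R\<^sup>2 \<le> a\<^sup>2" using a2 by simp
  then have "R \<le> a" using a by (simp add: abs_le_square_iff[symmetric])
  then have "a * a \<le> a * (2 * (1 - \<omega>))" using fi by (simp add: power2_eq_square algebra_simps)
  then have a_le: "a \<le> 2 * (1 - \<omega>)" using a by simp
  have "(min (1 - \<omega>) (sqrt (1 - \<omega>\<^sup>2)))\<^sup>2 \<le> 1 - \<omega>\<^sup>2 - \<omega> * a"
  proof (cases "\<omega> \<ge> 0")
    case True
    have "(min (1 - \<omega>) (sqrt (1 - \<omega>\<^sup>2)))\<^sup>2 \<le> (1 - \<omega>)\<^sup>2" using \<omega> by (intro power_mono) (auto simp: abs_square_le_1)
    also have "\<dots> \<le> 1 - \<omega>\<^sup>2 - \<omega> * a"
      using mult_left_mono[OF a_le True] by (simp add: power2_eq_square algebra_simps)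
    finally show ?thesis .
  next
    case False
    have "(min (1 - \<omega>) (sqrt (1 - \<omega>\<^sup>2)))\<^sup>2 \<le> (sqrt (1 - \<omega>\<^sup>2))\<^sup>2" using \<omega> by (intro power_mono) (auto simp: abs_square_le_1)
    also have "\<dots> = 1 - \<omega>\<^sup>2" using \<omega> by (simp add: abs_square_le_1)
    also have "\<dots> \<le> 1 - \<omega>\<^sup>2 - \<omega> * a" using False a by (simp add: mult_nonpos_nonneg)
    finally show ?thesis .
  qed
  then have "(min (1 - \<omega>) (sqrt (1 - \<omega>\<^sup>2)))\<^sup>2 * a \<le> (norm T)\<^sup>2" unfolding T2 using a by (intro mult_right_mono) auto
  then have "(min (1 - \<omega>) (sqrt (1 - \<omega>\<^sup>2)) * norm u)\<^sup>2 \<le> (norm T)\<^sup>2" by (simp add: a_def power_mult_distrib)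
  then show ?thesis unfolding T_def by (rule power2_le_imp_le) simp
qed

text \<open>In terms of \<open>R = Re (u^2)\<close> the first integral reads
  \<open>\<omega> a = R - R^2\<close>, and \<open>\<omega>^2 |T|^2 a\<close> is \<open>R^2\<close>
  times a sum of two nonnegative terms that do not vanish together: \<open>\<omega>^2 R^2\<close> is
  bounded below for \<open>R\<close> away from 0, the other one for small \<open>R\<close>.\<close>

lemma gross_neveu_nondegenerate:
  fixes \<omega> :: real
  assumes \<omega>: "0 < \<omega>" "\<omega> < 1"
  shows "\<exists>k>0. \<forall>u::complex. u \<noteq> 0 \<longrightarrow> 2 * \<omega> * (norm u)\<^sup>2 + norm u ^ 4 + Re (u ^ 4) = 2 * Re (u\<^sup>2) \<longrightarrow>
    k * norm u \<le> norm (\<omega> * u - cnj u + u * cnj u * u + cnj u ^ 3)"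
proof -
  \<comment> \<open>Below \<eta>, \<open>1 - 2 * R\<close> is at least 1/2 because of the entry 1/4,
    and \<open>1 - R\<close> is at least \<open>(1 + \<omega>) / 2\<close> because of the other
    entry; together these give the bound \<open>(1 - \<omega>) / 16\<close>.\<close>
  define \<eta> where "\<eta> = min (1/4) ((1 - \<omega>) / 2)"
  define k where "k = min (\<omega> * \<eta>) (sqrt ((1 - \<omega>) / 16))"
  have \<eta>: "\<eta> > 0" "\<eta> \<le> 1/4" "\<eta> \<le> (1 - \<omega>) / 2" using \<omega> unfolding \<eta>_def by (simp, blast intro: min.cobounded1, blast intro: min.cobounded2)
  have k: "k > 0" "k\<^sup>2 \<le> (\<omega> * \<eta>)\<^sup>2" "k\<^sup>2 \<le> (1 - \<omega>) / 16"
  proof -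
    show "k > 0" using \<omega> \<eta> by (simp add: k_def)
    then show "k\<^sup>2 \<le> (\<omega> * \<eta>)\<^sup>2" by (intro power_mono) (auto simp: k_def)
    have "k\<^sup>2 \<le> (sqrt ((1 - \<omega>) / 16))\<^sup>2" using \<open>k > 0\<close> by (intro power_mono) (auto simp: k_def)
    then show "k\<^sup>2 \<le> (1 - \<omega>) / 16" using \<omega> by simp
  qed
  have "k * norm u \<le> norm (\<omega> * u - cnj u + u * cnj u * u + cnj u ^ 3)"
    if u: "u \<noteq> 0" "2 * \<omega> * (norm u)\<^sup>2 + norm u ^ 4 + Re (u ^ 4) = 2 * Re (u\<^sup>2)" for u :: complex
  proof -
    define a R I T where "a = (norm u)\<^sup>2" and "R = Re (u\<^sup>2)" and "I = Im (u\<^sup>2)"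
      and "T = \<omega> * u - cnj u + u * cnj u * u + cnj u ^ 3"
    have a: "a > 0" using u(1) by (simp add: a_def)
    have a2: "a\<^sup>2 = R\<^sup>2 + I\<^sup>2"
      unfolding a_def R_def I_def using cmod_power2[of "u\<^sup>2"] by (simp add: norm_power)
    have u4: "u ^ 4 = u\<^sup>2 * u\<^sup>2" by (simp add: power2_eq_square power4_eq_xxxx)
    have "Re (z * z) = (Re z)\<^sup>2 - (Im z)\<^sup>2" "Im (z * z) = 2 * Re z * Im z" for z
      by (simp_all add: power2_eq_square)
    from this[of "u\<^sup>2"] have "Re (u ^ 4) = R\<^sup>2 - I\<^sup>2" "Im (u ^ 4) = 2 * R * I"
      unfolding u4 R_def I_def by blast+
    then have fi: "\<omega> * a = R - R\<^sup>2" using u(2) a2 by (simp add: a_def R_def)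
    have ua: "u * cnj u = of_real a" unfolding a_def by (rule complex_norm_square[symmetric])
    have "T * cnj u = \<omega> * (u * cnj u) - cnj (u\<^sup>2) + (u * cnj u)\<^sup>2 + cnj (u ^ 4)"
      by (simp add: T_def power2_eq_square power3_eq_cube power4_eq_xxxx algebra_simps)
    also have "cnj (u\<^sup>2) = Complex R (- I)" by (simp add: R_def I_def complex_eq_iff del: complex_cnj_power)
    also have "cnj (u ^ 4) = Complex (R\<^sup>2 - I\<^sup>2) (- (2 * R * I))"
      using \<open>Re (u ^ 4) = _\<close> \<open>Im (u ^ 4) = _\<close> by (simp add: complex_eq_iff del: complex_cnj_power)
    also have "\<omega> * (u * cnj u) - Complex R (- I) + (u * cnj u)\<^sup>2 + Complex (R\<^sup>2 - I\<^sup>2) (- (2 * R * I))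
        = Complex (R\<^sup>2) (I * (1 - 2 * R))"
      unfolding ua using fi a2 by (simp add: complex_eq_iff algebra_simps flip: of_real_power of_real_mult)
    finally have "(norm (T * cnj u))\<^sup>2 = (R\<^sup>2)\<^sup>2 + I\<^sup>2 * (1 - 2 * R)\<^sup>2" by (simp add: cmod_power2 power_mult_distrib)
    then have Tu: "(norm T)\<^sup>2 * a = (R\<^sup>2)\<^sup>2 + (a\<^sup>2 - R\<^sup>2) * (1 - 2 * R)\<^sup>2"
      unfolding a2 by (simp add: norm_mult power_mult_distrib a_def)
    have R_R: "R * (1 - R) = \<omega> * a" unfolding fi by (simp add: power2_eq_square algebra_simps)
    have RR: "R * (1 - R) > 0" unfolding R_R using \<omega>(1) a by (rule mult_pos_pos)
    have R: "0 < R" "R < 1" using RR by (auto simp: zero_less_mult_iff)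
    have "R\<^sup>2 \<le> a\<^sup>2" using a2 by simp
    then have "R \<le> a" using a by (simp add: abs_le_square_iff[symmetric])
    then have "\<omega> * R \<le> R * (1 - R)" unfolding R_R using \<omega>(1) by (intro mult_left_mono) auto
    then have R1: "R \<le> 1 - \<omega>" using R by (simp add: mult.commute[of \<omega>])
    have "\<omega>\<^sup>2 * ((norm T)\<^sup>2 * a) = \<omega>\<^sup>2 * (R\<^sup>2)\<^sup>2 + ((\<omega> * a)\<^sup>2 - \<omega>\<^sup>2 * R\<^sup>2) * (1 - 2 * R)\<^sup>2"
      unfolding Tu by (simp add: algebra_simps power_mult_distrib)
    also have "\<dots> = R\<^sup>2 * (\<omega>\<^sup>2 * R\<^sup>2 + ((1 - R)\<^sup>2 - \<omega>\<^sup>2) * (1 - 2 * R)\<^sup>2)"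
      unfolding fi by (simp add: algebra_simps power2_eq_square)
    finally have key: "\<omega>\<^sup>2 * ((norm T)\<^sup>2 * a) = R\<^sup>2 * (\<omega>\<^sup>2 * R\<^sup>2 + ((1 - R)\<^sup>2 - \<omega>\<^sup>2) * (1 - 2 * R)\<^sup>2)" .
    have sq: "(1 - R)\<^sup>2 - \<omega>\<^sup>2 \<ge> 0" using R1 \<omega> by (simp add: power_mono)
    have "k\<^sup>2 \<le> \<omega>\<^sup>2 * R\<^sup>2 + ((1 - R)\<^sup>2 - \<omega>\<^sup>2) * (1 - 2 * R)\<^sup>2"
    proof (cases "R \<ge> \<eta>")
      case True
      have "k\<^sup>2 \<le> (\<omega> * R)\<^sup>2" using k(2) True \<eta> \<omega> by (meson order_trans power_mono mult_left_mono mult_nonneg_nonneg less_imp_le)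
      moreover have "((1 - R)\<^sup>2 - \<omega>\<^sup>2) * (1 - 2 * R)\<^sup>2 \<ge> 0" using sq by simp
      ultimately show ?thesis by (simp add: power_mult_distrib)
    next
      case False
      have 1: "(1/2)\<^sup>2 \<le> (1 - 2 * R)\<^sup>2" using False \<eta> by (intro power_mono) auto
      have "((1 + \<omega>) / 2)\<^sup>2 \<le> (1 - R)\<^sup>2" using False \<eta> \<omega> by (intro power_mono) auto
      moreover have "((1 + \<omega>) / 2)\<^sup>2 - \<omega>\<^sup>2 = (1 - \<omega>) * (1 + 3 * \<omega>) / 4" by (simp add: power2_eq_square field_simps)
      moreover have "(1 - \<omega>) * 1 \<le> (1 - \<omega>) * (1 + 3 * \<omega>)" using \<omega> by (intro mult_left_mono) auto
      ultimately have 2: "(1 - \<omega>) / 4 \<le> (1 - R)\<^sup>2 - \<omega>\<^sup>2" by simp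
      have "(1 - \<omega>) / 4 * (1/2)\<^sup>2 \<le> ((1 - R)\<^sup>2 - \<omega>\<^sup>2) * (1 - 2 * R)\<^sup>2"
        using sq \<omega> by (intro mult_mono 1 2) auto
      moreover have "(1 - \<omega>) / 4 * (1/2)\<^sup>2 = (1 - \<omega>) / 16" by (simp add: power2_eq_square)
      moreover have "0 \<le> \<omega>\<^sup>2 * R\<^sup>2" by simp
      ultimately show ?thesis using k(3) by linarith
    qed
    then have "R\<^sup>2 * k\<^sup>2 \<le> \<omega>\<^sup>2 * ((norm T)\<^sup>2 * a)" unfolding key by (intro mult_left_mono) auto
    moreover have "(\<omega> * a)\<^sup>2 \<le> R\<^sup>2"
      unfolding fi using R by (intro power_mono) (auto simp: power2_eq_square)
    ultimately have "(\<omega> * a)\<^sup>2 * k\<^sup>2 \<le> \<omega>\<^sup>2 * ((norm T)\<^sup>2 * a)"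
      by (meson mult_right_mono order_trans zero_le_power2)
    then have "(\<omega>\<^sup>2 * a) * (a * k\<^sup>2) \<le> (\<omega>\<^sup>2 * a) * (norm T)\<^sup>2" by (simp add: power_mult_distrib power2_eq_square mult_ac)
    then have "a * k\<^sup>2 \<le> (norm T)\<^sup>2" using a \<omega> by (simp add: zero_less_mult_iff)
    then have "(k * norm u)\<^sup>2 \<le> (norm T)\<^sup>2" by (simp add: a_def power_mult_distrib mult.commute)
    then show ?thesis unfolding T_def by (rule power2_le_imp_le) simp
  qed
  with k(1) show ?thesis by blast
qed

section \<open>The variation of the soliton in the frequency, in closed form\<close>

context soliton_profile
begin

text \<open>A candidate for the variation in \<omega> built from \<open>U\<close>, \<open>dU\<close>
  and \<open>x * dU\<close>, so that no differentiation in the parameter has to be justified. The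
  scalar factor is fixed by the equation in \<open>thirring_dw_eq\<close>.\<close>

definition thirring_dw :: "real \<Rightarrow> complex" where
  "thirring_dw x = of_real (- 1 / (2 * \<mu>\<^sup>2)) * (2 * \<omega> * U x + 2 * \<omega> * (of_real x * dU x) + \<i> * dU x)"

definition gross_neveu_dw :: "real \<Rightarrow> complex" where
  "gross_neveu_dw x = of_real (- 1 / (2 * \<omega> * \<mu>\<^sup>2)) * ((\<omega>\<^sup>2 + 2) * U x + 2 * \<omega>\<^sup>2 * (of_real x * dU x)
     - \<omega> * cnj (U x) - U x ^ 3 - U x * cnj (U x) ^ 2)"

lemma complex_first_integral:
  "4 * \<omega> * (U x * cnj (U x)) + 2 * (U x * cnj (U x))\<^sup>2 + g * (U x ^ 4 + cnj (U x) ^ 4) = 2 * ((U x)\<^sup>2 + (cnj (U x))\<^sup>2)"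
proof -
  have "complex_of_real (2 * (2 * \<omega> * (norm (U x))\<^sup>2 + ((norm (U x))\<^sup>2)\<^sup>2 + g * Re (U x ^ 4))) = of_real (2 * (2 * Re ((U x)\<^sup>2)))"
    using first_integral[of x] by simp
  then show ?thesis
    using twice_of_real_Re[of "U x ^ 4"] twice_of_real_Re[of "(U x)\<^sup>2"]
    by (simp only: of_real_mult of_real_add of_real_power norm_sq of_real_numeral complex_cnj_power) algebra
qed

lemma xdU_deriv: "((\<lambda>x. of_real x * dU x) has_vector_derivative dU x + of_real x * (- \<i> * (\<omega> * dU x - cnj (dU x)
    + (2 * U x * cnj (U x) * dU x + (U x)\<^sup>2 * cnj (dU x)) + 3 * g * (cnj (U x))\<^sup>2 * cnj (dU x)))) (at x)"
  by (rule has_vector_derivative_eq_rhs[OF has_vector_derivative_mult[OF has_vector_derivative_of_real[OF DERIV_ident[unfolded has_real_derivative_iff_has_vector_derivative]] dU_deriv]])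
     simp

lemma xdU_bound: "norm (of_real x * dU x) \<le> B * (C / \<kappa>) * exp (- \<kappa> * \<bar>x\<bar>)"
proof -
  have "norm (of_real x * dU x) = \<bar>x\<bar> * norm (dU x)" by (simp add: norm_mult)
  also have "\<dots> \<le> \<bar>x\<bar> * (B * norm (U x))" by (intro mult_left_mono dU_norm) auto
  also have "\<dots> = B * norm (of_real x * U x)" by (simp add: norm_mult)
  also have "\<dots> \<le> B * (C / \<kappa> * exp (- \<kappa> * \<bar>x\<bar>))" using B_pos by (intro mult_left_mono xU_bound) auto
  finally show ?thesis by simp
qed

lemma decaying_combination:
  assumes "continuous_on UNIV h" "\<And>x. norm (h x) \<le> K * norm (U x)"
  shows "\<exists>M. decaying \<kappa> (\<lambda>x. z * (h x + z' * (of_real x * dU x))) M"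
proof -
  have "decaying \<kappa> (\<lambda>x. of_real x * dU x) (B * (C / \<kappa>))"
    unfolding decaying_def using xdU_bound by (auto intro!: continuous_intros)
  then obtain M1 where M1: "decaying \<kappa> (\<lambda>x. z' * (of_real x * dU x)) M1"
    using decay_operator_mult[of \<kappa> z'] unfolding decay_operator_def by blast
  have "decaying \<kappa> (\<lambda>x. h x + z' * (of_real x * dU x)) (\<bar>K\<bar> * C + M1)"
    by (rule decaying_linear(1)[OF decaying_scaled[OF assms] M1])
  then show ?thesis using decay_operator_mult[of \<kappa> z] unfolding decay_operator_def by blast
qed

lemmas has_vector_derivative_cmult = bounded_linear.has_vector_derivative[OF bounded_linear_mult_right]

text \<open>With \<open>u\<close>, \<open>w = cnj u\<close> and \<open>X = x\<close> as independent
  unknowns, and \<open>d\<close>, \<open>e\<close> given by the profile equation, the claim is a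
  polynomial identity modulo the first integral and the normalization of \<open>n\<close>.\<close>

lemma thirring_dw_eq:
  assumes "g = 0" "\<mu>\<^sup>2 = 1 - \<omega>\<^sup>2"
  shows "dirac_eq \<alpha>p \<beta>p thirring_dw (\<lambda>x. - U x)"
  unfolding dirac_eq_def
proof
  fix x
  define u w d e X where "u = U x" and "w = cnj u" and "d = dU x" and "e = cnj d" and "X = complex_of_real x"
  define n where "n = complex_of_real (- 1 / (2 * \<mu>\<^sup>2))"
  define W where "W = complex_of_real \<omega>"
  have n: "2 * n * (1 - W\<^sup>2) = - 1"
  proof -
    have "2 * (- 1 / (2 * \<mu>\<^sup>2)) * \<mu>\<^sup>2 = - 1" using mu by simp
    then have "complex_of_real (2 * (- 1 / (2 * \<mu>\<^sup>2)) * (1 - \<omega>\<^sup>2)) = of_real (- 1)" unfolding assms(2) by (rule arg_cong)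
    then show ?thesis by (simp only: n_def W_def of_real_mult of_real_diff of_real_power of_real_1 of_real_minus of_real_numeral)
  qed
  have d: "d = - \<i> * (W * u - w + u * w * u)" and e: "e = \<i> * (W * w - u + w * u * w)"
    unfolding d_def e_def dU_def u_def w_def W_def by (simp_all add: assms(1))
  have "4 * W * (u * w) + 2 * (u * w)\<^sup>2 + of_real g * (u ^ 4 + w ^ 4) = 2 * (u\<^sup>2 + w\<^sup>2)"
    using complex_first_integral[of x] by (simp only: u_def w_def W_def of_real_mult of_real_numeral)
  then have fi: "2 * W * (u * w) + (u * w)\<^sup>2 = u\<^sup>2 + w\<^sup>2" unfolding assms(1) of_real_0 by algebra
  have i: "\<i> * \<i> = - 1" by simp
  have deriv: "(thirring_dw has_vector_derivative n * (2 * W * d + 2 * W * (d + X * (- \<i> * (W * d - e + (2 * u * w * d + u\<^sup>2 * e))))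
      + \<i> * (- \<i> * (W * d - e + (2 * u * w * d + u\<^sup>2 * e))))) (at x)"
    unfolding thirring_dw_def[abs_def]
    by (rule has_vector_derivative_eq_rhs[OF has_vector_derivative_cmult[OF has_vector_derivative_add[OF has_vector_derivative_add[OF
            has_vector_derivative_cmult[OF U_deriv'] has_vector_derivative_cmult[OF xdU_deriv]] has_vector_derivative_cmult[OF dU_deriv]]]])
       (simp add: assms(1) n_def W_def u_def w_def d_def e_def X_def)
  have val: "thirring_dw x = n * (2 * W * u + 2 * W * (X * d) + \<i> * d)" "cnj (thirring_dw x) = n * (2 * W * w + 2 * W * (X * e) - \<i> * e)"
    by (simp_all add: thirring_dw_def n_def W_def u_def w_def d_def e_def X_def)
  have \<alpha>: "complex_of_real (\<alpha>p x) = W + 2 * (u * w)" "\<beta>p x = - 1 + u\<^sup>2"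
    unfolding alpha_p_eq \<beta>p_def W_def u_def w_def by (simp_all add: assms(1))
  show "(thirring_dw has_vector_derivative \<i> * (- U x - \<alpha>p x * thirring_dw x - \<beta>p x * cnj (thirring_dw x))) (at x)"
  proof (rule has_vector_derivative_eq_rhs[OF deriv])
    have "n * (2 * W * d + 2 * W * (d + X * (- \<i> * (W * d - e + (2 * u * w * d + u\<^sup>2 * e))))
      + \<i> * (- \<i> * (W * d - e + (2 * u * w * d + u\<^sup>2 * e)))) = \<i> * (- u - (W + 2 * (u * w)) * D - (- 1 + u\<^sup>2) * E)"
      if "D = n * (2 * W * u + 2 * W * (X * d) + \<i> * d)" "E = n * (2 * W * w + 2 * W * (X * e) - \<i> * e)" for D E
      unfolding that using n d e fi i by algebra
    from this[OF val] show "n * (2 * W * d + 2 * W * (d + X * (- \<i> * (W * d - e + (2 * u * w * d + u\<^sup>2 * e))))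
      + \<i> * (- \<i> * (W * d - e + (2 * u * w * d + u\<^sup>2 * e)))) = \<i> * (- U x - \<alpha>p x * thirring_dw x - \<beta>p x * cnj (thirring_dw x))"
      by (simp only: \<alpha> u_def)
  qed
qed

lemma gross_neveu_dw_eq:
  assumes "g = 1" "\<mu>\<^sup>2 = 1 - \<omega>\<^sup>2" "\<omega> \<noteq> 0"
  shows "dirac_eq \<alpha>p \<beta>p gross_neveu_dw (\<lambda>x. - U x)"
  unfolding dirac_eq_def
proof
  fix x
  define u w d e X where "u = U x" and "w = cnj u" and "d = dU x" and "e = cnj d" and "X = complex_of_real x"
  define n where "n = complex_of_real (- 1 / (2 * \<omega> * \<mu>\<^sup>2))"
  define W where "W = complex_of_real \<omega>"
  have n: "2 * n * W * (1 - W\<^sup>2) = - 1"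
  proof -
    have "2 * (- 1 / (2 * \<omega> * \<mu>\<^sup>2)) * \<omega> * \<mu>\<^sup>2 = - 1" using mu assms(3) by simp
    then have "complex_of_real (2 * (- 1 / (2 * \<omega> * \<mu>\<^sup>2)) * \<omega> * (1 - \<omega>\<^sup>2)) = of_real (- 1)" unfolding assms(2) by (rule arg_cong)
    then show ?thesis by (simp only: n_def W_def of_real_mult of_real_diff of_real_power of_real_1 of_real_minus of_real_numeral)
  qed
  have d: "d = - \<i> * (W * u - w + u * w * u + w ^ 3)" and e: "e = \<i> * (W * w - u + w * u * w + u ^ 3)"
    unfolding d_def e_def dU_def u_def w_def W_def by (simp_all add: assms(1))
  have "4 * W * (u * w) + 2 * (u * w)\<^sup>2 + of_real g * (u ^ 4 + w ^ 4) = 2 * (u\<^sup>2 + w\<^sup>2)"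
    using complex_first_integral[of x] by (simp only: u_def w_def W_def of_real_mult of_real_numeral)
  then have fi: "4 * W * (u * w) + (u\<^sup>2 + w\<^sup>2)\<^sup>2 = 2 * (u\<^sup>2 + w\<^sup>2)" unfolding assms(1) of_real_1 by algebra
  have i: "\<i> * \<i> = - 1" by simp
  have cu: "((\<lambda>x. U x ^ 3) has_vector_derivative 3 * u\<^sup>2 * d) (at x)"
    unfolding power3_eq_cube
    by (rule has_vector_derivative_eq_rhs[OF has_vector_derivative_mult[OF has_vector_derivative_mult[OF U_deriv' U_deriv'] U_deriv']])
       (simp add: u_def d_def power2_eq_square algebra_simps)
  have cw: "((\<lambda>x. U x * cnj (U x) ^ 2) has_vector_derivative u * (2 * w * e) + d * w\<^sup>2) (at x)"
    unfolding power2_eq_square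
    by (rule has_vector_derivative_eq_rhs[OF has_vector_derivative_mult[OF U_deriv'
            has_vector_derivative_mult[OF has_vector_derivative_cnj[OF U_deriv'] has_vector_derivative_cnj[OF U_deriv']]]])
       (simp add: u_def d_def w_def e_def algebra_simps)
  have deriv: "(gross_neveu_dw has_vector_derivative n * ((W\<^sup>2 + 2) * d
      + 2 * W\<^sup>2 * (d + X * (- \<i> * (W * d - e + (2 * u * w * d + u\<^sup>2 * e) + 3 * w\<^sup>2 * e)))
      - W * e - 3 * u\<^sup>2 * d - (u * (2 * w * e) + d * w\<^sup>2))) (at x)"
    unfolding gross_neveu_dw_def[abs_def]
    by (rule has_vector_derivative_eq_rhs[OF has_vector_derivative_cmult[OF has_vector_derivative_diff[OF has_vector_derivative_diff[OF
            has_vector_derivative_diff[OF has_vector_derivative_add[OF has_vector_derivative_cmult[OF U_deriv'] has_vector_derivative_cmult[OF xdU_deriv]]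
            has_vector_derivative_cmult[OF has_vector_derivative_cnj[OF U_deriv']]] cu] cw]]])
       (simp add: assms(1) n_def W_def u_def w_def d_def e_def X_def)
  have val: "gross_neveu_dw x = n * ((W\<^sup>2 + 2) * u + 2 * W\<^sup>2 * (X * d) - W * w - u ^ 3 - u * w\<^sup>2)"
    "cnj (gross_neveu_dw x) = n * ((W\<^sup>2 + 2) * w + 2 * W\<^sup>2 * (X * e) - W * u - w ^ 3 - w * u\<^sup>2)"
    by (simp_all add: gross_neveu_dw_def n_def W_def u_def w_def d_def e_def X_def)
  have \<alpha>: "complex_of_real (\<alpha>p x) = W + 2 * (u * w)" "\<beta>p x = - 1 + u\<^sup>2 + 3 * w\<^sup>2"
    unfolding alpha_p_eq \<beta>p_def W_def u_def w_def by (simp_all add: assms(1))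
  show "(gross_neveu_dw has_vector_derivative \<i> * (- U x - \<alpha>p x * gross_neveu_dw x - \<beta>p x * cnj (gross_neveu_dw x))) (at x)"
  proof (rule has_vector_derivative_eq_rhs[OF deriv])
    have "n * ((W\<^sup>2 + 2) * d
      + 2 * W\<^sup>2 * (d + X * (- \<i> * (W * d - e + (2 * u * w * d + u\<^sup>2 * e) + 3 * w\<^sup>2 * e)))
      - W * e - 3 * u\<^sup>2 * d - (u * (2 * w * e) + d * w\<^sup>2))
      = \<i> * (- u - (W + 2 * (u * w)) * D - (- 1 + u\<^sup>2 + 3 * w\<^sup>2) * E)"
      if "D = n * ((W\<^sup>2 + 2) * u + 2 * W\<^sup>2 * (X * d) - W * w - u ^ 3 - u * w\<^sup>2)"
        "E = n * ((W\<^sup>2 + 2) * w + 2 * W\<^sup>2 * (X * e) - W * u - w ^ 3 - w * u\<^sup>2)" for D E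
      unfolding that using n d e fi i by algebra
    from this[OF val] show "n * ((W\<^sup>2 + 2) * d
      + 2 * W\<^sup>2 * (d + X * (- \<i> * (W * d - e + (2 * u * w * d + u\<^sup>2 * e) + 3 * w\<^sup>2 * e)))
      - W * e - 3 * u\<^sup>2 * d - (u * (2 * w * e) + d * w\<^sup>2))
      = \<i> * (- U x - \<alpha>p x * gross_neveu_dw x - \<beta>p x * cnj (gross_neveu_dw x))"
      by (simp only: \<alpha> u_def)
  qed
qed

lemma ImU2_integral:
  shows "integrable lborel (\<lambda>x. 2 * Im (U x * dU x))" and "(LINT x|lborel. 2 * Im (U x * dU x)) = 0"
proof -
  have b: "\<bar>2 * Im (U x * dU x)\<bar> \<le> (2 * C * B) * norm (U x)" for x
  proof -
    have "\<bar>Im (U x * dU x)\<bar> \<le> norm (U x) * norm (dU x)"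
      using abs_Im_le_cmod[of "U x * dU x"] by (simp only: norm_mult)
    also have "\<dots> \<le> C * (B * norm (U x))" using C_pos by (intro mult_mono U_bound dU_norm) auto
    finally show ?thesis by (simp add: abs_mult)
  qed
  have cont: "continuous_on UNIV (\<lambda>x. 2 * Im (U x * dU x))" by (intro continuous_intros)
  show int: "integrable lborel (\<lambda>x. 2 * Im (U x * dU x))" by (rule integrable_scaled[OF cont b])
  have d: "((\<lambda>x. Im (U x * U x)) has_real_derivative 2 * Im (U x * dU x)) (at x)" for x
    using bounded_linear.has_vector_derivative[OF bounded_linear_Im has_vector_derivative_mult[OF U_deriv' U_deriv'], of x]
    by (simp add: has_real_derivative_iff_has_vector_derivative algebra_simps)
  have lim: "\<bar>Im (U x * U x)\<bar> \<le> (C * C) * exp (- \<kappa> * \<bar>x\<bar>)" for x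
  proof -
    have "\<bar>Im (U x * U x)\<bar> \<le> norm (U x) * norm (U x)"
      using abs_Im_le_cmod[of "U x * U x"] by (simp only: norm_mult)
    also have "\<dots> \<le> C * (C * exp (- \<kappa> * \<bar>x\<bar>))" using C_pos by (intro mult_mono U_bound U_kappa) auto
    finally show ?thesis by simp
  qed
  show "(LINT x|lborel. 2 * Im (U x * dU x)) = 0"
    using integral_derivative[OF d cont int exp_decay_tendsto[OF _ lim]] mu by simp
qed

lemma norm2_integrable: "integrable lborel (\<lambda>x. (norm (U x))\<^sup>2)"
proof (rule integrable_scaled)
  show "\<bar>(norm (U x))\<^sup>2\<bar> \<le> C * norm (U x)" for x
    using mult_right_mono[OF U_bound[of x] norm_ge_zero[of "U x"]] by (simp add: power2_eq_square)
qed (intro continuous_intros)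

text \<open>Up to a multiple of the derivative of \<open>x * |U|^2\<close>, the density
  \<open>Re (dw cnj U)\<close> is a negative multiple of \<open>Re (U^2)\<close>. The slope
  condition on the charge thus follows from the same positivity that controls the translation
  coefficient.\<close>

lemma thirring_variation:
  assumes "g = 0" "\<mu>\<^sup>2 = 1 - \<omega>\<^sup>2" and pos: "0 < (LINT x|lborel. Re ((U x)\<^sup>2))"
  shows "\<exists>dw M. soliton_variation U \<omega> \<mu> g c C k dw M"
proof -
  define n where "n = - 1 / (2 * \<mu>\<^sup>2)"
  have n: "n < 0" using mu by (simp add: n_def)
  have "\<exists>M. decaying \<kappa> (\<lambda>x. of_real n * ((2 * \<omega> * U x + \<i> * dU x) + (2 * \<omega>) * (of_real x * dU x))) M"
  proof (rule decaying_combination)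
    show "norm (2 * \<omega> * U x + \<i> * dU x) \<le> (\<bar>2 * \<omega>\<bar> + B) * norm (U x)" for x
    proof -
      have "norm (2 * \<omega> * U x + \<i> * dU x) \<le> \<bar>2 * \<omega>\<bar> * norm (U x) + norm (dU x)"
        by (rule order_trans[OF norm_triangle_ineq]) (simp add: norm_mult)
      then show ?thesis using dU_norm[of x] by (simp add: distrib_right)
    qed
  qed (intro continuous_intros)
  moreover have "thirring_dw = (\<lambda>x. of_real n * ((2 * \<omega> * U x + \<i> * dU x) + (2 * \<omega>) * (of_real x * dU x)))"
    by (auto simp: thirring_dw_def n_def algebra_simps)
  ultimately obtain M where M: "decaying \<kappa> thirring_dw M" by auto
  have "real_pairing thirring_dw U = n * (LINT x|lborel. Re ((U x)\<^sup>2))"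
  proof -
    have "Re (thirring_dw x * cnj (U x)) = n * (\<omega> * ((norm (U x))\<^sup>2 + x * (2 * Re (U x * cnj (dU x)))) + Re ((U x)\<^sup>2))" for x
    proof -
      have 1: "thirring_dw x * cnj (U x) = of_real n * (of_real (2 * \<omega>) * (U x * cnj (U x)) + of_real (2 * \<omega> * x) * cnj (U x * cnj (dU x)) + cnj (- (\<i> * U x * cnj (dU x))))"
        by (simp add: thirring_dw_def n_def algebra_simps)
      have "Re (of_real n * (of_real p * of_real a + of_real q * cnj y + cnj (- z))) = n * (p * a + q * Re y - Re z)" for p a q y z
        by simp
      then have "Re (thirring_dw x * cnj (U x)) = n * (2 * \<omega> * (norm (U x))\<^sup>2 + 2 * \<omega> * x * Re (U x * cnj (dU x)) - Re (\<i> * U x * cnj (dU x)))"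
        unfolding 1 complex_norm_square[symmetric] .
      moreover have "y = n * (w * (a + x * (2 * r)) + R)"
        if "y = n * (2 * w * a + 2 * w * x * r - (R - w * a - f - g * h))" "2 * w * a + f + g * h = 2 * R"
        for y w a r R f h :: real
        using that by algebra
      ultimately show ?thesis unfolding current using first_integral[of x] by blast
    qed
    then show ?thesis
      unfolding real_pairing_def using x_norm2_integral ReU2_integrable by simp
  qed
  then have neg: "real_pairing thirring_dw U < 0" using n pos by (simp add: mult_neg_pos)
  have "soliton_variation U \<omega> \<mu> g c C k thirring_dw M"
    by (intro soliton_variation.intro soliton_profile_axioms soliton_variation_axioms.intro
         thirring_dw_eq assms M neg) (simp add: thirring_dw_def U_sym dU_sym)
  then show ?thesis by blast
qed

text \<open>The density \<open>Re (dw cnj U)\<close> is a negative multiple of \<open>|U|^2\<close>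
  plus multiples of the derivatives of \<open>x * |U|^2\<close> and \<open>Im (U^2)\<close>, which
  integrate to zero.\<close>

lemma gross_neveu_variation:
  assumes "g = 1" "\<mu>\<^sup>2 = 1 - \<omega>\<^sup>2" "\<omega> > 0"
  shows "\<exists>dw M. soliton_variation U \<omega> \<mu> g c C k dw M"
proof -
  define n where "n = - 1 / (2 * \<omega> * \<mu>\<^sup>2)"
  have n: "n < 0" using mu assms(3) by (simp add: n_def)
  define h where "h x = (\<omega>\<^sup>2 + 2) * U x - \<omega> * cnj (U x) - U x ^ 3 - U x * cnj (U x) ^ 2" for x
  have "\<exists>M. decaying \<kappa> (\<lambda>x. of_real n * (h x + (2 * \<omega>\<^sup>2) * (of_real x * dU x))) M"
  proof (rule decaying_combination)
    show "norm (h x) \<le> (\<omega>\<^sup>2 + 2 + \<bar>\<omega>\<bar> + 2 * C\<^sup>2) * norm (U x)" for x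
    proof -
      have "norm (h x) \<le> norm ((\<omega>\<^sup>2 + 2) * U x) + norm (\<omega> * cnj (U x)) + norm (U x ^ 3) + norm (U x * cnj (U x) ^ 2)"
        unfolding h_def by (intro order_trans[OF norm_triangle_ineq4] add_mono order_refl)
      also have "norm ((\<omega>\<^sup>2 + 2) * U x) = (\<omega>\<^sup>2 + 2) * norm (U x)"
        unfolding norm_mult norm_of_real by simp
      also have "norm (\<omega> * cnj (U x)) = \<bar>\<omega>\<bar> * norm (U x)" by (simp add: norm_mult)
      also have "norm (U x ^ 3) = (norm (U x))\<^sup>2 * norm (U x)"
        by (simp add: norm_mult power2_eq_square power3_eq_cube)
      also have "norm (U x * cnj (U x) ^ 2) = (norm (U x))\<^sup>2 * norm (U x)" by (simp add: norm_power norm_mult power2_eq_square)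
      also have "(\<omega>\<^sup>2 + 2) * norm (U x) + \<bar>\<omega>\<bar> * norm (U x) + (norm (U x))\<^sup>2 * norm (U x) + (norm (U x))\<^sup>2 * norm (U x)
          \<le> (\<omega>\<^sup>2 + 2) * norm (U x) + \<bar>\<omega>\<bar> * norm (U x) + C\<^sup>2 * norm (U x) + C\<^sup>2 * norm (U x)"
        by (intro add_mono mult_right_mono power_mono U_bound order_refl) auto
      finally show ?thesis by (simp add: algebra_simps)
    qed
    show "continuous_on UNIV h" unfolding h_def by (intro continuous_intros)
  qed
  moreover have "gross_neveu_dw = (\<lambda>x. of_real n * (h x + (2 * \<omega>\<^sup>2) * (of_real x * dU x)))"
    by (auto simp: gross_neveu_dw_def n_def h_def algebra_simps)
  ultimately obtain M where M: "decaying \<kappa> gross_neveu_dw M" by auto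
  have "real_pairing gross_neveu_dw U = n * (LINT x|lborel. (norm (U x))\<^sup>2)"
  proof -
    have "Re (gross_neveu_dw x * cnj (U x)) = n * ((norm (U x))\<^sup>2
       + \<omega>\<^sup>2 * ((norm (U x))\<^sup>2 + x * (2 * Re (U x * cnj (dU x)))) + (2 * Im (U x * dU x)) / 2)" for x
    proof -
      define A R where "A = (norm (U x))\<^sup>2" and "R = Re ((U x)\<^sup>2)"
      have UU: "U x * cnj (U x) = of_real A" unfolding A_def by (rule complex_norm_square[symmetric])
      have 1: "gross_neveu_dw x * cnj (U x) = of_real n * (of_real (\<omega>\<^sup>2 + 2) * (U x * cnj (U x)) + of_real (2 * \<omega>\<^sup>2 * x) * cnj (U x * cnj (dU x))
          - of_real \<omega> * cnj ((U x)\<^sup>2) - (U x * cnj (U x)) * ((U x)\<^sup>2 + cnj ((U x)\<^sup>2)))"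
        by (simp add: gross_neveu_dw_def n_def algebra_simps power2_eq_square power3_eq_cube)
      have "Re (of_real n * (of_real p * of_real a + of_real q * cnj y - of_real w * cnj z - of_real a * (z + cnj z)))
          = n * (p * a + q * Re y - w * Re z - 2 * a * Re z)" for p a q w y z
        by (simp add: algebra_simps)
      then have "Re (gross_neveu_dw x * cnj (U x)) = n * ((\<omega>\<^sup>2 + 2) * A + 2 * \<omega>\<^sup>2 * x * Re (U x * cnj (dU x)) - \<omega> * R - 2 * A * R)"
        unfolding 1 UU R_def .
      moreover have "Im (U x * dU x) = A - \<omega> * R - 2 * A * R"
      proof -
        have "U x * dU x = - \<i> * (of_real \<omega> * (U x)\<^sup>2 - of_real A + of_real A * ((U x)\<^sup>2 + cnj ((U x)\<^sup>2)))"
          unfolding UU[symmetric] dU_def by (simp add: assms(1) algebra_simps power2_eq_square power3_eq_cube)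
        moreover have "Im (- \<i> * (of_real w * z - of_real a + of_real a * (z + cnj z))) = a - w * Re z - 2 * a * Re z" for w a z
          by (simp add: algebra_simps)
        ultimately show ?thesis unfolding R_def by (simp only:)
      qed
      moreover have "y = n * (a + w\<^sup>2 * (a + x * (2 * r)) + (2 * i) / 2)"
        if "y = n * ((w\<^sup>2 + 2) * a + 2 * w\<^sup>2 * x * r - w * R - 2 * a * R)" "i = a - w * R - 2 * a * R"
        for y w a r R i :: real
        unfolding that by (simp add: field_simps)
      ultimately show ?thesis unfolding A_def[symmetric] by blast
    qed
    then show ?thesis
      unfolding real_pairing_def using x_norm2_integral norm2_integrable ImU2_integral by simp
  qed
  moreover have "(LINT x|lborel. (norm (U x))\<^sup>2) > 0"
    by (rule integral_pos[OF norm2_integrable]) (simp add: U_nonzero)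
  ultimately have neg: "real_pairing gross_neveu_dw U < 0" using n by (simp add: mult_neg_pos)
  \<comment> \<open>Here the integrand is positive at every point, because
    \<open>Re (U^2) - (Re (U^2))^2 = \<omega> |U|^2 > 0\<close>.\<close>
  have pos: "0 < (LINT x|lborel. Re ((U x)\<^sup>2))"
  proof (rule integral_pos[OF ReU2_integrable])
    fix x
    have "0 < \<omega> * (norm (U x))\<^sup>2" using assms(3) U_nonzero by simp
    then have "(Re ((U x)\<^sup>2))\<^sup>2 < Re ((U x)\<^sup>2)" using gross_neveu_first_integral[OF assms(1), of x] by linarith
    then show "0 < Re ((U x)\<^sup>2)" using zero_le_power2[of "Re ((U x)\<^sup>2)"] by linarith
  qed
  have sym: "gross_neveu_dw (- x) = cnj (gross_neveu_dw x)" for x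
    by (simp add: gross_neveu_dw_def U_sym dU_sym)
  have "soliton_variation U \<omega> \<mu> g c C k gross_neveu_dw M"
    using assms by (intro soliton_variation.intro soliton_profile_axioms soliton_variation_axioms.intro
         gross_neveu_dw_eq M neg pos sym) simp_all
  then show ?thesis by blast
qed

end

section \<open>Decay rates of the explicit solitons\<close>

lemma cosh_exp_bounds:
  fixes \<mu> x :: real
  defines "E \<equiv> exp (- \<mu> * \<bar>x\<bar>)"
  assumes "\<mu> > 0"
  shows "1 / (2 * E\<^sup>2) \<le> cosh (2 * \<mu> * x)" "cosh (2 * \<mu> * x) \<le> 1 / E\<^sup>2" "E > 0"
proof -
  have "exp \<bar>2 * \<mu> * x\<bar> = 1 / E\<^sup>2"
    using assms(2) by (simp add: E_def exp_minus abs_mult power2_eq_square flip: exp_add inverse_eq_divide)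
  then show "1 / (2 * E\<^sup>2) \<le> cosh (2 * \<mu> * x)" "cosh (2 * \<mu> * x) \<le> 1 / E\<^sup>2"
    using half_cosh_bounds[of "2 * \<mu> * x"] by simp_all
qed (simp add: E_def)

lemma thirring_profile:
  assumes omega: "\<bar>\<omega>\<bar> < 1"
  shows "\<exists>c C k. soliton_profile (soliton Thirring \<omega>) \<omega> (soliton_mu \<omega>) 0 c C k"
proof -
  let ?U = "soliton Thirring \<omega>" and ?m = "soliton_mu \<omega>"
  note mp = mu_pos[OF omega]
  have A: "(norm (?U x))\<^sup>2 = 2 * ?m\<^sup>2 / (\<omega> + cosh (2 * ?m * x))" for x
  proof -
    let ?N = "soliton_numerator \<omega> x"
    have "complex_of_real ((norm ?N)\<^sup>2) = of_real (\<omega> + cosh (2 * ?m * x))"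
      using numerator_squares(1)[OF omega, of x] complex_norm_square[of ?N] by simp
    then have "(norm ?N)\<^sup>2 = \<omega> + cosh (2 * ?m * x)" by (simp only: of_real_eq_iff)
    then show ?thesis
      unfolding thirring_quotient[OF omega] by (simp add: norm_mult norm_inverse power_mult_distrib power_inverse divide_inverse)
  qed
  \<comment> \<open>From \<open>\<omega> + cosh y \<ge> (1 - \<bar>\<omega>\<bar>) cosh y\<close>
    and \<open>cosh y \<ge> exp \<bar>y\<bar> / 2\<close> with \<open>y = 2 \<mu> x\<close>.\<close>
  define C where "C = sqrt (4 * ?m\<^sup>2 / (1 - \<bar>\<omega>\<bar>))"
  have "soliton_profile ?U \<omega> ?m 0 ?m C (min (1 - \<omega>) ?m)"
  proof
    fix x
    define E where "E = exp (- ?m * \<bar>x\<bar>)"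
    note ch = cosh_exp_bounds[OF mp, of x, folded E_def]
    have ch1: "cosh (2 * ?m * x) \<ge> 1" by (rule cosh_real_ge_1)
    have den: "\<omega> + cosh (2 * ?m * x) \<le> 2 / E\<^sup>2" "(1 - \<bar>\<omega>\<bar>) / (2 * E\<^sup>2) \<le> \<omega> + cosh (2 * ?m * x)" "\<omega> + cosh (2 * ?m * x) > 0"
    proof -
      show "\<omega> + cosh (2 * ?m * x) \<le> 2 / E\<^sup>2" using ch ch1 omega by (simp add: abs_less_iff)
      have "(1 - \<bar>\<omega>\<bar>) * (1 / (2 * E\<^sup>2)) \<le> (1 - \<bar>\<omega>\<bar>) * cosh (2 * ?m * x)" using ch omega by (intro mult_left_mono) auto
      also have "\<dots> \<le> \<omega> + cosh (2 * ?m * x)"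
      proof -
        have "\<bar>\<omega>\<bar> * 1 \<le> \<bar>\<omega>\<bar> * cosh (2 * ?m * x)" using ch1 by (intro mult_left_mono) auto
        then show ?thesis by (simp add: algebra_simps)
      qed
      finally show "(1 - \<bar>\<omega>\<bar>) / (2 * E\<^sup>2) \<le> \<omega> + cosh (2 * ?m * x)" by simp
      show "\<omega> + cosh (2 * ?m * x) > 0" using ch1 omega by linarith
    qed
    have E2: "E\<^sup>2 > 0" using ch(3) by simp
    have "(?m * E)\<^sup>2 \<le> (norm (?U x))\<^sup>2"
    proof -
      have "(?m * E)\<^sup>2 = 2 * ?m\<^sup>2 / (2 / E\<^sup>2)" using E2 by (simp add: power_mult_distrib)
      also have "\<dots> \<le> 2 * ?m\<^sup>2 / (\<omega> + cosh (2 * ?m * x))" using den E2 by (intro divide_left_mono) auto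
      finally show ?thesis unfolding A .
    qed
    then show "?m * exp (- ?m * \<bar>x\<bar>) \<le> norm (?U x)" unfolding E_def[symmetric] by (rule power2_le_imp_le) simp
    have "(norm (?U x))\<^sup>2 \<le> (C * E)\<^sup>2"
    proof -
      have "2 * ?m\<^sup>2 / (\<omega> + cosh (2 * ?m * x)) \<le> 2 * ?m\<^sup>2 / ((1 - \<bar>\<omega>\<bar>) / (2 * E\<^sup>2))"
        using den E2 omega by (intro divide_left_mono) auto
      also have "\<dots> = (C * E)\<^sup>2" using omega by (simp add: C_def power_mult_distrib)
      finally show ?thesis unfolding A .
    qed
    then show "norm (?U x) \<le> C * exp (- ?m * \<bar>x\<bar>)" unfolding E_def[symmetric]
      by (rule power2_le_imp_le) (use ch(3) omega in \<open>simp add: C_def\<close>)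
    show "(?U has_vector_derivative
        - \<i> * (\<omega> * ?U x - cnj (?U x) + ?U x * cnj (?U x) * ?U x + of_real 0 * cnj (?U x) ^ 3)) (at x)"
      by (rule thirring_deriv[OF omega])
    show "?U (- x) = cnj (?U x)" by (simp add: numerator_reflect[OF omega])
    have nz: "?U x \<noteq> 0" using A[of x] den(3) mp by auto
    have "complex_of_real (2 * \<omega> * (norm (?U x))\<^sup>2 + ((norm (?U x))\<^sup>2)\<^sup>2) = of_real (2 * Re ((?U x)\<^sup>2))"
      using thirring_deriv(2)[OF omega, of x] twice_of_real_Re[of "(?U x)\<^sup>2"]
      by (simp only: of_real_add of_real_mult of_real_power[of "(norm (?U x))\<^sup>2" 2] complex_norm_square of_real_numeral complex_cnj_power)
    then have "2 * \<omega> * (norm (?U x))\<^sup>2 + ((norm (?U x))\<^sup>2)\<^sup>2 = 2 * Re ((?U x)\<^sup>2)" by (simp only: of_real_eq_iff)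
    then have first: "2 * \<omega> * (norm (?U x))\<^sup>2 + norm (?U x) ^ 4 = 2 * Re ((?U x)\<^sup>2)" by simp
    then show "2 * \<omega> * (norm (?U x))\<^sup>2 + norm (?U x) ^ 4 + 0 * Re (?U x ^ 4) = 2 * Re ((?U x)\<^sup>2)" by simp
    show "min (1 - \<omega>) ?m * norm (?U x) \<le> norm (\<omega> * ?U x - cnj (?U x) + ?U x * cnj (?U x) * ?U x + of_real 0 * cnj (?U x) ^ 3)"
      using thirring_nondegenerate[OF omega first nz] by (simp add: soliton_mu_def del: soliton.simps)
  qed (use mp omega in auto)
  then show ?thesis by blast
qed

lemma gross_neveu_profile:
  assumes omega: "0 < \<omega>" "\<omega> < 1"
  shows "\<exists>c C k. soliton_profile (soliton Gross_Neveu \<omega>) \<omega> (soliton_mu \<omega>) 1 c C k"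
proof -
  have omega': "\<bar>\<omega>\<bar> < 1" using omega by simp
  let ?U = "soliton Gross_Neveu \<omega>" and ?m = "soliton_mu \<omega>"
  note mp = mu_pos[OF omega']
  have A: "(norm (?U x))\<^sup>2 = ?m\<^sup>2 * (\<omega> + cosh (2 * ?m * x)) / (1 + \<omega> * cosh (2 * ?m * x))\<^sup>2" for x
  proof -
    let ?N = "soliton_numerator \<omega> x"
    have "complex_of_real ((norm ?N)\<^sup>2) = of_real (\<omega> + cosh (2 * ?m * x))"
      using numerator_squares(1)[OF omega', of x] complex_norm_square[of ?N] by simp
    then have N: "(norm ?N)\<^sup>2 = \<omega> + cosh (2 * ?m * x)" by (simp only: of_real_eq_iff)
    show ?thesis unfolding soliton.simps norm_mult norm_divide norm_of_real power_mult_distrib power_divide N by simp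
  qed
  \<comment> \<open>The sum \<open>\<omega> + cosh\<close> is at most \<open>2 / E\<^sup>2\<close>
    and the denominator, before squaring, at least \<open>\<omega> / (2 * E\<^sup>2)\<close>;
    together this gives the 8.\<close>
  define C where "C = sqrt (8 * ?m\<^sup>2 / \<omega>\<^sup>2)"
  from gross_neveu_nondegenerate[OF omega]
  obtain k where k: "k > 0" "\<forall>u::complex. u \<noteq> 0 \<longrightarrow> 2 * \<omega> * (norm u)\<^sup>2 + norm u ^ 4 + Re (u ^ 4) = 2 * Re (u\<^sup>2) \<longrightarrow>
    k * norm u \<le> norm (\<omega> * u - cnj u + u * cnj u * u + cnj u ^ 3)"
    by (elim exE conjE) (rule that)
  have "soliton_profile ?U \<omega> ?m 1 (?m / 3) C k"
  proof
    fix x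
    define E where "E = exp (- ?m * \<bar>x\<bar>)"
    note ch = cosh_exp_bounds[OF mp, of x, folded E_def]
    define h where "h = cosh (2 * ?m * x)"
    have h1: "h \<ge> 1" unfolding h_def by (rule cosh_real_ge_1)
    have h: "1 / (2 * E\<^sup>2) \<le> h" "h \<le> 1 / E\<^sup>2" using ch by (simp_all add: h_def)
    have E2: "E\<^sup>2 > 0" using ch(3) by simp
    have den: "1 + \<omega> * h \<le> 2 / E\<^sup>2" "\<omega> / (2 * E\<^sup>2) \<le> 1 + \<omega> * h" "1 + \<omega> * h > 0"
    proof -
      have "\<omega> * h \<le> 1 * h" using h1 omega by (intro mult_right_mono) auto
      moreover have "2 / E\<^sup>2 = 1 / E\<^sup>2 + 1 / E\<^sup>2" by simp
      ultimately show "1 + \<omega> * h \<le> 2 / E\<^sup>2" using h(2) h1 by linarith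
      have "\<omega> * (1 / (2 * E\<^sup>2)) \<le> \<omega> * h" using h omega by (intro mult_left_mono) auto
      moreover have "\<omega> * (1 / (2 * E\<^sup>2)) = \<omega> / (2 * E\<^sup>2)" by simp
      ultimately show "\<omega> / (2 * E\<^sup>2) \<le> 1 + \<omega> * h" by linarith
      show "1 + \<omega> * h > 0" using h1 omega by (simp add: add_pos_nonneg)
    qed
    \<comment> \<open>The estimates yield \<open>\<mu>\<^sup>2 * E\<^sup>2 / 8\<close>; weakening 8
      to 9 makes it a perfect square.\<close>
    have "(?m / 3 * E)\<^sup>2 \<le> (norm (?U x))\<^sup>2"
    proof -
      have "(?m / 3 * E)\<^sup>2 \<le> ?m\<^sup>2 * (1 / (2 * E\<^sup>2)) / (2 / E\<^sup>2)\<^sup>2"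
      proof -
        have "?m\<^sup>2 * (1 / (2 * E\<^sup>2)) / (2 / E\<^sup>2)\<^sup>2 = ?m\<^sup>2 * E\<^sup>2 / 8"
          using ch(3) by (simp add: field_simps power2_eq_square)
        moreover have "(?m / 3 * E)\<^sup>2 = ?m\<^sup>2 * E\<^sup>2 / 9" by (simp add: power_mult_distrib power_divide)
        moreover have "0 \<le> ?m\<^sup>2 * E\<^sup>2" by simp
        ultimately show ?thesis by linarith
      qed
      also have "\<dots> \<le> ?m\<^sup>2 * (\<omega> + h) / (1 + \<omega> * h)\<^sup>2"
        using den h E2 omega h1 by (intro frac_le mult_left_mono power_mono) auto
      finally show ?thesis unfolding A h_def .
    qed
    then show "?m / 3 * exp (- ?m * \<bar>x\<bar>) \<le> norm (?U x)" unfolding E_def[symmetric] by (rule power2_le_imp_le) simp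
    have "(norm (?U x))\<^sup>2 \<le> (C * E)\<^sup>2"
    proof -
      have "?m\<^sup>2 * (\<omega> + h) / (1 + \<omega> * h)\<^sup>2 \<le> ?m\<^sup>2 * (2 / E\<^sup>2) / (\<omega> / (2 * E\<^sup>2))\<^sup>2"
        using den h E2 omega h1 by (intro frac_le mult_left_mono power_mono) auto
      also have "\<dots> = (C * E)\<^sup>2" using omega E2 by (simp add: C_def power_mult_distrib power_divide field_simps power2_eq_square)
      finally show ?thesis unfolding A h_def .
    qed
    then show "norm (?U x) \<le> C * exp (- ?m * \<bar>x\<bar>)" unfolding E_def[symmetric]
      by (rule power2_le_imp_le) (use ch(3) omega in \<open>simp add: C_def\<close>)
    show "(?U has_vector_derivative
        - \<i> * (\<omega> * ?U x - cnj (?U x) + ?U x * cnj (?U x) * ?U x + of_real 1 * cnj (?U x) ^ 3)) (at x)"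
      by (rule gross_neveu_deriv[OF omega' omega(1)])
    show "?U (- x) = cnj (?U x)" by (simp add: numerator_reflect[OF omega'])
    have nz: "?U x \<noteq> 0" using A[of x] den(3) mp h1 omega unfolding h_def[symmetric] by auto
    have "complex_of_real (2 * (2 * \<omega> * (norm (?U x))\<^sup>2 + ((norm (?U x))\<^sup>2)\<^sup>2 + Re (?U x ^ 4))) = of_real (2 * (2 * Re ((?U x)\<^sup>2)))"
    proof -
      define a where "a = complex_of_real ((norm (?U x))\<^sup>2)"
      have a: "a = ?U x * cnj (?U x)" unfolding a_def by (rule complex_norm_square)
      have "2 * (2 * of_real \<omega> * a + a\<^sup>2) + 2 * of_real (Re (?U x ^ 4)) = 2 * (2 * of_real (Re ((?U x)\<^sup>2)))"
      proof -
        have "2 * (2 * W * (u * w) + (u * w)\<^sup>2) + (u ^ 4 + w ^ 4) = 2 * (u\<^sup>2 + w\<^sup>2)"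
          if "4 * W * (u * w) + 2 * (u * w)\<^sup>2 + (u ^ 4 + w ^ 4) = 2 * (u\<^sup>2 + w\<^sup>2)" for u w W :: complex
          using that by algebra
        from this[OF gross_neveu_deriv(2)[OF omega' omega(1), of x]] show ?thesis
          unfolding twice_of_real_Re a complex_cnj_power .
      qed
      then show ?thesis by (simp add: a_def algebra_simps del: soliton.simps)
    qed
    then have "2 * \<omega> * (norm (?U x))\<^sup>2 + ((norm (?U x))\<^sup>2)\<^sup>2 + Re (?U x ^ 4) = 2 * Re ((?U x)\<^sup>2)"
      unfolding of_real_eq_iff by (rule mult_left_cancel[THEN iffD1, rotated]) simp
    then have first: "2 * \<omega> * (norm (?U x))\<^sup>2 + norm (?U x) ^ 4 + Re (?U x ^ 4) = 2 * Re ((?U x)\<^sup>2)"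
      by (simp del: soliton.simps)
    then show "2 * \<omega> * (norm (?U x))\<^sup>2 + norm (?U x) ^ 4 + 1 * Re (?U x ^ 4) = 2 * Re ((?U x)\<^sup>2)" by (simp only: mult_1)
    show "k * norm (?U x) \<le> norm (\<omega> * ?U x - cnj (?U x) + ?U x * cnj (?U x) * ?U x + of_real 1 * cnj (?U x) ^ 3)"
      using k(2)[rule_format, OF nz first] by (simp only: of_real_1 mult_1)
  qed (use mp omega k(1) in auto)
  then show ?thesis by blast
qed

text \<open>For negative \<omega> the integrand changes sign, so positivity is read off an explicit
  primitive \<open>F\<close> with limits \<open>- \<mu>\<close> and \<mu> at the two ends; the
  integral is \<open>2 * \<mu>\<close>.\<close>

lemma thirring_ReU2_pos:
  assumes omega: "\<bar>\<omega>\<bar> < 1" and int: "integrable lborel (\<lambda>x. Re ((soliton Thirring \<omega> x)\<^sup>2))"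
  shows "0 < (LINT x|lborel. Re ((soliton Thirring \<omega> x)\<^sup>2))"
proof -
  let ?m = "soliton_mu \<omega>"
  note mp = mu_pos[OF omega]
  have den: "\<omega> + cosh y > 0" for y :: real using cosh_real_ge_1[of y] omega by linarith
  define f where "f x = 2 * ?m\<^sup>2 * (1 + \<omega> * cosh (2 * ?m * x)) / (\<omega> + cosh (2 * ?m * x))\<^sup>2" for x
  have f: "Re ((soliton Thirring \<omega> x)\<^sup>2) = f x" for x
  proof -
    have "(soliton Thirring \<omega> x)\<^sup>2 = of_real (2 * ?m\<^sup>2 / (\<omega> + cosh (2 * ?m * x))\<^sup>2) * (soliton_numerator \<omega> x)\<^sup>2"
      by (simp add: power_mult_distrib power_divide flip: of_real_power of_real_add)
    then have "Re ((soliton Thirring \<omega> x)\<^sup>2) = 2 * ?m\<^sup>2 / (\<omega> + cosh (2 * ?m * x))\<^sup>2 * Re ((soliton_numerator \<omega> x)\<^sup>2)"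
      by (simp only: Re_complex_of_real Im_complex_of_real times_complex.sel mult_zero_left diff_zero)
    then show ?thesis unfolding numerator_squares[OF omega] f_def by simp
  qed
  define F where "F x = ?m * (sinh (2 * ?m * x) / (\<omega> + cosh (2 * ?m * x)))" for x
  have F': "(F has_real_derivative f x) (at x)" for x
  proof -
    have "(F has_real_derivative ?m * ((cosh (2 * ?m * x) * (2 * ?m) * (\<omega> + cosh (2 * ?m * x)) - sinh (2 * ?m * x) * (sinh (2 * ?m * x) * (2 * ?m)))
        / ((\<omega> + cosh (2 * ?m * x)) * (\<omega> + cosh (2 * ?m * x))))) (at x)"
    proof -
      have s: "((\<lambda>x. sinh (2 * ?m * x)) has_real_derivative cosh (2 * ?m * x) * (2 * ?m)) (at x)"
        and c: "((\<lambda>x. \<omega> + cosh (2 * ?m * x)) has_real_derivative sinh (2 * ?m * x) * (2 * ?m)) (at x)"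
        by (auto intro!: derivative_eq_intros)
      have "\<omega> + cosh (2 * ?m * x) \<noteq> 0" using den[of "2 * ?m * x"] by simp
      from DERIV_cmult[OF DERIV_divide[OF s c this], of ?m] show ?thesis unfolding F_def .
    qed
    moreover have "cosh (2 * ?m * x) * (2 * ?m) * (\<omega> + cosh (2 * ?m * x)) - sinh (2 * ?m * x) * (sinh (2 * ?m * x) * (2 * ?m))
       = 2 * ?m * (1 + \<omega> * cosh (2 * ?m * x))"
      using cosh_square_eq[of "2 * ?m * x"] by (simp add: algebra_simps power2_eq_square)
    ultimately show ?thesis
      by (elim DERIV_cong) (simp only: f_def power2_eq_square, simp)
  qed
  have top: "(F \<longlongrightarrow> ?m) at_top"
  proof -
    have F_eq: "F x = ?m * ((1 - (exp (- (2 * ?m * x)))\<^sup>2) / (2 * \<omega> * exp (- (2 * ?m * x)) + 1 + (exp (- (2 * ?m * x)))\<^sup>2))" for x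
    proof -
      have "sinh y / (\<omega> + cosh y) = (1 - (exp (- y))\<^sup>2) / (2 * \<omega> * exp (- y) + 1 + (exp (- y))\<^sup>2)" for y :: real
      proof -
        have "exp y * exp (- y) = 1" by (simp flip: exp_add)
        then have e: "1 - (exp (- y))\<^sup>2 = sinh y * (2 * exp (- y))" "2 * \<omega> * exp (- y) + 1 + (exp (- y))\<^sup>2 = (\<omega> + cosh y) * (2 * exp (- y))"
          by (simp_all add: sinh_def cosh_def power2_eq_square algebra_simps)
        show ?thesis unfolding e by simp
      qed
      then show ?thesis unfolding F_def by (simp only:)
    qed
    have q: "((\<lambda>x. exp (- (2 * ?m * x))) \<longlongrightarrow> 0) at_top"
      using filterlim_tendsto_pos_mult_at_top[OF tendsto_const _ filterlim_ident, of "2 * ?m"] mp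
      by (intro filterlim_compose[OF exp_at_bot]) (simp add: filterlim_uminus_at_bot)
    have "((\<lambda>x. ?m * ((1 - (exp (- (2 * ?m * x)))\<^sup>2) / (2 * \<omega> * exp (- (2 * ?m * x)) + 1 + (exp (- (2 * ?m * x)))\<^sup>2)))
        \<longlongrightarrow> ?m * ((1 - 0\<^sup>2) / (2 * \<omega> * 0 + 1 + 0\<^sup>2))) at_top"
      by (intro tendsto_intros q) simp
    then show ?thesis unfolding F_eq[symmetric] by simp
  qed
  have odd: "F (- x) = - F x" for x by (simp add: F_def)
  have bot: "(F \<longlongrightarrow> - ?m) at_bot"
  proof -
    have "((\<lambda>x. - F (- x)) \<longlongrightarrow> - ?m) at_bot"
      by (intro tendsto_minus filterlim_compose[OF top filterlim_uminus_at_top_at_bot])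
    then show ?thesis by (simp add: odd)
  qed
  have "continuous_on UNIV f"
    unfolding f_def using den by (intro continuous_intros) (auto simp: less_le)
  then have "(LINT x|lborel. f x) = ?m - - ?m"
    using int unfolding f by (intro integral_derivative[OF F'] bot top)
  then show ?thesis unfolding f using mp by simp
qed

theorem soliton_variation_exists:
  assumes "\<omega> \<in> existence_interval m"
  shows "\<exists>c C k dw M. soliton_variation (soliton m \<omega>) \<omega> (soliton_mu \<omega>) (case m of Thirring \<Rightarrow> 0 | Gross_Neveu \<Rightarrow> 1) c C k dw M"
proof (cases m)
  case Thirring
  then have omega: "\<bar>\<omega>\<bar> < 1" using assms by auto
  obtain c C k where p: "soliton_profile (soliton Thirring \<omega>) \<omega> (soliton_mu \<omega>) 0 c C k"
    using thirring_profile[OF omega] by blast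
  from soliton_profile.thirring_variation[OF p refl mu_sq[OF omega]
      thirring_ReU2_pos[OF omega soliton_profile.ReU2_integrable[OF p]]]
  show ?thesis unfolding Thirring dirac_model.case by blast
next
  case Gross_Neveu
  then have omega: "0 < \<omega>" "\<omega> < 1" "\<bar>\<omega>\<bar> < 1" using assms by auto
  obtain c C k where p: "soliton_profile (soliton Gross_Neveu \<omega>) \<omega> (soliton_mu \<omega>) 1 c C k"
    using gross_neveu_profile[OF omega(1,2)] by blast
  from soliton_profile.gross_neveu_variation[OF p refl mu_sq[OF omega(3)] omega(1)]
  show ?thesis unfolding Gross_Neveu dirac_model.case by blast
qed

section \<open>Eigenvalues near zero\<close>

definition decays :: "real \<Rightarrow> (real \<Rightarrow> complex) \<Rightarrow> bool" where
  "decays \<kappa> f \<longleftrightarrow> (\<exists>M. decaying \<kappa> f M)"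

lemma decays_add: "decays \<kappa> f \<Longrightarrow> decays \<kappa> g \<Longrightarrow> decays \<kappa> (\<lambda>x. f x + g x)"
  unfolding decays_def using decaying_linear(1) by blast

lemma decays_bounded_mult:
  assumes "decays \<kappa> f" "continuous_on UNIV h" "\<And>x. norm (h x) \<le> K"
  shows "decays \<kappa> (\<lambda>x. h x * f x)"
proof -
  obtain M where M: "decaying \<kappa> f M" using assms(1) by (auto simp: decays_def)
  have "decaying \<kappa> (\<lambda>x. h x * f x) (K * M)"
    unfolding decaying_def
  proof (intro conjI allI)
    show "continuous_on UNIV (\<lambda>x. h x * f x)" using M assms(2) unfolding decaying_def by (intro continuous_intros) auto
    fix x
    have "norm (h x * f x) \<le> K * (M * exp (- \<kappa> * \<bar>x\<bar>))"
      unfolding norm_mult using M assms(3)[of x] unfolding decaying_def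
      by (intro mult_mono) (auto intro: order_trans[OF norm_ge_zero])
    then show "norm (h x * f x) \<le> K * M * exp (- \<kappa> * \<bar>x\<bar>)" by simp
  qed
  then show ?thesis by (auto simp: decays_def)
qed

lemma decays_cmult: "decays \<kappa> f \<Longrightarrow> decays \<kappa> (\<lambda>x. z * f x)" for z :: complex
  by (rule decays_bounded_mult[of _ _ "\<lambda>_. z" "norm z"]) auto

lemma decaying_cnj: "decaying \<kappa> f M \<Longrightarrow> decaying \<kappa> (\<lambda>x. cnj (f x)) M"
  unfolding decaying_def by (auto intro!: continuous_intros)

lemma decaying_reflect: "decaying \<kappa> f M \<Longrightarrow> decaying \<kappa> (\<lambda>x. f (- x)) M"
  unfolding decaying_def
  by (auto intro!: continuous_on_compose2[of UNIV f UNIV uminus] continuous_intros dest: spec[of _ "- _"])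

lemma decaying_cmult:
  assumes "decaying \<kappa> f M"
  shows "decaying \<kappa> (\<lambda>x. z * f x) (norm z * M)"
  using assms unfolding decaying_def by (auto intro!: continuous_intros simp: norm_mult mult.assoc mult_left_mono)

lemma decays_cnj: "decays \<kappa> f \<Longrightarrow> decays \<kappa> (\<lambda>x. cnj (f x))"
  unfolding decays_def using decaying_cnj by blast

lemma decays_reflect: "decays \<kappa> f \<Longrightarrow> decays \<kappa> (\<lambda>x. f (- x))"
  unfolding decays_def using decaying_reflect by blast

text \<open>The half-sum and half-difference of entries 1 and 4 are \<open>A\<close> and
  \<open>C\<close>, those of entries 2 and 3 are \<open>B\<close> and \<open>D\<close>. In these
  coordinates \<open>sigma\<close> sends (A, B, C, D) to (C, -D, A, -B), so it exchanges the
  blocks.\<close>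

definition block_vector :: "complex \<Rightarrow> complex \<Rightarrow> complex \<Rightarrow> complex \<Rightarrow> complex^4" where
  "block_vector A B C D = vector [A + C, B + D, B - D, A - C]"

lemma norm_block_vector_le: "norm (block_vector a b c d) \<le> 2 * (norm a + norm b + norm c + norm d)"
proof -
  have "norm (block_vector a b c d) \<le> (norm a + norm c) + (norm b + norm d) + (norm b + norm d) + (norm a + norm c)"
    unfolding block_vector_def
    by (rule order_trans[OF norm_vector4_le]) (intro add_mono norm_triangle_ineq norm_triangle_ineq4)
  then show ?thesis by simp
qed

lemma block_vector_exp_bound:
  assumes "decays \<kappa> a" "decays \<kappa> b" "decays \<kappa> c" "decays \<kappa> d"
  shows "\<exists>M. \<forall>x. norm (block_vector (a x) (b x) (c x) (d x)) \<le> M * exp (- \<kappa> * \<bar>x\<bar>)"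
proof -
  obtain Ma Mb Mc Md where M: "decaying \<kappa> a Ma" "decaying \<kappa> b Mb" "decaying \<kappa> c Mc" "decaying \<kappa> d Md"
    using assms unfolding decays_def by blast
  have "norm (block_vector (a x) (b x) (c x) (d x)) \<le> (2 * (Ma + Mb + Mc + Md)) * exp (- \<kappa> * \<bar>x\<bar>)" for x
  proof -
    have "2 * (norm (a x) + norm (b x) + norm (c x) + norm (d x)) \<le> 2 * (Ma * exp (- \<kappa> * \<bar>x\<bar>) + Mb * exp (- \<kappa> * \<bar>x\<bar>) + Mc * exp (- \<kappa> * \<bar>x\<bar>) + Md * exp (- \<kappa> * \<bar>x\<bar>))"
      using M unfolding decaying_def by (intro mult_left_mono add_mono) auto
    then show ?thesis using norm_block_vector_le[of "a x" "b x" "c x" "d x"] by (simp add: algebra_simps)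
  qed
  then show ?thesis by blast
qed

lemma continuous_on_block_vector:
  fixes a b c d :: "real \<Rightarrow> complex"
  assumes "continuous_on UNIV a" "continuous_on UNIV b" "continuous_on UNIV c" "continuous_on UNIV d"
  shows "continuous_on UNIV (\<lambda>x. block_vector (a x) (b x) (c x) (d x))"
  unfolding block_vector_def by (intro vector4_continuous_on continuous_intros assms)

lemma decays_continuous: "decays \<kappa> f \<Longrightarrow> continuous_on UNIV f"
  by (auto simp: decays_def decaying_def)

lemma in_L2_block_vector:
  assumes "\<kappa> > 0" "decays \<kappa> a" "decays \<kappa> b" "decays \<kappa> c" "decays \<kappa> d"
  shows "in_L2 (\<lambda>x. block_vector (a x) (b x) (c x) (d x))"
proof -
  obtain M where M: "\<And>x. norm (block_vector (a x) (b x) (c x) (d x)) \<le> M * exp (- \<kappa> * \<bar>x\<bar>)"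
    using block_vector_exp_bound[OF assms(2-5)] by blast
  show ?thesis
    by (rule in_L2_exp_bound[OF continuous_on_block_vector assms(1) M]) (rule assms(2-5)[THEN decays_continuous])+
qed

text \<open>The pointwise distance to the limit is at most \<open>8 * \<delta>\<close> times the
  weight: four components, each entering twice. At 0 this and \<open>nz\<close> keep the vector from
  vanishing, and integrating it gives the bound on \<open>L2_norm\<close>.\<close>

lemma eigenvector_block_vector:
  fixes A B C D A' B' C' D' A0 B0 C0 D0 :: "real \<Rightarrow> complex"
  defines "V \<equiv> \<lambda>x. block_vector (A x) (B x) (C x) (D x)"
  assumes \<kappa>: "\<kappa> > 0"
    and deriv: "\<And>x. (A has_vector_derivative A' x) (at x)" "\<And>x. (B has_vector_derivative B' x) (at x)"
      "\<And>x. (C has_vector_derivative C' x) (at x)" "\<And>x. (D has_vector_derivative D' x) (at x)"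
    and dec: "decays \<kappa> A'" "decays \<kappa> B'" "decays \<kappa> C'" "decays \<kappa> D'"
    and close: "decaying \<kappa> (\<lambda>x. A x - A0 x) \<delta>" "decaying \<kappa> (\<lambda>x. B x - B0 x) \<delta>"
      "decaying \<kappa> (\<lambda>x. C x - C0 x) \<delta>" "decaying \<kappa> (\<lambda>x. D x - D0 x) \<delta>"
    and lim: "decays \<kappa> A0" "decays \<kappa> B0" "decays \<kappa> C0" "decays \<kappa> D0"
    and nz: "norm (block_vector (A0 0) (B0 0) (C0 0) (D0 0)) > 8 * \<delta>"
    and eq: "\<And>x. (\<i> * l) *s (sigma *v V x) = D_omega \<omega> (V x) (block_vector (A' x) (B' x) (C' x) (D' x))
        + E_matrix m p *v V x + W_matrix m \<omega> x *v V x"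
  shows "eigenvector m \<omega> p l V \<and> in_L2 V \<and>
    L2_norm (\<lambda>x. V x - block_vector (A0 x) (B0 x) (C0 x) (D0 x)) \<le> 8 * \<delta> * sqrt (LINT x|lborel. exp (- (2 * \<kappa>) * \<bar>x\<bar>))"
proof -
  have diff: "block_vector a b c d - block_vector a0 b0 c0 d0 = block_vector (a - a0) (b - b0) (c - c0) (d - d0)"
    for a b c d a0 b0 c0 d0 by (simp add: block_vector_def vec_eq_iff forall_4)
  have decV: "decays \<kappa> A" "decays \<kappa> B" "decays \<kappa> C" "decays \<kappa> D"
    using decays_add[OF lim(1), of "\<lambda>x. A x - A0 x"] decays_add[OF lim(2), of "\<lambda>x. B x - B0 x"]
      decays_add[OF lim(3), of "\<lambda>x. C x - C0 x"] decays_add[OF lim(4), of "\<lambda>x. D x - D0 x"] close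
    by (auto simp: decays_def)
  have V': "(V has_vector_derivative block_vector (A' x) (B' x) (C' x) (D' x)) (at x)" for x
    unfolding V_def block_vector_def
    by (intro vector4_has_vector_derivative has_vector_derivative_add has_vector_derivative_diff deriv)
  obtain M1 where M1: "\<And>x. norm (V x) \<le> M1 * exp (- \<kappa> * \<bar>x\<bar>)" unfolding V_def using block_vector_exp_bound[OF decV] by blast
  obtain M2 where M2: "\<And>x. norm (block_vector (A' x) (B' x) (C' x) (D' x)) \<le> M2 * exp (- \<kappa> * \<bar>x\<bar>)" using block_vector_exp_bound[OF dec] by blast
  have close_bd: "norm (V x - block_vector (A0 x) (B0 x) (C0 x) (D0 x)) \<le> 8 * \<delta> * exp (- \<kappa> * \<bar>x\<bar>)" for x
  proof -
    have "norm (A x - A0 x) \<le> \<delta> * exp (- \<kappa> * \<bar>x\<bar>)" "norm (B x - B0 x) \<le> \<delta> * exp (- \<kappa> * \<bar>x\<bar>)"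
      "norm (C x - C0 x) \<le> \<delta> * exp (- \<kappa> * \<bar>x\<bar>)" "norm (D x - D0 x) \<le> \<delta> * exp (- \<kappa> * \<bar>x\<bar>)"
      using close unfolding decaying_def by auto
    then have "2 * (norm (A x - A0 x) + norm (B x - B0 x) + norm (C x - C0 x) + norm (D x - D0 x))
        \<le> 2 * (\<delta> * exp (- \<kappa> * \<bar>x\<bar>) + \<delta> * exp (- \<kappa> * \<bar>x\<bar>) + \<delta> * exp (- \<kappa> * \<bar>x\<bar>) + \<delta> * exp (- \<kappa> * \<bar>x\<bar>))"
      by (intro mult_left_mono add_mono) auto
    then show ?thesis unfolding V_def diff by (intro order_trans[OF norm_block_vector_le]) simp
  qed
  have cV: "continuous_on UNIV V" unfolding V_def by (intro continuous_on_block_vector decays_continuous[of \<kappa>] decV)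
  have cL: "continuous_on UNIV (\<lambda>x. V x - block_vector (A0 x) (B0 x) (C0 x) (D0 x))"
    by (intro continuous_on_diff cV continuous_on_block_vector decays_continuous[of \<kappa>] lim)
  have "V 0 \<noteq> 0"
    using close_bd[of 0] nz by (auto simp: norm_minus_commute)
  moreover have "M1 \<le> max M1 M2" "M2 \<le> max M1 M2" by auto
  then have "norm (V x) \<le> max M1 M2 * exp (- \<kappa> * \<bar>x\<bar>)"
    "norm (block_vector (A' x) (B' x) (C' x) (D' x)) \<le> max M1 M2 * exp (- \<kappa> * \<bar>x\<bar>)" for x
    by (meson M1 M2 mult_right_mono exp_ge_zero order_trans)+
  ultimately have "eigenvector m \<omega> p l V"
    by (intro eigenvectorI[OF V' continuous_on_block_vector \<kappa>, where ?x0.0 = 0] decays_continuous[of \<kappa>] dec eq)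
  then show ?thesis
    using in_L2_exp_bound[OF cV \<kappa> M1] L2_norm_exp_bound[OF cL \<kappa> close_bd] by blast
qed

section \<open>The spectral problem in block coordinates\<close>

lemma thirring_block:
  fixes \<omega> x p :: real and l :: complex
  defines "u \<equiv> soliton Thirring \<omega> x"
  assumes "- \<i> * A' = \<i> * l * C - of_real \<omega> * A + B - 2 * (u * cnj u) * A - u\<^sup>2 * B - of_real (p\<^sup>2) * A"
    and "\<i> * B' = - \<i> * l * D - of_real \<omega> * B + A - 2 * (u * cnj u) * B - (cnj u)\<^sup>2 * A - of_real (p\<^sup>2) * B"
    and "- \<i> * C' = \<i> * l * A - of_real \<omega> * C - D + u\<^sup>2 * D - of_real (p\<^sup>2) * C"
    and "\<i> * D' = - \<i> * l * B - of_real \<omega> * D - C + (cnj u)\<^sup>2 * C - of_real (p\<^sup>2) * D"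
  shows "(\<i> * l) *s (sigma *v block_vector A B C D) = D_omega \<omega> (block_vector A B C D) (block_vector A' B' C' D')
        + E_matrix Thirring p *v block_vector A B C D + W_matrix Thirring \<omega> x *v block_vector A B C D"
proof -
  have n: "complex_of_real ((norm u)\<^sup>2) = u * cnj u" by (rule complex_norm_square)
  have W: "W_matrix Thirring \<omega> x = vector [vector [u * cnj u, 0, u\<^sup>2, u * cnj u], vector [0, u * cnj u, u * cnj u, (cnj u)\<^sup>2],
      vector [(cnj u)\<^sup>2, u * cnj u, u * cnj u, 0], vector [u * cnj u, u\<^sup>2, 0, u * cnj u]]"
    unfolding W_matrix.simps Let_def u_def[symmetric] n ..
  have E: "E_matrix Thirring p *v v = of_real (p\<^sup>2) *s v" for v
    by (simp add: vec_eq_iff forall_4 matrix_vector_mult_def sum_4 mat_def)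
  show ?thesis
    unfolding W E
    by (simp add: vec_eq_iff forall_4 matrix_vector_mult_def sum_4 sigma_def D_omega_def block_vector_def del: of_real_power)
       (intro conjI; use assms(2-) in algebra)
qed

lemma gross_neveu_block:
  fixes \<omega> x p :: real and l :: complex
  defines "u \<equiv> soliton Gross_Neveu \<omega> x"
  assumes "- \<i> * A' = \<i> * l * C - of_real \<omega> * A + B - 2 * (u * cnj u) * A - (u\<^sup>2 + 3 * (cnj u)\<^sup>2) * B - \<i> * of_real p * D"
    and "\<i> * B' = - \<i> * l * D - of_real \<omega> * B + A - 2 * (u * cnj u) * B - ((cnj u)\<^sup>2 + 3 * u\<^sup>2) * A - \<i> * of_real p * C"
    and "- \<i> * C' = \<i> * l * A - of_real \<omega> * C - D + (u\<^sup>2 + (cnj u)\<^sup>2) * D + \<i> * of_real p * B"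
    and "\<i> * D' = - \<i> * l * B - of_real \<omega> * D - C + (u\<^sup>2 + (cnj u)\<^sup>2) * C + \<i> * of_real p * A"
  shows "(\<i> * l) *s (sigma *v block_vector A B C D) = D_omega \<omega> (block_vector A B C D) (block_vector A' B' C' D')
        + E_matrix Gross_Neveu p *v block_vector A B C D + W_matrix Gross_Neveu \<omega> x *v block_vector A B C D"
proof -
  have n: "complex_of_real ((norm u)\<^sup>2) = u * cnj u" by (rule complex_norm_square)
  have W: "W_matrix Gross_Neveu \<omega> x = vector [vector [u * cnj u, (cnj u)\<^sup>2, u\<^sup>2 + 2 * (cnj u)\<^sup>2, u * cnj u],
      vector [u\<^sup>2, u * cnj u, u * cnj u, 2 * u\<^sup>2 + (cnj u)\<^sup>2],
      vector [2 * u\<^sup>2 + (cnj u)\<^sup>2, u * cnj u, u * cnj u, u\<^sup>2], vector [u * cnj u, u\<^sup>2 + 2 * (cnj u)\<^sup>2, (cnj u)\<^sup>2, u * cnj u]]"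
    unfolding W_matrix.simps Let_def u_def[symmetric] n ..
  have E: "E_matrix Gross_Neveu p *v v = vector [- \<i> * of_real p * v $ 3, - \<i> * of_real p * v $ 4, \<i> * of_real p * v $ 1, \<i> * of_real p * v $ 2]" for v
    by (simp add: vec_eq_iff forall_4 matrix_vector_mult_def sum_4 map_matrix_def J_def)
  show ?thesis
    unfolding W E
    by (simp add: vec_eq_iff forall_4 matrix_vector_mult_def sum_4 sigma_def D_omega_def block_vector_def)
       (intro conjI; use assms(2-) in algebra)
qed

text \<open>Reflection reverses the derivative and conjugation reverses \<open>\<i>\<close>, so the
  equation is preserved. The outer minus sign is chosen such that \<open>dU\<close> and
  \<open>\<i> U\<close> are fixed.\<close>

lemma dirac_eq_reflect:
  assumes "dirac_eq \<alpha> \<beta> a f" "\<And>x. \<alpha> (- x) = \<alpha> x" "\<And>x. \<beta> (- x) = cnj (\<beta> x)"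
  shows "dirac_eq \<alpha> \<beta> (\<lambda>x. - cnj (a (- x))) (\<lambda>x. - cnj (f (- x)))"
  unfolding dirac_eq_def
proof
  fix x
  have u: "(uminus has_vector_derivative - 1) (at x)" for x :: real
    by (auto intro!: derivative_eq_intros)
  have "(a has_vector_derivative \<i> * (f (- x) - \<alpha> (- x) * a (- x) - \<beta> (- x) * cnj (a (- x)))) (at (- x))"
    using assms(1) unfolding dirac_eq_def by blast
  note d = has_vector_derivative_minus[OF has_vector_derivative_cnj[OF vector_diff_chain_at[OF u this]], unfolded o_def]
  show "((\<lambda>x. - cnj (a (- x))) has_vector_derivative
      \<i> * (- cnj (f (- x)) - \<alpha> x * - cnj (a (- x)) - \<beta> x * cnj (- cnj (a (- x))))) (at x)"
    by (rule has_vector_derivative_eq_rhs[OF d]) (simp add: assms(2,3) algebra_simps)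
qed

lemma decays_dirac_derivative:
  assumes "decays \<kappa> a" "decays \<kappa> f" "continuous_on UNIV \<alpha>" "continuous_on UNIV \<beta>"
    "\<And>x. \<bar>\<alpha> x\<bar> \<le> K" "\<And>x. norm (\<beta> x) \<le> K"
  shows "decays \<kappa> (\<lambda>x. \<i> * (f x - of_real (\<alpha> x) * a x - \<beta> x * cnj (a x)))"
proof -
  have "decays \<kappa> (\<lambda>x. of_real (- \<alpha> x) * a x)" "decays \<kappa> (\<lambda>x. (- \<beta> x) * cnj (a x))"
    by (rule decays_bounded_mult[where K = K]; use assms in \<open>auto intro!: decays_cnj continuous_intros\<close>)+
  then have "decays \<kappa> (\<lambda>x. \<i> * ((f x + of_real (- \<alpha> x) * a x) + (- \<beta> x) * cnj (a x)))"
    by (intro decays_cmult decays_add assms(2))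
  then show ?thesis by (simp add: algebra_simps)
qed

section \<open>From solutions of the scalar equations to eigenvectors\<close>

context soliton_profile
begin

lemma coefficients_reflect:
  "\<alpha>p (- x) = \<alpha>p x" "\<beta>p (- x) = cnj (\<beta>p x)" "\<alpha>m (- x) = \<alpha>m x" "\<beta>m (- x) = cnj (\<beta>m x)"
  by (simp_all add: \<alpha>p_def \<beta>p_def \<alpha>m_def \<beta>m_def U_sym)

lemma reflect_solutions:
  "dirac_eq \<alpha>p \<beta>p a f \<Longrightarrow> dirac_eq \<alpha>p \<beta>p (\<lambda>x. - cnj (a (- x))) (\<lambda>x. - cnj (f (- x)))"
  "dirac_eq \<alpha>m \<beta>m a f \<Longrightarrow> dirac_eq \<alpha>m \<beta>m (\<lambda>x. - cnj (a (- x))) (\<lambda>x. - cnj (f (- x)))"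
  by (rule dirac_eq_reflect; simp add: coefficients_reflect)+

lemma solution_derivative:
  fixes a f :: "real \<Rightarrow> complex"
  assumes "decays \<kappa> a" "decays \<kappa> f"
  shows "dirac_eq \<alpha>p \<beta>p a f \<Longrightarrow> \<exists>a'. (\<forall>x. (a has_vector_derivative a' x) (at x)) \<and> decays \<kappa> a' \<and>
      (\<forall>x. - \<i> * a' x = f x - (\<omega> + 2 * (U x * cnj (U x))) * a x - (- 1 + (U x)\<^sup>2 + 3 * g * (cnj (U x))\<^sup>2) * cnj (a x))"
    and "dirac_eq \<alpha>m \<beta>m a f \<Longrightarrow> \<exists>a'. (\<forall>x. (a has_vector_derivative a' x) (at x)) \<and> decays \<kappa> a' \<and>
      (\<forall>x. - \<i> * a' x = f x - \<omega> * a x - (1 - (U x)\<^sup>2 - g * (cnj (U x))\<^sup>2) * cnj (a x))"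
proof -
  have "\<bar>\<alpha>p x\<bar> \<le> \<bar>\<omega>\<bar> + 2 * C\<^sup>2 + (1 + 4 * C\<^sup>2)" "\<bar>\<alpha>m x\<bar> \<le> \<bar>\<omega>\<bar> + 2 * C\<^sup>2 + (1 + 4 * C\<^sup>2)"
    "norm (\<beta>p x) \<le> \<bar>\<omega>\<bar> + 2 * C\<^sup>2 + (1 + 4 * C\<^sup>2)" "norm (\<beta>m x) \<le> \<bar>\<omega>\<bar> + 2 * C\<^sup>2 + (1 + 4 * C\<^sup>2)" for x
  proof -
    have C2: "0 \<le> C\<^sup>2" and "(norm (U x))\<^sup>2 \<le> C\<^sup>2" "0 \<le> (norm (U x))\<^sup>2" by (simp_all add: power_mono U_bound)
    then show "\<bar>\<alpha>p x\<bar> \<le> \<bar>\<omega>\<bar> + 2 * C\<^sup>2 + (1 + 4 * C\<^sup>2)" "\<bar>\<alpha>m x\<bar> \<le> \<bar>\<omega>\<bar> + 2 * C\<^sup>2 + (1 + 4 * C\<^sup>2)"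
      unfolding \<alpha>p_def \<alpha>m_def by linarith+
    show "norm (\<beta>p x) \<le> \<bar>\<omega>\<bar> + 2 * C\<^sup>2 + (1 + 4 * C\<^sup>2)" "norm (\<beta>m x) \<le> \<bar>\<omega>\<bar> + 2 * C\<^sup>2 + (1 + 4 * C\<^sup>2)"
      using beta_bound[of x] C2 by linarith+
  qed
  note bounds = this
  show "\<exists>a'. (\<forall>x. (a has_vector_derivative a' x) (at x)) \<and> decays \<kappa> a' \<and>
      (\<forall>x. - \<i> * a' x = f x - (\<omega> + 2 * (U x * cnj (U x))) * a x - (- 1 + (U x)\<^sup>2 + 3 * g * (cnj (U x))\<^sup>2) * cnj (a x))"
    if "dirac_eq \<alpha>p \<beta>p a f"
    using that decays_dirac_derivative[OF assms p.cont bounds(1,3)] unfolding dirac_eq_def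
    by (intro exI[of _ "\<lambda>x. \<i> * (f x - of_real (\<alpha>p x) * a x - \<beta>p x * cnj (a x))"]) (simp add: alpha_p_eq \<beta>p_def)
  show "\<exists>a'. (\<forall>x. (a has_vector_derivative a' x) (at x)) \<and> decays \<kappa> a' \<and>
      (\<forall>x. - \<i> * a' x = f x - \<omega> * a x - (1 - (U x)\<^sup>2 - g * (cnj (U x))\<^sup>2) * cnj (a x))"
    if "dirac_eq \<alpha>m \<beta>m a f"
    using that decays_dirac_derivative[OF assms m.cont bounds(2,4)] unfolding dirac_eq_def
    by (intro exI[of _ "\<lambda>x. \<i> * (f x - of_real (\<alpha>m x) * a x - \<beta>m x * cnj (a x))"]) (simp add: \<alpha>m_def \<beta>m_def)
qed

lemma decays_near:
  assumes "decays \<kappa> a0" "decaying \<kappa> (\<lambda>x. a x - a0 x) \<delta>"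
  shows "decays \<kappa> a"
  using decays_add[OF assms(1), of "\<lambda>x. a x - a0 x"] assms(2) by (auto simp: decays_def)

text \<open>\<open>y\<close> is a common phase, free for normalizing the limit, and \<open>z\<close>
  is the phase of the difference block relative to the sum block. Each block is a phase times a pair
  \<open>(f, cnj f)\<close>, so two scalar functions determine all four components.\<close>

lemma mode_pointwise:
  fixes y z l :: complex and a b F G a0 b0 :: "real \<Rightarrow> complex"
  assumes eqs: "dirac_eq \<alpha>p \<beta>p a F" "dirac_eq \<alpha>m \<beta>m b G" and dec: "decays \<kappa> F" "decays \<kappa> G"
    and lim: "decays \<kappa> a0" "decays \<kappa> b0"
    and close: "decaying \<kappa> (\<lambda>x. a x - a0 x) \<delta>" "decaying \<kappa> (\<lambda>x. b x - b0 x) \<delta>"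
    and yz: "norm y = 1" "norm z = 1"
    and nz: "norm (block_vector (y * a0 0) (y * cnj (a0 0)) (y * z * b0 0) (y * z * cnj (b0 0))) > 8 * \<delta>"
    and eq: "\<And>x (a' :: complex) (b' :: complex). - \<i> * a' = F x - (\<omega> + 2 * (U x * cnj (U x))) * a x - (- 1 + (U x)\<^sup>2 + 3 * g * (cnj (U x))\<^sup>2) * cnj (a x) \<Longrightarrow>
      - \<i> * b' = G x - \<omega> * b x - (1 - (U x)\<^sup>2 - g * (cnj (U x))\<^sup>2) * cnj (b x) \<Longrightarrow>
      (\<i> * l) *s (sigma *v block_vector (y * a x) (y * cnj (a x)) (y * z * b x) (y * z * cnj (b x))) =
        D_omega \<omega> (block_vector (y * a x) (y * cnj (a x)) (y * z * b x) (y * z * cnj (b x)))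
          (block_vector (y * a') (y * cnj a') (y * z * b') (y * z * cnj b'))
        + E_matrix m p *v block_vector (y * a x) (y * cnj (a x)) (y * z * b x) (y * z * cnj (b x))
        + W_matrix m \<omega> x *v block_vector (y * a x) (y * cnj (a x)) (y * z * b x) (y * z * cnj (b x))"
  shows "\<exists>u. eigenvector m \<omega> p l u \<and> in_L2 u \<and>
    L2_norm (\<lambda>x. u x - block_vector (y * a0 x) (y * cnj (a0 x)) (y * z * b0 x) (y * z * cnj (b0 x)))
      \<le> 8 * \<delta> * sqrt (LINT x|lborel. exp (- (2 * \<kappa>) * \<bar>x\<bar>))"
proof -
  have deca: "decays \<kappa> a" "decays \<kappa> b" by (rule decays_near[OF lim(1) close(1)], rule decays_near[OF lim(2) close(2)])
  from solution_derivative(1)[OF deca(1) dec(1) eqs(1)]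
  obtain a' :: "real \<Rightarrow> complex" where a': "\<forall>x. (a has_vector_derivative a' x) (at x)" "decays \<kappa> a'"
    "\<forall>x. - \<i> * a' x = F x - (\<omega> + 2 * (U x * cnj (U x))) * a x - (- 1 + (U x)\<^sup>2 + 3 * g * (cnj (U x))\<^sup>2) * cnj (a x)"
    by (elim exE conjE) (rule that)
  note a' = a'(1)[rule_format] a'(2) a'(3)[rule_format]
  from solution_derivative(2)[OF deca(2) dec(2) eqs(2)]
  obtain b' :: "real \<Rightarrow> complex" where b': "\<forall>x. (b has_vector_derivative b' x) (at x)" "decays \<kappa> b'"
    "\<forall>x. - \<i> * b' x = G x - \<omega> * b x - (1 - (U x)\<^sup>2 - g * (cnj (U x))\<^sup>2) * cnj (b x)"
    by (elim exE conjE) (rule that)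
  note b' = b'(1)[rule_format] b'(2) b'(3)[rule_format]
  have yz': "norm (y * z) = 1" using yz by (simp add: norm_mult)
  have cl: "decaying \<kappa> (\<lambda>x. w * f x - w * f0 x) \<delta>" "decaying \<kappa> (\<lambda>x. w * cnj (f x) - w * cnj (f0 x)) \<delta>"
    if "norm w = 1" "decaying \<kappa> (\<lambda>x. f x - f0 x) \<delta>" for w f f0
    using decaying_cmult[OF that(2), of w] decaying_cmult[OF decaying_cnj[OF that(2)], of w] that(1)
    by (simp_all add: algebra_simps)
  show ?thesis
    by (intro exI, rule eigenvector_block_vector[where A' = "\<lambda>x. y * a' x" and B' = "\<lambda>x. y * cnj (a' x)"
          and C' = "\<lambda>x. y * z * b' x" and D' = "\<lambda>x. y * z * cnj (b' x)" and \<delta> = \<delta>])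
       (use mu in \<open>auto intro!: has_vector_derivative_mult_right has_vector_derivative_cnj a' b' decays_cmult decays_cnj lim
          cl[OF yz(1) close(1)] cl[OF yz' close(2)] nz eq\<close>)
qed

text \<open>Here a block is no longer a phase times \<open>(f, cnj f)\<close>: each component
  superposes a function and its reflection, one of them conjugated, with opposite weights
  \<open>P\<close> and \<open>N = - P\<close> in the two blocks. Differentiating the reflected part
  changes its sign, which yields the minus signs in the derivatives.\<close>

lemma mode_nonlocal:
  fixes l :: complex and a b F G a0 b0 :: "real \<Rightarrow> complex"
  defines "h \<equiv> \<lambda>w (f :: real \<Rightarrow> complex) x. (1 + \<i>) / 2 * f x + w * cnj (f (- x))" and "h' \<equiv> \<lambda>w (f :: real \<Rightarrow> complex) x. (1 + \<i>) / 2 * cnj (f x) + w * f (- x)"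
    and "P \<equiv> (1 - \<i>) / 2" and "N \<equiv> (\<i> - 1) / 2"
  assumes eqs: "dirac_eq \<alpha>p \<beta>p a F" "dirac_eq \<alpha>m \<beta>m b G" and dec: "decays \<kappa> F" "decays \<kappa> G"
    and lim: "decays \<kappa> a0" "decays \<kappa> b0"
    and close: "decaying \<kappa> (\<lambda>x. a x - a0 x) \<delta>" "decaying \<kappa> (\<lambda>x. b x - b0 x) \<delta>"
    and nz: "norm (block_vector (h P a0 0) (h' P a0 0) (h N b0 0) (h' N b0 0)) > 16 * \<delta>"
    and eq: "\<And>x (a1 :: complex) (a2 :: complex) (b1 :: complex) (b2 :: complex). - \<i> * a1 = F x - (\<omega> + 2 * (U x * cnj (U x))) * a x - (- 1 + (U x)\<^sup>2 + 3 * g * (cnj (U x))\<^sup>2) * cnj (a x) \<Longrightarrow>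
      - \<i> * a2 = F (- x) - (\<omega> + 2 * (U x * cnj (U x))) * a (- x) - (- 1 + (cnj (U x))\<^sup>2 + 3 * g * (U x)\<^sup>2) * cnj (a (- x)) \<Longrightarrow>
      - \<i> * b1 = G x - \<omega> * b x - (1 - (U x)\<^sup>2 - g * (cnj (U x))\<^sup>2) * cnj (b x) \<Longrightarrow>
      - \<i> * b2 = G (- x) - \<omega> * b (- x) - (1 - (cnj (U x))\<^sup>2 - g * (U x)\<^sup>2) * cnj (b (- x)) \<Longrightarrow>
      (\<i> * l) *s (sigma *v block_vector (h P a x) (h' P a x) (h N b x) (h' N b x)) =
        D_omega \<omega> (block_vector (h P a x) (h' P a x) (h N b x) (h' N b x))
          (block_vector ((1 + \<i>) / 2 * a1 - P * cnj a2) ((1 + \<i>) / 2 * cnj a1 - P * a2)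
             ((1 + \<i>) / 2 * b1 - N * cnj b2) ((1 + \<i>) / 2 * cnj b1 - N * b2))
        + E_matrix m p *v block_vector (h P a x) (h' P a x) (h N b x) (h' N b x)
        + W_matrix m \<omega> x *v block_vector (h P a x) (h' P a x) (h N b x) (h' N b x)"
  shows "\<exists>u. eigenvector m \<omega> p l u \<and> in_L2 u \<and>
    L2_norm (\<lambda>x. u x - block_vector (h P a0 x) (h' P a0 x) (h N b0 x) (h' N b0 x))
      \<le> 8 * (2 * \<delta>) * sqrt (LINT x|lborel. exp (- (2 * \<kappa>) * \<bar>x\<bar>))"
proof -
  have deca: "decays \<kappa> a" "decays \<kappa> b" by (rule decays_near[OF lim(1) close(1)], rule decays_near[OF lim(2) close(2)])
  from solution_derivative(1)[OF deca(1) dec(1) eqs(1)]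
  obtain a' :: "real \<Rightarrow> complex" where a': "\<forall>x. (a has_vector_derivative a' x) (at x)" "decays \<kappa> a'"
    "\<forall>x. - \<i> * a' x = F x - (\<omega> + 2 * (U x * cnj (U x))) * a x - (- 1 + (U x)\<^sup>2 + 3 * g * (cnj (U x))\<^sup>2) * cnj (a x)"
    by (elim exE conjE) (rule that)
  note a' = a'(1)[rule_format] a'(2) a'(3)[rule_format]
  from solution_derivative(2)[OF deca(2) dec(2) eqs(2)]
  obtain b' :: "real \<Rightarrow> complex" where b': "\<forall>x. (b has_vector_derivative b' x) (at x)" "decays \<kappa> b'"
    "\<forall>x. - \<i> * b' x = G x - \<omega> * b x - (1 - (U x)\<^sup>2 - g * (cnj (U x))\<^sup>2) * cnj (b x)"
    by (elim exE conjE) (rule that)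
  note b' = b'(1)[rule_format] b'(2) b'(3)[rule_format]
  have refl: "((\<lambda>x. f (- x)) has_vector_derivative - f' (- x)) (at x)"
    if "\<And>x. (f has_vector_derivative f' x) (at x)" for f f' :: "real \<Rightarrow> complex" and x
  proof -
    have "(uminus has_vector_derivative - 1) (at x)" by (auto intro!: derivative_eq_intros)
    from vector_diff_chain_at[OF this that] show ?thesis by (simp add: o_def)
  qed
  have hd: "(h w f has_vector_derivative (1 + \<i>) / 2 * f' x - w * cnj (f' (- x))) (at x)"
    "(h' w f has_vector_derivative (1 + \<i>) / 2 * cnj (f' x) - w * f' (- x)) (at x)"
    if f: "\<And>x. (f has_vector_derivative f' x) (at x)" for f f' w x
    unfolding h_def h'_def
    using has_vector_derivative_add[OF has_vector_derivative_mult_right[OF f, of "(1 + \<i>) / 2" x]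
        has_vector_derivative_mult_right[OF has_vector_derivative_cnj[OF refl[of f f', OF f]], of w]]
      has_vector_derivative_add[OF has_vector_derivative_mult_right[OF has_vector_derivative_cnj[OF f], of "(1 + \<i>) / 2" x]
        has_vector_derivative_mult_right[OF refl[of f f', OF f], of w]] by simp_all
  have hdec: "decays \<kappa> (h w f)" "decays \<kappa> (h' w f)" if "decays \<kappa> f" for w f
    unfolding h_def h'_def by (intro decays_add decays_cmult decays_cnj decays_reflect that)+
  have hdec': "decays \<kappa> (\<lambda>x. (1 + \<i>) / 2 * f x - w * cnj (f (- x)))" "decays \<kappa> (\<lambda>x. (1 + \<i>) / 2 * cnj (f x) - w * f (- x))"
    if "decays \<kappa> f" for w f
    using hdec[OF that, of "- w"] by (simp_all add: h_def h'_def)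
  have half: "norm ((1 + \<i>) / 2) \<le> 1" "norm P \<le> 1" "norm N \<le> 1"
    using norm_triangle_ineq[of 1 \<i>] norm_triangle_ineq4[of 1 \<i>] norm_triangle_ineq4[of \<i> 1]
    by (simp_all add: norm_divide P_def N_def)
  have hcl: "decaying \<kappa> (\<lambda>x. h w f x - h w f0 x) (2 * \<delta>)" "decaying \<kappa> (\<lambda>x. h' w f x - h' w f0 x) (2 * \<delta>)"
    if w: "norm w \<le> 1" and d: "decaying \<kappa> (\<lambda>x. f x - f0 x) \<delta>" for w f f0
  proof -
    have \<delta>: "\<delta> \<ge> 0" using decaying_nonneg[OF d] .
    have e: "(\<lambda>x. h w f x - h w f0 x) = h w (\<lambda>x. f x - f0 x)" "(\<lambda>x. h' w f x - h' w f0 x) = h' w (\<lambda>x. f x - f0 x)"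
      by (auto simp: h_def h'_def algebra_simps add_divide_distrib diff_divide_distrib)
    have "norm ((1 + \<i>) / 2) * \<delta> + norm w * \<delta> \<le> 1 * \<delta> + 1 * \<delta>"
      using half w \<delta> by (intro add_mono mult_right_mono) auto
    then have le: "norm ((1 + \<i>) / 2) * \<delta> + norm w * \<delta> \<le> 2 * \<delta>" by simp
    show "decaying \<kappa> (\<lambda>x. h w f x - h w f0 x) (2 * \<delta>)" unfolding e unfolding h_def
      by (rule decaying_mono[OF decaying_linear(1)[OF decaying_cmult[OF d] decaying_cmult[OF decaying_cnj[OF decaying_reflect[OF d]]]] le])
    show "decaying \<kappa> (\<lambda>x. h' w f x - h' w f0 x) (2 * \<delta>)" unfolding e unfolding h'_def
      by (rule decaying_mono[OF decaying_linear(1)[OF decaying_cmult[OF decaying_cnj[OF d]] decaying_cmult[OF decaying_reflect[OF d]]] le])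
  qed
  have eq': "(\<i> * l) *s (sigma *v block_vector (h P a x) (h' P a x) (h N b x) (h' N b x)) =
        D_omega \<omega> (block_vector (h P a x) (h' P a x) (h N b x) (h' N b x))
          (block_vector ((1 + \<i>) / 2 * a' x - P * cnj (a' (- x))) ((1 + \<i>) / 2 * cnj (a' x) - P * a' (- x))
             ((1 + \<i>) / 2 * b' x - N * cnj (b' (- x))) ((1 + \<i>) / 2 * cnj (b' x) - N * b' (- x)))
        + E_matrix m p *v block_vector (h P a x) (h' P a x) (h N b x) (h' N b x)
        + W_matrix m \<omega> x *v block_vector (h P a x) (h' P a x) (h N b x) (h' N b x)" for x
    by (rule eq[OF a'(3) _ b'(3)]) (use a'(3)[of "- x"] b'(3)[of "- x"] in \<open>simp_all add: U_sym mult.commute\<close>)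
  have nz': "norm (block_vector (h P a0 0) (h' P a0 0) (h N b0 0) (h' N b0 0)) > 8 * (2 * \<delta>)" using nz by simp
  have \<kappa>: "\<kappa> > 0" using mu by simp
  show ?thesis
    by (rule exI, rule eigenvector_block_vector[OF \<kappa> hd(1)[OF a'(1)] hd(2)[OF a'(1)] hd(1)[OF b'(1)] hd(2)[OF b'(1)]
          hdec'(1)[OF a'(2)] hdec'(2)[OF a'(2)] hdec'(1)[OF b'(2)] hdec'(2)[OF b'(2)]
          hcl(1)[OF half(2) close(1)] hcl(2)[OF half(2) close(1)] hcl(1)[OF half(3) close(2)] hcl(2)[OF half(3) close(2)]
          hdec(1)[OF lim(1)] hdec(2)[OF lim(1)] hdec(1)[OF lim(2)] hdec(2)[OF lim(2)] nz' eq'])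
qed

end

definition source :: "real \<Rightarrow> real \<Rightarrow> real \<Rightarrow> real \<Rightarrow> bool \<Rightarrow> real \<Rightarrow> (real \<Rightarrow> complex) \<Rightarrow> (real \<Rightarrow> complex) \<Rightarrow> real \<Rightarrow> complex" where
  "source \<epsilon> t s \<tau> r \<zeta> b a x = \<epsilon> *\<^sub>R (t *\<^sub>R ((\<i> * of_real s) * b x) + coupling \<tau> r b x + \<epsilon> *\<^sub>R (\<zeta> *\<^sub>R a x))"

lemma decays_source:
  assumes "decays \<kappa> a" "decays \<kappa> b"
  shows "decays \<kappa> (source \<epsilon> t s \<tau> r \<zeta> b a)"
proof -
  have "decays \<kappa> (\<lambda>x. if r then b (- x) else cnj (b x))"
    using assms decays_cnj decays_reflect by (cases r) auto
  then show ?thesis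
    unfolding source_def[abs_def] coupling_def scaleR_conv_of_real
    by (intro decays_cmult decays_add assms)
qed

text \<open>The conjugation reverses only the term with \<open>\<i> * s\<close>; the other two terms
  commute with the symmetry.\<close>

lemma reflect_source:
  "- cnj (source \<epsilon> t s \<tau> False \<zeta> b a (- x)) = source \<epsilon> t (- s) \<tau> False \<zeta> (\<lambda>x. - cnj (b (- x))) (\<lambda>x. - cnj (a (- x))) x"
  by (simp add: source_def coupling_def scaleR_conv_of_real algebra_simps)

lemma block_vector_eq_0_iff: "block_vector a b c d = 0 \<longleftrightarrow> a = 0 \<and> b = 0 \<and> c = 0 \<and> d = 0"
proof -
  have "a = 0 \<and> c = 0" if "a + c = 0" "a - c = 0" for a c :: complex
    using that by (metis add.right_neutral add_diff_cancel_left' eq_iff_diff_eq_0 mult_2 mult_eq_0_iff zero_neq_numeral)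
  then show ?thesis by (auto simp: block_vector_def vec_eq_iff forall_4)
qed

lemma scale_eq:
  fixes w :: complex
  shows "j * s = r \<Longrightarrow> w * r = r' \<Longrightarrow> j * (w * s) = r'"
  by (metis mult.left_commute)

lemma combine_eq:
  fixes j v w :: complex
  shows "j * s = r \<Longrightarrow> - j * s' = r' \<Longrightarrow> v * r + w * r' = q \<Longrightarrow> j * (v * s - w * s') = q"
  using right_diff_distrib[of j "v * s" "w * s'"] by (auto simp: mult.left_commute)

text \<open>The hypotheses on \<open>l\<close> imply \<open>k2 * z\<^sup>2 = k1\<close>: equal
  nonzero constants go with \<open>z\<^sup>2 = 1\<close> and real \<open>l\<close>, opposite ones
  with \<open>z\<^sup>2 = -1\<close> and imaginary \<open>l\<close>. Two of the four block equations
  are conjugates of the others.\<close>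

lemma thirring_mode_eq:
  fixes k1 k2 p \<omega> x :: real and y z l a b a' b' :: complex
  defines "u \<equiv> soliton Thirring \<omega> x"
  assumes l: "l * z = of_real k1" "l = of_real k2 * z"
    and a': "- \<i> * a' = (\<i> * of_real k1 * b - of_real (p\<^sup>2) * a) - (\<omega> + 2 * (u * cnj u)) * a - (- 1 + u\<^sup>2) * cnj a"
    and b': "- \<i> * b' = (\<i> * of_real k2 * a - of_real (p\<^sup>2) * b) - \<omega> * b - (1 - u\<^sup>2) * cnj b"
  shows "(\<i> * l) *s (sigma *v block_vector (y * a) (y * cnj a) (y * z * b) (y * z * cnj b)) =
        D_omega \<omega> (block_vector (y * a) (y * cnj a) (y * z * b) (y * z * cnj b))
          (block_vector (y * a') (y * cnj a') (y * z * b') (y * z * cnj b'))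
        + E_matrix Thirring p *v block_vector (y * a) (y * cnj a) (y * z * b) (y * z * cnj b)
        + W_matrix Thirring \<omega> x *v block_vector (y * a) (y * cnj a) (y * z * b) (y * z * cnj b)"
proof -
  have ca: "\<i> * cnj a' = (- \<i> * of_real k1 * cnj b - of_real (p\<^sup>2) * cnj a) - (\<omega> + 2 * (u * cnj u)) * cnj a - (- 1 + (cnj u)\<^sup>2) * a"
    using arg_cong[OF a', of cnj] by (simp add: mult.commute[of "cnj u" u])
  have cb: "\<i> * cnj b' = (- \<i> * of_real k2 * cnj a - of_real (p\<^sup>2) * cnj b) - \<omega> * cnj b - (1 - (cnj u)\<^sup>2) * b"
    using arg_cong[OF b', of cnj] by simp
  show ?thesis
    apply (rule thirring_block, unfold u_def[symmetric])
       apply (rule scale_eq[OF a'], unfold l(1)[symmetric], algebra)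
      apply (rule scale_eq[OF ca], unfold l(1)[symmetric], algebra)
     apply (rule scale_eq[OF b'], use l(2) in algebra)
    apply (rule scale_eq[OF cb], use l(2) in algebra)
    done
qed

text \<open>For a general phase the transverse term in the first equation is
  \<open>- \<i> * p * z * cnj b\<close>. It agrees with the conjugate equation only if
  \<open>\<i> * z\<close> is real, which is why \<open>z = \<i>\<close> is built in here.\<close>

lemma gross_neveu_mode_eq:
  fixes k1 k2 p \<omega> x :: real and y l a b a' b' :: complex
  defines "u \<equiv> soliton Gross_Neveu \<omega> x"
  assumes l: "l * \<i> = of_real k1" "l = of_real k2 * \<i>"
    and a': "- \<i> * a' = (\<i> * of_real k1 * b + of_real p * cnj b) - (\<omega> + 2 * (u * cnj u)) * a - (- 1 + u\<^sup>2 + 3 * (cnj u)\<^sup>2) * cnj a"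
    and b': "- \<i> * b' = (\<i> * of_real k2 * a + of_real p * cnj a) - \<omega> * b - (1 - u\<^sup>2 - (cnj u)\<^sup>2) * cnj b"
  shows "(\<i> * l) *s (sigma *v block_vector (y * a) (y * cnj a) (y * \<i> * b) (y * \<i> * cnj b)) =
        D_omega \<omega> (block_vector (y * a) (y * cnj a) (y * \<i> * b) (y * \<i> * cnj b))
          (block_vector (y * a') (y * cnj a') (y * \<i> * b') (y * \<i> * cnj b'))
        + E_matrix Gross_Neveu p *v block_vector (y * a) (y * cnj a) (y * \<i> * b) (y * \<i> * cnj b)
        + W_matrix Gross_Neveu \<omega> x *v block_vector (y * a) (y * cnj a) (y * \<i> * b) (y * \<i> * cnj b)"
proof -
  have i: "\<i> * \<i> = - 1" by simp
  have ca: "\<i> * cnj a' = (- \<i> * of_real k1 * cnj b + of_real p * b) - (\<omega> + 2 * (u * cnj u)) * cnj a - (- 1 + (cnj u)\<^sup>2 + 3 * u\<^sup>2) * a"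
    using arg_cong[OF a', of cnj] by (simp add: mult.commute[of "cnj u" u])
  have cb: "\<i> * cnj b' = (- \<i> * of_real k2 * cnj a + of_real p * a) - \<omega> * cnj b - (1 - (cnj u)\<^sup>2 - u\<^sup>2) * b"
    using arg_cong[OF b', of cnj] by simp
  show ?thesis
    apply (rule gross_neveu_block, unfold u_def[symmetric])
       apply (rule scale_eq[OF a'], unfold l(1)[symmetric], use i in algebra)
      apply (rule scale_eq[OF ca], unfold l(1)[symmetric], use i in algebra)
     apply (rule scale_eq[OF b'], use i l(2) in algebra)
    apply (rule scale_eq[OF cb], use i l(2) in algebra)
    done
qed

text \<open>Matching the terms with the real eigenvalue \<open>k\<close> requires
  \<open>N = - P\<close>, and matching those with \<open>p\<close> requires
  \<open>P = - \<i> * h\<close> and \<open>N = \<i> * h\<close>. The value of \<open>h\<close> is a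
  normalization.\<close>

lemma gross_neveu_nonlocal_eq:
  fixes k p \<omega> x :: real and a am b bm a1 a2 b1 b2 :: complex
  defines "u \<equiv> soliton Gross_Neveu \<omega> x" and "h \<equiv> (1 + \<i>) / 2" and "P \<equiv> (1 - \<i>) / 2" and "N \<equiv> (\<i> - 1) / 2"
  assumes a1: "- \<i> * a1 = (\<i> * of_real k * b + of_real p * bm) - (\<omega> + 2 * (u * cnj u)) * a - (- 1 + u\<^sup>2 + 3 * (cnj u)\<^sup>2) * cnj a"
    and a2: "- \<i> * a2 = (\<i> * of_real k * bm + of_real p * b) - (\<omega> + 2 * (u * cnj u)) * am - (- 1 + (cnj u)\<^sup>2 + 3 * u\<^sup>2) * cnj am"
    and b1: "- \<i> * b1 = (\<i> * of_real k * a + of_real p * am) - \<omega> * b - (1 - u\<^sup>2 - (cnj u)\<^sup>2) * cnj b"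
    and b2: "- \<i> * b2 = (\<i> * of_real k * am + of_real p * a) - \<omega> * bm - (1 - (cnj u)\<^sup>2 - u\<^sup>2) * cnj bm"
  shows "(\<i> * of_real k) *s (sigma *v block_vector (h * a + P * cnj am) (h * cnj a + P * am) (h * b + N * cnj bm) (h * cnj b + N * bm)) =
        D_omega \<omega> (block_vector (h * a + P * cnj am) (h * cnj a + P * am) (h * b + N * cnj bm) (h * cnj b + N * bm))
          (block_vector (h * a1 - P * cnj a2) (h * cnj a1 - P * a2) (h * b1 - N * cnj b2) (h * cnj b1 - N * b2))
        + E_matrix Gross_Neveu p *v block_vector (h * a + P * cnj am) (h * cnj a + P * am) (h * b + N * cnj bm) (h * cnj b + N * bm)
        + W_matrix Gross_Neveu \<omega> x *v block_vector (h * a + P * cnj am) (h * cnj a + P * am) (h * b + N * cnj bm) (h * cnj b + N * bm)"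
proof -
  have PN: "P = - \<i> * h" "N = \<i> * h" by (simp_all add: h_def P_def N_def field_simps)
  have ca1: "\<i> * cnj a1 = (- \<i> * of_real k * cnj b + of_real p * cnj bm) - (\<omega> + 2 * (u * cnj u)) * cnj a - (- 1 + (cnj u)\<^sup>2 + 3 * u\<^sup>2) * a"
    using arg_cong[OF a1, of cnj] by (simp add: mult.commute[of "cnj u" u])
  have ca2: "\<i> * cnj a2 = (- \<i> * of_real k * cnj bm + of_real p * cnj b) - (\<omega> + 2 * (u * cnj u)) * cnj am - (- 1 + u\<^sup>2 + 3 * (cnj u)\<^sup>2) * am"
    using arg_cong[OF a2, of cnj] by (simp add: mult.commute[of "cnj u" u])
  have cb1: "\<i> * cnj b1 = (- \<i> * of_real k * cnj a + of_real p * cnj am) - \<omega> * cnj b - (1 - (cnj u)\<^sup>2 - u\<^sup>2) * b"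
    using arg_cong[OF b1, of cnj] by simp
  have cb2: "\<i> * cnj b2 = (- \<i> * of_real k * cnj am + of_real p * cnj a) - \<omega> * cnj bm - (1 - u\<^sup>2 - (cnj u)\<^sup>2) * bm"
    using arg_cong[OF b2, of cnj] by simp
  have "- (- \<i>) * s = \<i> * s" for s by simp
  note neg = this[THEN trans, OF ca2] a2 this[THEN trans, OF cb2] b2
  show ?thesis
    apply (rule gross_neveu_block, unfold u_def[symmetric] PN)
       apply (rule combine_eq[OF a1 neg(1)], simp add: algebra_simps power2_eq_square)
      apply (rule combine_eq[OF ca1 neg(2)], simp add: algebra_simps power2_eq_square)
     apply (rule combine_eq[OF b1 neg(3)], simp add: algebra_simps power2_eq_square)
    apply (rule combine_eq[OF cb1 neg(4)], simp add: algebra_simps power2_eq_square)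
    done
qed

section \<open>Limit vectors, small parameters and the two kinds of modes\<close>

context soliton_profile
begin

lemma U_t_block:
  assumes "U = soliton m \<omega>"
  shows "U_t m \<omega> x = block_vector (dU x) (cnj (dU x)) 0 0"
  unfolding U_t_def soliton_vector_def Let_def block_vector_def add_0_right diff_0_right assms[symmetric]
  by (intro vector_derivative_at vector4_has_vector_derivative has_vector_derivative_cnj U_deriv')

lemma U_g_block: "U = soliton m \<omega> \<Longrightarrow> U_g m \<omega> x = block_vector 0 0 (\<i> * U x) (cnj (\<i> * U x))"
  by (simp add: U_g_def soliton_vector_def Let_def block_vector_def vec_eq_iff forall_4 matrix_vector_mult_def sum_4 sigma_def)

end

text \<open>The factor 16 covers the larger of two losses in rebuilding the eigenvector, 8 for the
  local and 16 for the nonlocal ansatz. With \<open>n0\<close> the norm of the limit at 0, the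
  eigenvector is then nonzero there.\<close>

lemma small_parameter:
  fixes n0 L :: real
  assumes "\<exists>\<epsilon>0>0. \<exists>C. \<forall>\<epsilon>. 0 < \<epsilon> \<and> \<epsilon> < \<epsilon>0 \<longrightarrow> Q \<epsilon> (C * \<epsilon>)" "n0 > 0"
    and "\<And>\<epsilon> \<delta>. 0 < \<epsilon> \<Longrightarrow> Q \<epsilon> \<delta> \<Longrightarrow> 16 * \<delta> < n0 \<Longrightarrow> R \<epsilon> (L * \<delta>)"
  shows "\<exists>p0>0. \<exists>K. \<forall>\<epsilon>. 0 < \<epsilon> \<and> \<epsilon> < p0 \<longrightarrow> R \<epsilon> (K * \<epsilon>)"
proof -
  obtain \<epsilon>0 C where e: "\<epsilon>0 > 0" "\<forall>\<epsilon>. 0 < \<epsilon> \<and> \<epsilon> < \<epsilon>0 \<longrightarrow> Q \<epsilon> (C * \<epsilon>)"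
    using assms(1) by (elim exE conjE) (rule that)
  define p0 where "p0 = min \<epsilon>0 (n0 / (16 * (\<bar>C\<bar> + 1)))"
  have "R \<epsilon> ((L * C) * \<epsilon>)" if "0 < \<epsilon>" "\<epsilon> < p0" for \<epsilon>
  proof -
    have "\<epsilon> < n0 / (16 * (\<bar>C\<bar> + 1))" using that by (simp add: p0_def)
    then have "16 * ((\<bar>C\<bar> + 1) * \<epsilon>) < n0" by (simp add: field_simps)
    moreover have "C * \<epsilon> \<le> (\<bar>C\<bar> + 1) * \<epsilon>" using that by (intro mult_right_mono) auto
    ultimately have "16 * (C * \<epsilon>) < n0" by linarith
    from assms(3)[OF that(1) e(2)[rule_format] this] that show ?thesis by (simp add: p0_def mult.assoc)
  qed
  moreover have "p0 > 0" using e(1) assms(2) by (simp add: p0_def)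
  ultimately show ?thesis by blast
qed

text \<open>The reduction works with \<open>\<epsilon> = \<bar>p\<bar>\<close>; the sign of
  \<open>p\<close> becomes the parameter \<sigma>, which enters Gross--Neveu through \<tau> and
  Thirring through its square.\<close>

lemma both_signs:
  fixes R :: "real \<Rightarrow> real \<Rightarrow> bool"
  assumes "\<And>\<sigma>. \<sigma>\<^sup>2 = 1 \<Longrightarrow> \<exists>p0>0. \<exists>K. \<forall>\<epsilon>. 0 < \<epsilon> \<and> \<epsilon> < p0 \<longrightarrow> R (\<epsilon> * \<sigma>) (K * \<epsilon>)"
    and mono: "\<And>p e e'. R p e \<Longrightarrow> e \<le> e' \<Longrightarrow> R p e'"
  shows "\<exists>p0>0. \<exists>K. \<forall>p. 0 < \<bar>p\<bar> \<and> \<bar>p\<bar> < p0 \<longrightarrow> R p (K * \<bar>p\<bar>)"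
proof -
  obtain p1 K1 where 1: "p1 > 0" "\<forall>\<epsilon>. 0 < \<epsilon> \<and> \<epsilon> < p1 \<longrightarrow> R \<epsilon> (K1 * \<epsilon>)"
    using assms(1)[of 1, simplified] by (elim exE conjE) (rule that)
  obtain p2 K2 where 2: "p2 > 0" "\<forall>\<epsilon>. 0 < \<epsilon> \<and> \<epsilon> < p2 \<longrightarrow> R (- \<epsilon>) (K2 * \<epsilon>)"
    using assms(1)[of "- 1", simplified] by (elim exE conjE) (rule that)
  have "R p (max K1 K2 * \<bar>p\<bar>)" if p: "0 < \<bar>p\<bar>" "\<bar>p\<bar> < min p1 p2" for p
  proof (cases "p > 0")
    case True
    then show ?thesis using 1(2)[rule_format, of p] p by (auto elim!: mono intro!: mult_right_mono)
  next
    case False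
    then show ?thesis using 2(2)[rule_format, of "- p"] p by (auto elim!: mono intro!: mult_right_mono)
  qed
  moreover have "min p1 p2 > 0" using 1 2 by simp
  ultimately show ?thesis by blast
qed

text \<open>The number \<open>e\<close> will be a multiple of \<open>\<bar>p\<bar>\<close>, which
  turns this pointwise statement in \<open>p\<close> into convergence.\<close>

definition unstable_mode :: "dirac_model \<Rightarrow> real \<Rightarrow> real \<Rightarrow> real \<Rightarrow> bool" where
  "unstable_mode m \<omega> p e \<longleftrightarrow> (\<exists>l u. Re l > 0 \<and> eigenvector m \<omega> p l u \<and> in_L2 u \<and>
     L2_norm (\<lambda>x. u x - unstable_limit m \<omega> x) \<le> e)"

definition neutral_mode :: "dirac_model \<Rightarrow> real \<Rightarrow> real \<Rightarrow> real \<Rightarrow> bool" where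
  "neutral_mode m \<omega> p e \<longleftrightarrow> (\<exists>t v w. t > 0 \<and>
     eigenvector m \<omega> p (\<i> * of_real t) v \<and> in_L2 v \<and> L2_norm (\<lambda>x. v x - neutral_limit m \<omega> x) \<le> e \<and>
     eigenvector m \<omega> p (- (\<i> * of_real t)) w \<and> in_L2 w \<and> L2_norm (\<lambda>x. w x - neutral_limit m \<omega> x) \<le> e)"

lemma unstable_mode_mono: "unstable_mode m \<omega> p e \<Longrightarrow> e \<le> e' \<Longrightarrow> unstable_mode m \<omega> p e'"
  unfolding unstable_mode_def by (elim exE conjE, intro exI conjI) (assumption | erule (1) order_trans)+

lemma neutral_mode_mono: "neutral_mode m \<omega> p e \<Longrightarrow> e \<le> e' \<Longrightarrow> neutral_mode m \<omega> p e'"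
  unfolding neutral_mode_def by (elim exE conjE, intro exI conjI) (assumption | erule (1) order_trans)+

lemma source_pointwise:
  "source \<epsilon> t s \<tau> False \<zeta> b a x = \<i> * of_real (\<epsilon> * t * s) * b x + of_real (\<epsilon> * \<tau>) * cnj (b x) + of_real (\<epsilon>\<^sup>2 * \<zeta>) * a x"
  by (simp add: source_def coupling_def scaleR_conv_of_real algebra_simps power2_eq_square)

lemma source_nonlocal:
  "source \<epsilon> t 1 \<tau> True 0 b a x = \<i> * of_real (\<epsilon> * t) * b x + of_real (\<epsilon> * \<tau>) * b (- x)"
  by (simp add: source_def coupling_def scaleR_conv_of_real algebra_simps)

context soliton_profile
begin

text \<open>\<open>s1\<close> and \<open>s2\<close> are the factors of the eigenvalue terms in the
  two blocks: equal signs lead to a real eigenvalue, opposite signs to an imaginary one.\<close>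

definition solution_near where
  "solution_near s1 s2 \<tau> r \<zeta> a0 b0 \<epsilon> \<delta> \<longleftrightarrow> (\<exists>t>0. \<exists>a b.
     dirac_eq \<alpha>p \<beta>p a (source \<epsilon> t s1 \<tau> r \<zeta> b a) \<and> dirac_eq \<alpha>m \<beta>m b (source \<epsilon> t s2 \<tau> r \<zeta> a b) \<and>
     decaying \<kappa> (\<lambda>x. a x - a0 x) \<delta> \<and> decaying \<kappa> (\<lambda>x. b x - b0 x) \<delta>)"

definition exp_norm :: real where
  "exp_norm = sqrt (LINT x|lborel. exp (- (2 * \<kappa>) * \<bar>x\<bar>))"

lemma limits_decay: "decays \<kappa> dU" "decays \<kappa> (\<lambda>x. \<i> * U x)" "decays \<kappa> (\<lambda>x. 0)"
  using decaying_dU decaying_U decaying_cmult[OF decaying_U, of 0] by (auto simp: decays_def intro: decays_cmult[unfolded decays_def])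

lemma limits_reflect: "- cnj (dU (- x)) = dU x" "- cnj (\<i> * U (- x)) = \<i> * U x"
  by (simp_all add: dU_sym U_sym)

lemma pointwise_mode:
  fixes y z l :: complex
  assumes model: "U = soliton m \<omega>"
      "m = Thirring \<and> g = 0 \<and> \<tau> = 0 \<and> \<zeta> = -1 \<and> p\<^sup>2 = \<epsilon>\<^sup>2 \<or> m = Gross_Neveu \<and> g = 1 \<and> \<epsilon> * \<tau> = p \<and> \<zeta> = 0 \<and> z = \<i>"
    and eqs: "dirac_eq \<alpha>p \<beta>p a (source \<epsilon> t s1 \<tau> False \<zeta> b a)" "dirac_eq \<alpha>m \<beta>m b (source \<epsilon> t s2 \<tau> False \<zeta> a b)"
    and close: "decaying \<kappa> (\<lambda>x. a x - a0 x) \<delta>" "decaying \<kappa> (\<lambda>x. b x - b0 x) \<delta>"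
    and lim: "decays \<kappa> a0" "decays \<kappa> b0"
    and yz: "norm y = 1" "norm z = 1"
    and l: "l * z = of_real (\<epsilon> * t * s1)" "l = of_real (\<epsilon> * t * s2) * z"
    and V: "\<And>x. V x = block_vector (y * a0 x) (y * cnj (a0 x)) (y * z * b0 x) (y * z * cnj (b0 x))"
    and nz: "16 * \<delta> < norm (V 0)"
  shows "\<exists>u. eigenvector m \<omega> p l u \<and> in_L2 u \<and> L2_norm (\<lambda>x. u x - V x) \<le> 8 * exp_norm * \<delta>"
proof -
  have dec: "decays \<kappa> a" "decays \<kappa> b" by (rule decays_near[OF lim(1) close(1)], rule decays_near[OF lim(2) close(2)])
  have "8 * \<delta> < norm (V 0)" using nz decaying_nonneg[OF close(1)] by linarith
  note nz' = this[unfolded V]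
  have "\<exists>u. eigenvector m \<omega> p l u \<and> in_L2 u \<and>
    L2_norm (\<lambda>x. u x - block_vector (y * a0 x) (y * cnj (a0 x)) (y * z * b0 x) (y * z * cnj (b0 x)))
      \<le> 8 * \<delta> * sqrt (LINT x|lborel. exp (- (2 * \<kappa>) * \<bar>x\<bar>))"
  proof (rule mode_pointwise[OF eqs decays_source[OF dec] decays_source[OF dec(2,1)] lim close yz nz'], goal_cases)
    case (1 x a' b')
    show ?case
      using model(2)
    proof (elim disjE conjE)
      assume *: "m = Thirring" "g = 0" "\<tau> = 0" "\<zeta> = -1" "p\<^sup>2 = \<epsilon>\<^sup>2"
      show ?thesis unfolding *(1)
        by (rule thirring_mode_eq[OF l]; use 1 in \<open>simp add: model(1) * source_pointwise\<close>)
    next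
      assume *: "m = Gross_Neveu" "g = 1" "\<epsilon> * \<tau> = p" "\<zeta> = 0" "z = \<i>"
      show ?thesis unfolding *(1,5)
        by (rule gross_neveu_mode_eq[OF l[unfolded *(5)]]; use 1 in \<open>simp add: model(1) * source_pointwise\<close>)
    qed
  qed
  moreover have "8 * \<delta> * sqrt (LINT x|lborel. exp (- (2 * \<kappa>) * \<bar>x\<bar>)) = 8 * exp_norm * \<delta>" by (simp add: exp_norm_def)
  ultimately show ?thesis unfolding V by (simp only:)
qed

text \<open>The symmetry of \<open>dirac_eq_reflect\<close> reverses the signs of \<open>s1\<close>
  and \<open>s2\<close>, hence turns the mode for \<open>\<i> * \<epsilon> * t\<close> into one for
  the negative eigenvalue with the same \<open>t\<close>. The limits are fixed by the symmetry, so
  both modes share them.\<close>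

lemma neutral_pair:
  fixes y :: complex
  assumes model: "U = soliton m \<omega>"
      "m = Thirring \<and> g = 0 \<and> \<tau> = 0 \<and> \<zeta> = -1 \<and> p\<^sup>2 = \<epsilon>\<^sup>2 \<or> m = Gross_Neveu \<and> g = 1 \<and> \<epsilon> * \<tau> = p \<and> \<zeta> = 0"
    and near: "solution_near (- 1) 1 \<tau> False \<zeta> a0 b0 \<epsilon> \<delta>" "\<epsilon> > 0"
    and lim: "decays \<kappa> a0" "decays \<kappa> b0" "\<And>x. - cnj (a0 (- x)) = a0 x" "\<And>x. - cnj (b0 (- x)) = b0 x"
    and y: "norm y = 1"
    and V: "\<And>x. neutral_limit m \<omega> x = block_vector (y * a0 x) (y * cnj (a0 x)) (y * \<i> * b0 x) (y * \<i> * cnj (b0 x))"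
    and nz: "16 * \<delta> < norm (neutral_limit m \<omega> 0)"
  shows "neutral_mode m \<omega> p (8 * exp_norm * \<delta>)"
proof -
  from near(1) obtain t a b where t: "t > 0" and eqs: "dirac_eq \<alpha>p \<beta>p a (source \<epsilon> t (- 1) \<tau> False \<zeta> b a)"
      "dirac_eq \<alpha>m \<beta>m b (source \<epsilon> t 1 \<tau> False \<zeta> a b)"
      and close: "decaying \<kappa> (\<lambda>x. a x - a0 x) \<delta>" "decaying \<kappa> (\<lambda>x. b x - b0 x) \<delta>"
    unfolding solution_near_def by (elim exE conjE) (rule that)
  define a2 where "a2 = (\<lambda>x. - cnj (a (- x)))"
  define b2 where "b2 = (\<lambda>x. - cnj (b (- x)))"
  have eqs2: "dirac_eq \<alpha>p \<beta>p a2 (source \<epsilon> t 1 \<tau> False \<zeta> b2 a2)" "dirac_eq \<alpha>m \<beta>m b2 (source \<epsilon> t (- 1) \<tau> False \<zeta> a2 b2)"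
    using reflect_solutions(1)[OF eqs(1)] reflect_solutions(2)[OF eqs(2)]
    unfolding reflect_source a2_def[symmetric] b2_def[symmetric] by simp_all
  have refl: "decaying \<kappa> (\<lambda>x. - cnj (f (- x)) - f0 x) \<delta>"
    if d: "decaying \<kappa> (\<lambda>x. f x - f0 x) \<delta>" and s: "\<And>x. - cnj (f0 (- x)) = f0 x" for f f0
  proof -
    have e: "cnj (f0 (- x)) = - f0 x" for x using s[of x] by (metis minus_minus)
    show ?thesis
      using decaying_cmult[OF decaying_cnj[OF decaying_reflect[OF d]], of "- 1"] by (simp add: e)
  qed
  have close2: "decaying \<kappa> (\<lambda>x. a2 x - a0 x) \<delta>" "decaying \<kappa> (\<lambda>x. b2 x - b0 x) \<delta>"
    unfolding a2_def b2_def by (rule refl[OF close(1) lim(3)], rule refl[OF close(2) lim(4)])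
  have model': "m = Thirring \<and> g = 0 \<and> \<tau> = 0 \<and> \<zeta> = -1 \<and> p\<^sup>2 = \<epsilon>\<^sup>2 \<or> m = Gross_Neveu \<and> g = 1 \<and> \<epsilon> * \<tau> = p \<and> \<zeta> = 0 \<and> \<i> = \<i>"
    using model(2) by simp
  have i: "norm \<i> = 1" by simp
  have "\<exists>v. eigenvector m \<omega> p (\<i> * of_real (\<epsilon> * t)) v \<and> in_L2 v \<and> L2_norm (\<lambda>x. v x - neutral_limit m \<omega> x) \<le> 8 * exp_norm * \<delta>"
    by (rule pointwise_mode[OF model(1) model' eqs close lim(1,2) y i _ _ V nz]) (simp_all add: mult_ac)
  moreover have "\<exists>v. eigenvector m \<omega> p (- (\<i> * of_real (\<epsilon> * t))) v \<and> in_L2 v \<and> L2_norm (\<lambda>x. v x - neutral_limit m \<omega> x) \<le> 8 * exp_norm * \<delta>"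
    by (rule pointwise_mode[OF model(1) model' eqs2 close2 lim(1,2) y i _ _ V nz]) (simp_all add: mult_ac)
  moreover have "\<epsilon> * t > 0" using near(2) t by simp
  ultimately show ?thesis unfolding neutral_mode_def by blast
qed

lemma nonlocal_mode:
  assumes model: "U = soliton Gross_Neveu \<omega>" "g = 1" "\<epsilon> * \<tau> = p"
    and near: "solution_near 1 1 \<tau> True 0 (\<lambda>x. 0) (\<lambda>x. \<i> * U x) \<epsilon> \<delta>" "\<epsilon> > 0"
    and nz: "16 * \<delta> < norm (unstable_limit Gross_Neveu \<omega> 0)"
  shows "unstable_mode Gross_Neveu \<omega> p (16 * exp_norm * \<delta>)"
proof -
  from near(1) obtain t a b where t: "t > 0" and eqs: "dirac_eq \<alpha>p \<beta>p a (source \<epsilon> t 1 \<tau> True 0 b a)"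
      "dirac_eq \<alpha>m \<beta>m b (source \<epsilon> t 1 \<tau> True 0 a b)"
      and close: "decaying \<kappa> (\<lambda>x. a x - 0) \<delta>" "decaying \<kappa> (\<lambda>x. b x - \<i> * U x) \<delta>"
    unfolding solution_near_def by (elim exE conjE) (rule that)
  have dec: "decays \<kappa> a" "decays \<kappa> b"
    by (rule decays_near[OF limits_decay(3) close(1)], rule decays_near[OF limits_decay(2) close(2)])
  \<comment> \<open>For \<open>f (- x) = - cnj (f x)\<close> the weights add up to
    \<open>(1 + \<i>) / 2 - (\<i> - 1) / 2 = 1\<close>; this is the normalization that makes the
    limit exactly the gauge vector.\<close>
  have half: "(1 + \<i>) / 2 * (\<i> * U x) + (\<i> - 1) / 2 * cnj (\<i> * U (- x)) = \<i> * U x"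
    "(1 + \<i>) / 2 * cnj (\<i> * U x) + (\<i> - 1) / 2 * (\<i> * U (- x)) = cnj (\<i> * U x)" for x
    by (simp_all add: U_sym field_simps)
  have V: "unstable_limit Gross_Neveu \<omega> x = block_vector ((1 + \<i>) / 2 * 0 + (1 - \<i>) / 2 * cnj 0) ((1 + \<i>) / 2 * cnj 0 + (1 - \<i>) / 2 * 0)
    ((1 + \<i>) / 2 * (\<i> * U x) + (\<i> - 1) / 2 * cnj (\<i> * U (- x))) ((1 + \<i>) / 2 * cnj (\<i> * U x) + (\<i> - 1) / 2 * (\<i> * U (- x)))" for x
    unfolding half by (simp add: U_g_block[OF model(1)])
  note nz' = nz[unfolded V]
  have "\<exists>u. eigenvector Gross_Neveu \<omega> p (of_real (\<epsilon> * t)) u \<and> in_L2 u \<and> L2_norm (\<lambda>x. u x - block_vector ((1 + \<i>) / 2 * 0 + (1 - \<i>) / 2 * cnj 0) ((1 + \<i>) / 2 * cnj 0 + (1 - \<i>) / 2 * 0)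
    ((1 + \<i>) / 2 * (\<i> * U x) + (\<i> - 1) / 2 * cnj (\<i> * U (- x))) ((1 + \<i>) / 2 * cnj (\<i> * U x) + (\<i> - 1) / 2 * (\<i> * U (- x))))
      \<le> 8 * (2 * \<delta>) * sqrt (LINT x|lborel. exp (- (2 * \<kappa>) * \<bar>x\<bar>))"
  proof (rule mode_nonlocal[OF eqs decays_source[OF dec] decays_source[OF dec(2,1)] limits_decay(3,2) close nz'], goal_cases)
    case (1 x a1 a2 b1 b2)
    show ?case
      by (rule gross_neveu_nonlocal_eq; use 1 in \<open>simp add: model source_nonlocal\<close>)
  qed
  note mode = this
  have e: "8 * (2 * \<delta>) * sqrt (LINT x|lborel. exp (- (2 * \<kappa>) * \<bar>x\<bar>)) = 16 * exp_norm * \<delta>" by (simp add: exp_norm_def)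
  have "\<exists>u. eigenvector Gross_Neveu \<omega> p (of_real (\<epsilon> * t)) u \<and> in_L2 u \<and> L2_norm (\<lambda>x. u x - unstable_limit Gross_Neveu \<omega> x) \<le> 16 * exp_norm * \<delta>"
    using mode unfolding V[symmetric] e .
  moreover have "Re (of_real (\<epsilon> * t)) > 0" using near(2) t by simp
  ultimately show ?thesis unfolding unstable_mode_def by blast
qed

end

section \<open>The unstable and neutral branches of the two models\<close>

context soliton_variation
begin

lemma translation_near:
  assumes "\<tau> = 0 \<and> \<zeta> = -1 \<and> sg = -1 \<or> \<tau>\<^sup>2 = 1 \<and> \<zeta> = 0 \<and> sg = 1 \<and> g = 1 \<and> \<omega> > 0" "s1 * s2 * sg < 0"
  shows "\<exists>\<epsilon>0>0. \<exists>C. \<forall>\<epsilon>. 0 < \<epsilon> \<and> \<epsilon> < \<epsilon>0 \<longrightarrow> solution_near s1 s2 \<tau> r \<zeta> dU (\<lambda>x. 0) \<epsilon> (C * \<epsilon>)"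
  using translation_branch[OF assms, of r] unfolding solution_near_def source_def[abs_def] diff_0_right .

lemma gauge_near:
  assumes "\<tau> = 0 \<and> \<zeta> = -1 \<and> sg = -1 \<or> \<tau>\<^sup>2 = 1 \<and> \<zeta> = 0 \<and> sg = 1 \<and> g = 1 \<and> \<omega> > 0" "s1 * s2 * sg > 0"
  shows "\<exists>\<epsilon>0>0. \<exists>C. \<forall>\<epsilon>. 0 < \<epsilon> \<and> \<epsilon> < \<epsilon>0 \<longrightarrow> solution_near s1 s2 \<tau> r \<zeta> (\<lambda>x. 0) (\<lambda>x. \<i> * U x) \<epsilon> (C * \<epsilon>)"
proof -
  from gauge_branch[OF assms, of r, folded source_def]
  obtain \<epsilon>0 C where e: "\<epsilon>0 > 0" "\<forall>\<epsilon>. 0 < \<epsilon> \<and> \<epsilon> < \<epsilon>0 \<longrightarrow> (\<exists>t>0. \<exists>b a.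
      dirac_eq \<alpha>m \<beta>m b (\<lambda>x. source \<epsilon> t s2 \<tau> r \<zeta> a b x) \<and> dirac_eq \<alpha>p \<beta>p a (\<lambda>x. source \<epsilon> t s1 \<tau> r \<zeta> b a x) \<and>
      decaying \<kappa> (\<lambda>x. b x - \<i> * U x) (C * \<epsilon>) \<and> decaying \<kappa> a (C * \<epsilon>))"
    by (elim exE conjE) (rule that)
  have "solution_near s1 s2 \<tau> r \<zeta> (\<lambda>x. 0) (\<lambda>x. \<i> * U x) \<epsilon> (C * \<epsilon>)" if "0 < \<epsilon> \<and> \<epsilon> < \<epsilon>0" for \<epsilon>
    using e(2)[rule_format, OF that] unfolding solution_near_def diff_0_right
    by (elim exE conjE) (rule exI conjI | assumption)+
  then show ?thesis using e(1) by blast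
qed

lemma U_t_norm_pos: "U = soliton m \<omega> \<Longrightarrow> 0 < norm (U_t m \<omega> 0)"
  using p.psi_nonzero[of 0] by (simp add: U_t_block block_vector_eq_0_iff del: p.psi_nonzero)

lemma U_g_norm_pos: "U = soliton m \<omega> \<Longrightarrow> 0 < norm (U_g m \<omega> 0)"
  using U_nonzero[of 0] by (simp add: U_g_block block_vector_eq_0_iff)

lemma limits_in_L2:
  assumes "U = soliton m \<omega>"
  shows "in_L2 (U_t m \<omega>)" "in_L2 (U_g m \<omega>)"
  using in_L2_block_vector[OF _ limits_decay(1) decays_cnj[OF limits_decay(1)] limits_decay(3,3)]
    in_L2_block_vector[OF _ limits_decay(3,3,2) decays_cnj[OF limits_decay(2)]] mu
  unfolding U_t_block[OF assms, abs_def] U_g_block[OF assms, abs_def] by auto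

text \<open>With \<open>sg = -1\<close> the translation vector bifurcates for
  \<open>s1 = s2 = 1\<close>, which means a real eigenvalue and relative phase
  \<open>z = 1\<close>.\<close>

lemma thirring_unstable:
  assumes U: "U = soliton Thirring \<omega>" and g: "g = 0" and \<sigma>: "\<sigma>\<^sup>2 = 1"
  shows "\<exists>p0>0. \<exists>K. \<forall>\<epsilon>. 0 < \<epsilon> \<and> \<epsilon> < p0 \<longrightarrow> unstable_mode Thirring \<omega> (\<epsilon> * \<sigma>) (K * \<epsilon>)"
proof (rule small_parameter[OF translation_near[where sg = "-1"] U_t_norm_pos[OF U]])
  fix \<epsilon> \<delta> :: real
  assume \<epsilon>: "\<epsilon> > 0" and near: "solution_near 1 1 0 False (- 1) dU (\<lambda>x. 0) \<epsilon> \<delta>" and nz: "16 * \<delta> < norm (U_t Thirring \<omega> 0)"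
  from near obtain t a b where t: "t > 0" and eqs: "dirac_eq \<alpha>p \<beta>p a (source \<epsilon> t 1 0 False (- 1) b a)"
      "dirac_eq \<alpha>m \<beta>m b (source \<epsilon> t 1 0 False (- 1) a b)"
      and close: "decaying \<kappa> (\<lambda>x. a x - dU x) \<delta>" "decaying \<kappa> (\<lambda>x. b x - 0) \<delta>"
    unfolding solution_near_def by (elim exE conjE) (rule that)
  have "\<exists>u. eigenvector Thirring \<omega> (\<epsilon> * \<sigma>) (of_real (\<epsilon> * t)) u \<and> in_L2 u \<and> L2_norm (\<lambda>x. u x - U_t Thirring \<omega> x) \<le> 8 * exp_norm * \<delta>"
    by (rule pointwise_mode[where y = 1 and z = 1 and a = a and b = b and ?a0.0 = dU and ?b0.0 = "\<lambda>x. 0" and V = "U_t Thirring \<omega>", OF U _ eqs close limits_decay(1,3)])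
       (use nz g \<sigma> in \<open>simp_all add: U_t_block[OF U] power_mult_distrib\<close>)
  moreover have "Re (of_real (\<epsilon> * t)) > 0" using \<epsilon> t by simp
  ultimately show "unstable_mode Thirring \<omega> (\<epsilon> * \<sigma>) (8 * exp_norm * \<delta>)"
    unfolding unstable_mode_def unstable_limit.simps by blast
qed simp_all

text \<open>The opposite signs \<open>s1 = -1\<close> and \<open>s2 = 1\<close> make the product
  with \<open>sg = -1\<close> positive, so the gauge vector bifurcates with imaginary eigenvalues.
  The phase \<open>y = - \<i>\<close> cancels \<open>z = \<i>\<close> in the limit.\<close>

lemma thirring_neutral:
  assumes U: "U = soliton Thirring \<omega>" and g: "g = 0" and \<sigma>: "\<sigma>\<^sup>2 = 1"
  shows "\<exists>p0>0. \<exists>K. \<forall>\<epsilon>. 0 < \<epsilon> \<and> \<epsilon> < p0 \<longrightarrow> neutral_mode Thirring \<omega> (\<epsilon> * \<sigma>) (K * \<epsilon>)"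
proof (rule small_parameter[OF gauge_near[where sg = "-1"] U_g_norm_pos[OF U]])
  fix \<epsilon> \<delta> :: real
  assume \<epsilon>: "\<epsilon> > 0" and near: "solution_near (- 1) 1 0 False (- 1) (\<lambda>x. 0) (\<lambda>x. \<i> * U x) \<epsilon> \<delta>"
    and nz: "16 * \<delta> < norm (U_g Thirring \<omega> 0)"
  show "neutral_mode Thirring \<omega> (\<epsilon> * \<sigma>) (8 * exp_norm * \<delta>)"
    by (rule neutral_pair[where y = "- \<i>" and ?a0.0 = "\<lambda>x. 0" and ?b0.0 = "\<lambda>x. \<i> * U x", OF U _ near \<epsilon> limits_decay(3,2) _ limits_reflect(2)])
       (use nz g \<sigma> in \<open>simp_all add: U_g_block[OF U] power_mult_distrib\<close>)
qed simp_all

text \<open>With \<open>sg = 1\<close> the gauge vector bifurcates for equal signs, that is for a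
  real eigenvalue, and the reflection coupling handles the transverse term.\<close>

lemma gross_neveu_unstable:
  assumes U: "U = soliton Gross_Neveu \<omega>" and g: "g = 1" and \<omega>: "\<omega> > 0" and \<sigma>: "\<sigma>\<^sup>2 = 1"
  shows "\<exists>p0>0. \<exists>K. \<forall>\<epsilon>. 0 < \<epsilon> \<and> \<epsilon> < p0 \<longrightarrow> unstable_mode Gross_Neveu \<omega> (\<epsilon> * \<sigma>) (K * \<epsilon>)"
proof (rule small_parameter[OF gauge_near[where sg = 1] U_g_norm_pos[OF U]])
  fix \<epsilon> \<delta> :: real
  assume \<epsilon>: "\<epsilon> > 0" and near: "solution_near 1 1 \<sigma> True 0 (\<lambda>x. 0) (\<lambda>x. \<i> * U x) \<epsilon> \<delta>"
    and nz: "16 * \<delta> < norm (U_g Gross_Neveu \<omega> 0)"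
  show "unstable_mode Gross_Neveu \<omega> (\<epsilon> * \<sigma>) (16 * exp_norm * \<delta>)"
    using nonlocal_mode[OF U g refl near \<epsilon>] nz by simp
qed (use g \<omega> \<sigma> in simp_all)

text \<open>The translation vector now needs opposite signs; the eigenvalues are imaginary, and
  \<open>z = \<i>\<close> suits the local coupling.\<close>

lemma gross_neveu_neutral:
  assumes U: "U = soliton Gross_Neveu \<omega>" and g: "g = 1" and \<omega>: "\<omega> > 0" and \<sigma>: "\<sigma>\<^sup>2 = 1"
  shows "\<exists>p0>0. \<exists>K. \<forall>\<epsilon>. 0 < \<epsilon> \<and> \<epsilon> < p0 \<longrightarrow> neutral_mode Gross_Neveu \<omega> (\<epsilon> * \<sigma>) (K * \<epsilon>)"
proof (rule small_parameter[OF translation_near[where sg = 1] U_t_norm_pos[OF U]])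
  fix \<epsilon> \<delta> :: real
  assume \<epsilon>: "\<epsilon> > 0" and near: "solution_near (- 1) 1 \<sigma> False 0 dU (\<lambda>x. 0) \<epsilon> \<delta>"
    and nz: "16 * \<delta> < norm (U_t Gross_Neveu \<omega> 0)"
  show "neutral_mode Gross_Neveu \<omega> (\<epsilon> * \<sigma>) (8 * exp_norm * \<delta>)"
    by (rule neutral_pair[where y = 1 and ?a0.0 = dU and ?b0.0 = "\<lambda>x. 0", OF U _ near \<epsilon> limits_decay(1,3) limits_reflect(1)])
       (use nz g in \<open>simp_all add: U_t_block[OF U]\<close>)
qed (use g \<omega> \<sigma> in simp_all)

lemma mode_branches:
  assumes U: "U = soliton m \<omega>" and g: "g = (case m of Thirring \<Rightarrow> 0 | Gross_Neveu \<Rightarrow> 1)" and \<omega>: "\<omega> \<in> existence_interval m"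
    and \<sigma>: "\<sigma>\<^sup>2 = 1"
  shows "\<exists>p0>0. \<exists>K. \<forall>\<epsilon>. 0 < \<epsilon> \<and> \<epsilon> < p0 \<longrightarrow> unstable_mode m \<omega> (\<epsilon> * \<sigma>) (K * \<epsilon>)"
    and "\<exists>p0>0. \<exists>K. \<forall>\<epsilon>. 0 < \<epsilon> \<and> \<epsilon> < p0 \<longrightarrow> neutral_mode m \<omega> (\<epsilon> * \<sigma>) (K * \<epsilon>)"
  using assms thirring_unstable thirring_neutral gross_neveu_unstable gross_neveu_neutral
  by (cases m; simp)+

end

theorem theorem3p3:
  fixes m :: dirac_model and \<omega> :: real
  assumes "\<omega> \<in> existence_interval m"
  shows "\<exists>p0>0.
    (\<exists>(l :: real \<Rightarrow> complex) (u :: real \<Rightarrow> real \<Rightarrow> complex^4).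
       (\<forall>p. 0 < \<bar>p\<bar> \<and> \<bar>p\<bar> < p0 \<longrightarrow> Re (l p) > 0 \<and> eigenvector m \<omega> p (l p) (u p)) \<and>
       L2_tendsto u (unstable_limit m \<omega>) (at 0)) \<and>
    (\<exists>(\<tau> :: real \<Rightarrow> real) (v :: real \<Rightarrow> real \<Rightarrow> complex^4) (w :: real \<Rightarrow> real \<Rightarrow> complex^4).
       (\<forall>p. 0 < \<bar>p\<bar> \<and> \<bar>p\<bar> < p0 \<longrightarrow>
          \<tau> p > 0 \<and>
          eigenvector m \<omega> p (\<i> * of_real (\<tau> p)) (v p) \<and>
          eigenvector m \<omega> p (- (\<i> * of_real (\<tau> p))) (w p)) \<and>
       L2_tendsto v (neutral_limit m \<omega>) (at 0) \<and>
       L2_tendsto w (neutral_limit m \<omega>) (at 0))"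
proof -
  obtain c C k dw M where "soliton_variation (soliton m \<omega>) \<omega> (soliton_mu \<omega>) (case m of Thirring \<Rightarrow> 0 | Gross_Neveu \<Rightarrow> 1) c C k dw M"
    using soliton_variation_exists[OF assms] by (elim exE) (rule that)
  then interpret soliton_variation "soliton m \<omega>" \<omega> "soliton_mu \<omega>" "case m of Thirring \<Rightarrow> 0 | Gross_Neveu \<Rightarrow> 1" c C k dw M .
  have L2: "in_L2 (unstable_limit m \<omega>)" "in_L2 (neutral_limit m \<omega>)"
    using limits_in_L2[OF refl] by (cases m; simp)+
  obtain p1 K1 where 1: "p1 > 0" "\<forall>p. 0 < \<bar>p\<bar> \<and> \<bar>p\<bar> < p1 \<longrightarrow> unstable_mode m \<omega> p (K1 * \<bar>p\<bar>)"
  proof -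
    have "\<exists>p0>0. \<exists>K. \<forall>p. 0 < \<bar>p\<bar> \<and> \<bar>p\<bar> < p0 \<longrightarrow> unstable_mode m \<omega> p (K * \<bar>p\<bar>)"
      by (rule both_signs[where R = "unstable_mode m \<omega>"], erule mode_branches(1)[OF refl refl assms], erule (1) unstable_mode_mono)
    then show ?thesis by (elim exE conjE) (rule that)
  qed
  obtain p2 K2 where 2: "p2 > 0" "\<forall>p. 0 < \<bar>p\<bar> \<and> \<bar>p\<bar> < p2 \<longrightarrow> neutral_mode m \<omega> p (K2 * \<bar>p\<bar>)"
  proof -
    have "\<exists>p0>0. \<exists>K. \<forall>p. 0 < \<bar>p\<bar> \<and> \<bar>p\<bar> < p0 \<longrightarrow> neutral_mode m \<omega> p (K * \<bar>p\<bar>)"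
      by (rule both_signs[where R = "neutral_mode m \<omega>"], erule mode_branches(2)[OF refl refl assms], erule (1) neutral_mode_mono)
    then show ?thesis by (elim exE conjE) (rule that)
  qed
  define p0 where "p0 = min p1 p2"
  have p0: "p0 > 0" using 1 2 by (simp add: p0_def)
  \<comment> \<open>Modes are available separately for each \<open>p\<close>, so choice assembles
    them into functions of \<open>p\<close>; convergence comes from the bound by a multiple of
    \<open>\<bar>p\<bar>\<close> and not from continuity in \<open>p\<close>.\<close>
  have "\<forall>p. \<exists>lu. 0 < \<bar>p\<bar> \<and> \<bar>p\<bar> < p0 \<longrightarrow> Re (fst lu) > 0 \<and> eigenvector m \<omega> p (fst lu) (snd lu) \<and> in_L2 (snd lu) \<and>
      L2_norm (\<lambda>x. snd lu x - unstable_limit m \<omega> x) \<le> K1 * \<bar>p\<bar>"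
    using 1(2) unfolding unstable_mode_def p0_def by (simp add: split_paired_Ex)
  from choice[OF this] obtain lu where lu: "\<forall>p. 0 < \<bar>p\<bar> \<and> \<bar>p\<bar> < p0 \<longrightarrow> Re (fst (lu p)) > 0 \<and> eigenvector m \<omega> p (fst (lu p)) (snd (lu p)) \<and> in_L2 (snd (lu p)) \<and>
      L2_norm (\<lambda>x. snd (lu p) x - unstable_limit m \<omega> x) \<le> K1 * \<bar>p\<bar>"
    by (elim exE) (rule that)
  have "\<forall>p. \<exists>tvw. 0 < \<bar>p\<bar> \<and> \<bar>p\<bar> < p0 \<longrightarrow> fst tvw > 0 \<and>
     eigenvector m \<omega> p (\<i> * of_real (fst tvw)) (fst (snd tvw)) \<and> in_L2 (fst (snd tvw)) \<and>
     L2_norm (\<lambda>x. fst (snd tvw) x - neutral_limit m \<omega> x) \<le> K2 * \<bar>p\<bar> \<and>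
     eigenvector m \<omega> p (- (\<i> * of_real (fst tvw))) (snd (snd tvw)) \<and> in_L2 (snd (snd tvw)) \<and>
     L2_norm (\<lambda>x. snd (snd tvw) x - neutral_limit m \<omega> x) \<le> K2 * \<bar>p\<bar>"
    using 2(2) unfolding neutral_mode_def p0_def by (simp add: split_paired_Ex)
  from choice[OF this] obtain tvw where tvw: "\<forall>p. 0 < \<bar>p\<bar> \<and> \<bar>p\<bar> < p0 \<longrightarrow> fst (tvw p) > 0 \<and>
     eigenvector m \<omega> p (\<i> * of_real (fst (tvw p))) (fst (snd (tvw p))) \<and> in_L2 (fst (snd (tvw p))) \<and>
     L2_norm (\<lambda>x. fst (snd (tvw p)) x - neutral_limit m \<omega> x) \<le> K2 * \<bar>p\<bar> \<and>
     eigenvector m \<omega> p (- (\<i> * of_real (fst (tvw p)))) (snd (snd (tvw p))) \<and> in_L2 (snd (snd (tvw p))) \<and>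
     L2_norm (\<lambda>x. snd (snd (tvw p)) x - neutral_limit m \<omega> x) \<le> K2 * \<bar>p\<bar>"
    by (elim exE) (rule that)
  show ?thesis
  proof (rule exI[of _ p0], intro conjI p0)
    show "\<exists>l u. (\<forall>p. 0 < \<bar>p\<bar> \<and> \<bar>p\<bar> < p0 \<longrightarrow> Re (l p) > 0 \<and> eigenvector m \<omega> p (l p) (u p)) \<and>
        L2_tendsto u (unstable_limit m \<omega>) (at 0)"
      by (rule exI[of _ "\<lambda>p. fst (lu p)"], rule exI[of _ "\<lambda>p. snd (lu p)"], rule conjI)
         (use lu L2_tendsto_at_0[OF L2(1) p0, of "\<lambda>p. snd (lu p)" K1] in auto)
    show "\<exists>\<tau> v w. (\<forall>p. 0 < \<bar>p\<bar> \<and> \<bar>p\<bar> < p0 \<longrightarrow> \<tau> p > 0 \<and> eigenvector m \<omega> p (\<i> * of_real (\<tau> p)) (v p) \<and>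
          eigenvector m \<omega> p (- (\<i> * of_real (\<tau> p))) (w p)) \<and>
        L2_tendsto v (neutral_limit m \<omega>) (at 0) \<and> L2_tendsto w (neutral_limit m \<omega>) (at 0)"
      by (rule exI[of _ "\<lambda>p. fst (tvw p)"], rule exI[of _ "\<lambda>p. fst (snd (tvw p))"], rule exI[of _ "\<lambda>p. snd (snd (tvw p))"],
          intro conjI)
         (use tvw L2_tendsto_at_0[OF L2(2) p0, of "\<lambda>p. fst (snd (tvw p))" K2]
           L2_tendsto_at_0[OF L2(2) p0, of "\<lambda>p. snd (snd (tvw p))" K2] in auto)
  qed
qed

end
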